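(* Consider the interacting particle system $\bm{\widetilde X}=(\widetilde X^1,\ldots,\widetilde X^n)$ of the context with $p=2$, so that there is $\widetilde L<\infty$ with $|\widetilde b(t,x,m)-\widetilde b(t,x',m')|\le\widetilde L(|x-x'|+\mathcal W_2(m,m'))$ for all $t,x,x',m,m'$. Assume also that there exists $\kappa_0<\infty$ such that $$\mathcal W_2(\widetilde\mu_0,\nu)\le\sqrt{2\kappa_0\,\mathcal R(\nu|\widetilde\mu_0)}\qquad\text{for all }\nu\ll\widetilde\mu_0.$$ Then there exists a constant $\delta>0$, independent of $n$, such that for every $a>0$ and every $\Phi:(\mathcal C^d)^n\to\mathbb R$ that is $1$-Lipschitz with respect to $\|\bm x\|_{n,2}=\big(\sum_{i=1}^n\|x^i\|_\infty^2\big)^{1/2}$, we have $$\mathbb P\big(\Phi(\bm{\widetilde X})-\mathbb E\,\Phi(\bm{\widetilde X})>a\big)\le2e^{-\delta a^2}.$$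
   Context: $\mathcal C^d=C([0,T];\mathbb R^d)$ carries the sup norm $\|x\|_\infty=\sup_{t\in[0,T]}|x_t|$, $|\cdot|$ Euclidean. $\mathcal P^p(\mathbb R^d)$ is the set of Borel probability measures on $\mathbb R^d$ with finite $p$-th moment, with the $p$-Wasserstein distance $\mathcal W_p$ (associated to the Euclidean norm). For $\bm x\in(\mathbb R^d)^n$, $m^n_{\bm x}=\frac1n\sum_{i=1}^n\delta_{x_i}$. Relative entropy: $\mathcal R(\nu|\mu)=\int\frac{d\nu}{d\mu}\log\frac{d\nu}{d\mu}d\mu$ if $\nu\ll\mu$, $\infty$ otherwise. **Particle system.** Let $T\in(0,\infty)$, $B^1,\ldots,B^n$ i.i.d. standard $d$-dimensional Wiener processes, $\sigma\in\mathbb R^{d\times d}$, $p\in[1,2]$, and $\widetilde b:[0,T]\times\mathbb R^d\times\mathcal P^p(\mathbb R^d)\to\mathbb R^d$ jointly measurable, Lipschitz in $(x,m)$ uniformly in $t$ (Lipschitz in $m$ for $\mathcal W_p$, constant $\widetilde L$), with $\sup_{t\in[0,T]}|\widetilde b(t,0,\delta_0)|<\infty$. The system is the unique strong solution of $$d\widetilde X^i_t=\widetilde b(t,\widetilde X^i_t,m^n_{\bm{\widetilde X}_t})dt+\sigma dB^i_t,\quad i=1,\ldots,n,$$ with initial states $\widetilde X^1_0,\ldots,\widetilde X^n_0$ i.i.d. (and independent of $B^1,\ldots,B^n$) with law $\widetilde\mu_0$ satisfying $\mathbb E|\widetilde X^1_0|^2<\infty$. The data $d,T,\sigma,\widetilde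 b,\widetilde\mu_0$ do not depend on $n$. *)

theory Defs
  imports "HOL-Probability.Probability"
begin

section \<open>Wasserstein distance and relative entropy\<close>

definition prob_moment :: "real \<Rightarrow> ('a::euclidean_space) measure set" where
  "prob_moment p =
     {\<mu>. prob_space \<mu> \<and> sets \<mu> = sets borel \<and> integrable \<mu> (\<lambda>x. norm x powr p)}"

definition couplings :: "('a::euclidean_space) measure \<Rightarrow> 'a measure \<Rightarrow> ('a \<times> 'a) measure set" where
  "couplings \<mu> \<nu> =
     {\<pi>. sets \<pi> = sets (borel \<Otimes>\<^sub>M borel) \<and> distr \<pi> borel fst = \<mu> \<and> distr \<pi> borel snd = \<nu>}"

definition transport_cost :: "real \<Rightarrow> ('a::euclidean_space) measure \<Rightarrow> 'a measure \<Rightarrow> ennreal" where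
  "transport_cost p \<mu> \<nu> =
     (INF \<pi>\<in>couplings \<mu> \<nu>. \<integral>\<^sup>+ z. ennreal (norm (fst z - snd z) powr p) \<partial>\<pi>)"

text \<open>The distance takes the value \<open>\<infinity>\<close> outside \<open>prob_moment p\<close>; this matters when the transport
  inequality is applied to a measure without finite moment. The case distinction is the
  \<open>p\<close>-th root on \<open>ennreal\<close>.\<close>

definition wasserstein :: "real \<Rightarrow> ('a::euclidean_space) measure \<Rightarrow> 'a measure \<Rightarrow> ennreal" where
  "wasserstein p \<mu> \<nu> =
     (if transport_cost p \<mu> \<nu> = \<infinity> then \<infinity>
      else ennreal (enn2real (transport_cost p \<mu> \<nu>) powr (1 / p)))"

text \<open>The Borel \<open>\<sigma>\<close>-algebra of the metric space \<open>(prob_moment p, wasserstein p)\<close>, generated by the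
  metrically open sets.\<close>

definition wasserstein_borel :: "real \<Rightarrow> ('a::euclidean_space) measure measure" where
  "wasserstein_borel p = sigma (prob_moment p)
     {U. U \<subseteq> prob_moment p \<and>
         (\<forall>\<mu>\<in>U. \<exists>r>0. \<forall>\<nu>\<in>prob_moment p. wasserstein p \<mu> \<nu> < ennreal r \<longrightarrow> \<nu> \<in> U)}"

text \<open>The relative entropy of \<open>\<nu>\<close> with respect to \<open>\<mu>\<close>, for probability measures. The library's
  \<open>KL_divergence\<close> takes its arguments in the opposite order and is a Bochner integral, hence \<open>0\<close> if
  the log-density is not integrable. The negative part of the log-density is always
  \<open>\<nu>\<close>-integrable, so non-integrability means that the entropy is \<open>\<infinity>\<close>.\<close>

definition rel_entropy :: "'a measure \<Rightarrow> 'a measure \<Rightarrow> ereal" where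
  "rel_entropy \<nu> \<mu> =
     (if sets \<nu> = sets \<mu> \<and> absolutely_continuous \<mu> \<nu> \<and> integrable \<nu> (entropy_density (exp 1) \<mu> \<nu>)
      then ereal (KL_divergence (exp 1) \<mu> \<nu>) else \<infinity>)"

definition empirical :: "nat \<Rightarrow> (nat \<Rightarrow> 'a::euclidean_space) \<Rightarrow> 'a measure" where
  "empirical n x = distr (uniform_count_measure {..<n}) borel x"

lemma emeasure_empirical:
  assumes "n > 0" and A: "A \<in> sets borel"
  shows "emeasure (empirical n x) A = ennreal ((1 / real n) * (\<Sum>i<n. indicator A (x i)))"
proof -
  have "emeasure (empirical n x) A
      = emeasure (uniform_count_measure {..<n}) (x -` A \<inter> space (uniform_count_measure {..<n}))"
    unfolding empirical_def using A by (intro emeasure_distr) (auto simp: measurable_def space_uniform_count_measure sets_uniform_count_measure)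
  also have "\<dots> = ennreal (card (x -` A \<inter> {..<n}) / real n)"
    by (subst emeasure_uniform_count_measure) (auto simp: space_uniform_count_measure)
  also have "real (card (x -` A \<inter> {..<n})) = (\<Sum>i<n. indicator A (x i))"
    by (simp add: indicator_def sum.If_cases Int_commute Collect_conj_eq vimage_def)
  finally show ?thesis by simp
qed


section \<open>Path space\<close>

text \<open>A point of \<open>(C([0,T];\<real>\<^sup>d))\<^sup>n\<close> is represented by a function of which only the values at \<open>i < n\<close>
  and \<open>t \<in> [0,T]\<close> are relevant. A function on representatives that is Lipschitz for the seminorm
  below is the same thing as a Lipschitz function on \<open>(C([0,T];\<real>\<^sup>d))\<^sup>n\<close>.\<close>

definition paths :: "real \<Rightarrow> nat \<Rightarrow> (nat \<Rightarrow> real \<Rightarrow> 'a::euclidean_space) set" where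
  "paths T n = {x. \<forall>i<n. continuous_on {0..T} (x i)}"

definition path_norm :: "real \<Rightarrow> nat \<Rightarrow> (nat \<Rightarrow> real \<Rightarrow> 'a::euclidean_space) \<Rightarrow> real" where
  "path_norm T n x = sqrt (\<Sum>i<n. (SUP t\<in>{0..T}. norm (x i t))\<^sup>2)"

definition lipschitz1_paths ::
  "real \<Rightarrow> nat \<Rightarrow> ((nat \<Rightarrow> real \<Rightarrow> 'a::euclidean_space) \<Rightarrow> real) \<Rightarrow> bool" where
  "lipschitz1_paths T n \<Phi> \<longleftrightarrow>
     (\<forall>x\<in>paths T n. \<forall>y\<in>paths T n. \<bar>\<Phi> x - \<Phi> y\<bar> \<le> path_norm T n (\<lambda>i t. x i t - y i t))"


section \<open>The particle system\<close>

definition std_wiener :: "'w measure \<Rightarrow> real \<Rightarrow> (real \<Rightarrow> 'w \<Rightarrow> real ^ 'd) \<Rightarrow> bool" where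
  "std_wiener M T W \<longleftrightarrow>
     (\<forall>t\<in>{0..T}. W t \<in> borel_measurable M) \<and>
     (AE \<omega> in M. W 0 \<omega> = 0) \<and>
     (AE \<omega> in M. continuous_on {0..T} (\<lambda>t. W t \<omega>)) \<and>
     (\<forall>s t. 0 \<le> s \<and> s < t \<and> t \<le> T \<longrightarrow>
        distributed M lborel (\<lambda>\<omega>. W t \<omega> - W s \<omega>)
          (\<lambda>x. ennreal (\<Prod>k\<in>UNIV. normal_density 0 (sqrt (t - s)) (x $ k)))) \<and>
     (\<forall>m \<tau>. (\<forall>j\<le>m. \<tau> j \<in> {0..T}) \<and> (\<forall>j<m. \<tau> j < \<tau> (Suc j)) \<longrightarrow>
        prob_space.indep_vars M (\<lambda>_. borel) (\<lambda>j \<omega>. W (\<tau> (Suc j)) \<omega> - W (\<tau> j) \<omega>) {..<m})"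

text \<open>The filtration generated by the initial states and the noise, augmented by the null sets.\<close>

definition driving_filtration ::
  "'w measure \<Rightarrow> nat \<Rightarrow> (nat \<Rightarrow> 'w \<Rightarrow> real ^ 'd) \<Rightarrow> (nat \<Rightarrow> real \<Rightarrow> 'w \<Rightarrow> real ^ 'd) \<Rightarrow> real \<Rightarrow> 'w measure" where
  "driving_filtration M n \<xi> B t = sigma (space M)
     ({\<xi> i -` A \<inter> space M |i A. i < n \<and> A \<in> sets borel} \<union>
      {B i s -` A \<inter> space M |i s A. i < n \<and> s \<in> {0..t} \<and> A \<in> sets borel} \<union>
      null_sets M)"

text \<open>\<open>B i t \<omega>\<close> and \<open>X i t \<omega>\<close> are the values at time \<open>t\<close> of the \<open>i\<close>-th Wiener process and the \<open>i\<close>-th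
  particle, for \<open>i < n\<close>. The noise is additive with a constant matrix, so that its stochastic
  integral is \<open>\<sigma> *v B i t\<close> and the equation is a pathwise integral equation.\<close>

definition particle_system ::
  "real \<Rightarrow> real ^ 'd ^ 'd \<Rightarrow> (real \<Rightarrow> real ^ 'd \<Rightarrow> (real ^ 'd) measure \<Rightarrow> real ^ 'd) \<Rightarrow>
   (real ^ 'd) measure \<Rightarrow> nat \<Rightarrow> 'w measure \<Rightarrow>
   (nat \<Rightarrow> real \<Rightarrow> 'w \<Rightarrow> real ^ 'd) \<Rightarrow> (nat \<Rightarrow> real \<Rightarrow> 'w \<Rightarrow> real ^ 'd) \<Rightarrow> bool" where
  "particle_system T \<sigma> b \<mu>\<^sub>0 n M B X \<longleftrightarrow>
     prob_space M \<and>
     \<comment> \<open>i.i.d. Wiener processes, i.i.d. initial states, independent of each other\<close>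
     (\<forall>i<n. std_wiener M T (B i)) \<and>
     prob_space.indep_vars M (\<lambda>_. Pi\<^sub>M {0..T} (\<lambda>_. borel)) (\<lambda>i \<omega>. \<lambda>t\<in>{0..T}. B i t \<omega>) {..<n} \<and>
     (\<forall>i<n. X i 0 \<in> borel_measurable M \<and> distr M borel (X i 0) = \<mu>\<^sub>0) \<and>
     prob_space.indep_vars M (\<lambda>_. borel) (\<lambda>i. X i 0) {..<n} \<and>
     prob_space.indep_set M
       (sets (vimage_algebra (space M) (\<lambda>\<omega>. \<lambda>i\<in>{..<n}. X i 0 \<omega>) (Pi\<^sub>M {..<n} (\<lambda>_. borel))))
       (sets (vimage_algebra (space M) (\<lambda>\<omega>. \<lambda>i\<in>{..<n}. \<lambda>t\<in>{0..T}. B i t \<omega>)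
          (Pi\<^sub>M {..<n} (\<lambda>_. Pi\<^sub>M {0..T} (\<lambda>_. borel))))) \<and>
     \<comment> \<open>strong solution: continuous, adapted, satisfying the integral equation\<close>
     (\<forall>i<n. \<forall>\<omega>\<in>space M. continuous_on {0..T} (\<lambda>t. X i t \<omega>)) \<and>
     (\<forall>i<n. \<forall>t\<in>{0..T}. X i t \<in> borel_measurable (driving_filtration M n (\<lambda>i. X i 0) B t)) \<and>
     (AE \<omega> in M. \<forall>i<n. \<forall>t\<in>{0..T}.
        set_integrable lborel {0..t} (\<lambda>s. b s (X i s \<omega>) (empirical n (\<lambda>j. X j s \<omega>))) \<and>
        X i t \<omega> = X i 0 \<omega>
          + (LINT s:{0..t}|lborel. b s (X i s \<omega>) (empirical n (\<lambda>j. X j s \<omega>)))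
          + \<sigma> *v B i t \<omega>)"

end

theory Submission
  imports Defs
begin

text \<open>The dual form \<open>\<integral> exp g d\<mu> \<le> exp (\<integral> f d\<mu>)\<close>, for all bounded \<open>f\<close>, \<open>g\<close> with \<open>g x - f y \<le> c x y\<close>, of a
  quadratic transport inequality tensorises by Fubini's theorem alone, and applied to a multiple of a
  Lipschitz function it gives a Gaussian bound on the Laplace transform. It holds for \<open>\<mu>\<^sub>0\<close> by
  assumption and for the one-dimensional Gaussian measure by the Prekopa-Leindler inequality, hence
  for the initial states together with the Brownian increments on a grid. Since the noise is
  additive, the particle system is a Lipschitz function of the paths \<open>X\<^sub>0\<^sup>i + \<sigma> B\<^sup>i\<close>, with a constant
  that does not depend on \<open>n\<close>. This is only needed on the outcomes where the integral equation
  holds: \<open>\<Phi>(X)\<close> is extended from there to all driving paths by McShane's formula, so that no solution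
  has to be constructed for the polygonal approximations of the driving paths.\<close>

section \<open>Transport inequalities in dual form\<close>

text \<open>The inequality is the Bobkov-Goetze dual of a transport inequality with cost
  \<open>c\<close>. A product argument with optimal couplings would need measurable choices of
  conditional couplings; in the dual form only integrals of functions occur. Here \<open>g\<close>
  runs over the measurable functions below the inf-convolution of \<open>f\<close>, so that
  measurability of the infimum itself never matters. Costs add under products, and the sum of
  squares over the particles is the square of the norm in the claim; this is why the constant is
  free of \<open>n\<close>.

  Two limits shape the rest. The grid must be refined, so the bound for the increments has to be
  uniform in the number of grid points. And the pairs are bounded, while a Lipschitz functional is
  not: the estimate is made for truncations, and integrability of \<Phi>(X), without which the
  Bochner integral would not be its mean, is deduced from it.

  The midpoint form of Prekopa-Leindler yields for the standard Gaussian the cost (x - y)^2 / 4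
  instead of the sharp (x - y)^2 / 2, which only affects \<delta>.\<close>

definition dual_transport :: "'a measure \<Rightarrow> ('a \<Rightarrow> 'a \<Rightarrow> real) \<Rightarrow> bool" where
  "dual_transport \<mu> c \<longleftrightarrow> prob_space \<mu> \<and>
     (\<forall>f\<in>borel_measurable \<mu>. \<forall>g\<in>borel_measurable \<mu>. \<forall>r.
        (\<forall>x\<in>space \<mu>. \<bar>f x\<bar> \<le> r \<and> \<bar>g x\<bar> \<le> r) \<longrightarrow>
        (\<forall>x\<in>space \<mu>. \<forall>y\<in>space \<mu>. g x - f y \<le> c x y) \<longrightarrow>
        (\<integral>x. exp (g x) \<partial>\<mu>) \<le> exp (\<integral>x. f x \<partial>\<mu>))"

lemma dual_transportI:
  assumes "prob_space \<mu>"
    and "\<And>f g r. f \<in> borel_measurable \<mu> \<Longrightarrow> g \<in> borel_measurable \<mu> \<Longrightarrow>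
      (\<And>x. x \<in> space \<mu> \<Longrightarrow> \<bar>f x\<bar> \<le> r) \<Longrightarrow> (\<And>x. x \<in> space \<mu> \<Longrightarrow> \<bar>g x\<bar> \<le> r) \<Longrightarrow>
      (\<And>x y. x \<in> space \<mu> \<Longrightarrow> y \<in> space \<mu> \<Longrightarrow> g x - f y \<le> c x y) \<Longrightarrow>
      (\<integral>x. exp (g x) \<partial>\<mu>) \<le> exp (\<integral>x. f x \<partial>\<mu>)"
  shows "dual_transport \<mu> c"
  unfolding dual_transport_def
proof (intro conjI ballI allI impI)
  show "prob_space \<mu>" by fact
  fix f g r
  assume "f \<in> borel_measurable \<mu>" "g \<in> borel_measurable \<mu>"
    "\<forall>x\<in>space \<mu>. \<bar>f x\<bar> \<le> r \<and> \<bar>g x\<bar> \<le> r" "\<forall>x\<in>space \<mu>. \<forall>y\<in>space \<mu>. g x - f y \<le> c x y"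
  then show "(\<integral>x. exp (g x) \<partial>\<mu>) \<le> exp (\<integral>x. f x \<partial>\<mu>)"
    by (intro assms(2)[of f g r]) auto
qed

lemma dual_transportD:
  assumes "dual_transport \<mu> c" "f \<in> borel_measurable \<mu>" "g \<in> borel_measurable \<mu>"
    "\<And>x. x \<in> space \<mu> \<Longrightarrow> \<bar>f x\<bar> \<le> r" "\<And>x. x \<in> space \<mu> \<Longrightarrow> \<bar>g x\<bar> \<le> r"
    "\<And>x y. x \<in> space \<mu> \<Longrightarrow> y \<in> space \<mu> \<Longrightarrow> g x - f y \<le> c x y"
  shows "(\<integral>x. exp (g x) \<partial>\<mu>) \<le> exp (\<integral>x. f x \<partial>\<mu>)"
  using assms unfolding dual_transport_def by blast

lemma dual_transport_prob_space: "dual_transport \<mu> c \<Longrightarrow> prob_space \<mu>"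
  by (simp add: dual_transport_def)

text \<open>A pair admissible for \<open>c'\<close>, composed with \<open>\<phi>\<close>, is
  admissible for \<open>c\<close>.\<close>

lemma dual_transport_distr:
  assumes \<mu>: "dual_transport \<mu> c" and \<phi>: "\<phi> \<in> measurable \<mu> N"
    and c: "\<And>x y. x \<in> space \<mu> \<Longrightarrow> y \<in> space \<mu> \<Longrightarrow> c' (\<phi> x) (\<phi> y) \<le> c x y"
  shows "dual_transport (distr \<mu> N \<phi>) c'"
proof (rule dual_transportI)
  show "prob_space (distr \<mu> N \<phi>)"
    by (intro prob_space.prob_space_distr dual_transport_prob_space[OF \<mu>] \<phi>)
next
  fix f g r
  assume "f \<in> borel_measurable (distr \<mu> N \<phi>)" "g \<in> borel_measurable (distr \<mu> N \<phi>)"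
    and b: "\<And>x. x \<in> space (distr \<mu> N \<phi>) \<Longrightarrow> \<bar>f x\<bar> \<le> r" "\<And>x. x \<in> space (distr \<mu> N \<phi>) \<Longrightarrow> \<bar>g x\<bar> \<le> r"
    and d: "\<And>x y. x \<in> space (distr \<mu> N \<phi>) \<Longrightarrow> y \<in> space (distr \<mu> N \<phi>) \<Longrightarrow> g x - f y \<le> c' x y"
  then have f[measurable]: "f \<in> borel_measurable N" "g \<in> borel_measurable N" by auto
  note \<phi>[measurable]
  have \<phi>': "\<phi> x \<in> space N" if "x \<in> space \<mu>" for x
    using \<phi> that by (rule measurable_space)
  have "(\<integral>x. exp (g (\<phi> x)) \<partial>\<mu>) \<le> exp (\<integral>x. f (\<phi> x) \<partial>\<mu>)"
  proof (rule dual_transportD[OF \<mu>, of _ _ r])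
    fix x y assume "x \<in> space \<mu>" "y \<in> space \<mu>"
    then show "g (\<phi> x) - f (\<phi> y) \<le> c x y"
      using d[of "\<phi> x" "\<phi> y"] c[of x y] by (simp add: \<phi>')
  qed (use b \<phi>' in auto)
  then show "(\<integral>x. exp (g x) \<partial>distr \<mu> N \<phi>) \<le> exp (\<integral>x. f x \<partial>distr \<mu> N \<phi>)"
    by (simp add: integral_distr)
qed

lemma (in prob_space) integrable_bounded:
  fixes f :: "'a \<Rightarrow> real"
  assumes "f \<in> borel_measurable M" "\<And>x. x \<in> space M \<Longrightarrow> \<bar>f x\<bar> \<le> r"
  shows "integrable M f"
  using assms by (intro integrable_const_bound[where B = r]) auto

lemma (in prob_space) integral_in_interval:
  fixes f :: "'a \<Rightarrow> real"
  assumes "f \<in> borel_measurable M" "\<And>x. x \<in> space M \<Longrightarrow> a \<le> f x \<and> f x \<le> b"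
  shows "a \<le> (\<integral>x. f x \<partial>M)" "(\<integral>x. f x \<partial>M) \<le> b"
proof -
  have "integrable M f"
    using assms by (intro integrable_bounded[of f "max \<bar>a\<bar> \<bar>b\<bar>"]) fastforce+
  then show "a \<le> (\<integral>x. f x \<partial>M)" "(\<integral>x. f x \<partial>M) \<le> b"
    using assms by (auto intro!: integral_ge_const integral_le_const)
qed

text \<open>Fixing the first components \<open>x\<close>, \<open>y\<close> and absorbing \<open>c\<^sub>1 x y\<close> into \<open>f\<close>, the inequality for
  \<open>\<nu>\<close> shows that the logarithm of the partial integral of \<open>exp g\<close> and the partial integral of \<open>f\<close>
  are again an admissible pair for \<open>\<mu>\<close>.\<close>

lemma dual_transport_pair:
  assumes \<mu>: "dual_transport \<mu> c\<^sub>1" and \<nu>: "dual_transport \<nu> c\<^sub>2"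
  shows "dual_transport (\<mu> \<Otimes>\<^sub>M \<nu>) (\<lambda>x y. c\<^sub>1 (fst x) (fst y) + c\<^sub>2 (snd x) (snd y))"
proof (rule dual_transportI)
  interpret A: prob_space \<mu> by (rule dual_transport_prob_space[OF \<mu>])
  interpret B: prob_space \<nu> by (rule dual_transport_prob_space[OF \<nu>])
  interpret P: pair_prob_space \<mu> \<nu> ..
  show "prob_space (\<mu> \<Otimes>\<^sub>M \<nu>)" by (rule P.prob_space_axioms)
  fix f g r
  assume f[measurable]: "f \<in> borel_measurable (\<mu> \<Otimes>\<^sub>M \<nu>)" and g[measurable]: "g \<in> borel_measurable (\<mu> \<Otimes>\<^sub>M \<nu>)"
    and bf: "\<And>x. x \<in> space (\<mu> \<Otimes>\<^sub>M \<nu>) \<Longrightarrow> \<bar>f x\<bar> \<le> r" and bg: "\<And>x. x \<in> space (\<mu> \<Otimes>\<^sub>M \<nu>) \<Longrightarrow> \<bar>g x\<bar> \<le> r"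
    and d: "\<And>x y. x \<in> space (\<mu> \<Otimes>\<^sub>M \<nu>) \<Longrightarrow> y \<in> space (\<mu> \<Otimes>\<^sub>M \<nu>) \<Longrightarrow>
      g x - f y \<le> c\<^sub>1 (fst x) (fst y) + c\<^sub>2 (snd x) (snd y)"
  define G where "G x = ln (\<integral>z. exp (g (x, z)) \<partial>\<nu>)" for x
  define F where "F x = (\<integral>z. f (x, z) \<partial>\<nu>)" for x
  have I: "exp (- r) \<le> (\<integral>z. exp (g (x, z)) \<partial>\<nu>)" "(\<integral>z. exp (g (x, z)) \<partial>\<nu>) \<le> exp r"
    if "x \<in> space \<mu>" for x
    using that bg by (auto intro!: B.integral_in_interval simp: space_pair_measure abs_le_iff minus_le_iff)
  have pos: "0 < (\<integral>z. exp (g (x, z)) \<partial>\<nu>)" if "x \<in> space \<mu>" for x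
    using I(1)[OF that] exp_gt_zero[of "-r"] by linarith
  have eG: "exp (G x) = (\<integral>z. exp (g (x, z)) \<partial>\<nu>)" if "x \<in> space \<mu>" for x
    using pos[OF that] by (simp add: G_def)
  have bG: "\<bar>G x\<bar> \<le> r" if "x \<in> space \<mu>" for x
  proof -
    have "exp (- r) \<le> exp (G x)" "exp (G x) \<le> exp r"
      using I[OF that] by (simp_all add: eG that)
    then show ?thesis unfolding exp_le_cancel_iff by simp
  qed
  have bF: "\<bar>F x\<bar> \<le> r" if "x \<in> space \<mu>" for x
    using B.integral_in_interval[of "\<lambda>z. f (x, z)" "-r" r] that bf
    by (simp add: F_def space_pair_measure abs_le_iff minus_le_iff)
  have mF[measurable]: "F \<in> borel_measurable \<mu>" and mG[measurable]: "G \<in> borel_measurable \<mu>"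
    unfolding F_def G_def by measurable
  have "(\<integral>x. exp (G x) \<partial>\<mu>) \<le> exp (\<integral>x. F x \<partial>\<mu>)"
  proof (rule dual_transportD[OF \<mu> mF mG bF bG])
    fix x y assume x: "x \<in> space \<mu>" and y: "y \<in> space \<mu>"
    have "(\<integral>z. exp (g (x, z)) \<partial>\<nu>) \<le> exp (\<integral>z. f (y, z) + c\<^sub>1 x y \<partial>\<nu>)"
    proof (rule dual_transportD[OF \<nu>, of _ _ "r + \<bar>c\<^sub>1 x y\<bar>"])
      fix z assume "z \<in> space \<nu>"
      then show "\<bar>f (y, z) + c\<^sub>1 x y\<bar> \<le> r + \<bar>c\<^sub>1 x y\<bar>" "\<bar>g (x, z)\<bar> \<le> r + \<bar>c\<^sub>1 x y\<bar>"
        using bf[of "(y, z)"] bg[of "(x, z)"] x y by (auto simp: space_pair_measure)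
    next
      fix z z' assume "z \<in> space \<nu>" "z' \<in> space \<nu>"
      then show "g (x, z) - (f (y, z') + c\<^sub>1 x y) \<le> c\<^sub>2 z z'"
        using d[of "(x, z)" "(y, z')"] x y by (simp add: space_pair_measure)
    qed (use x y in measurable)
    also have "(\<integral>z. f (y, z) + c\<^sub>1 x y \<partial>\<nu>) = F y + c\<^sub>1 x y"
    proof -
      have "integrable \<nu> (\<lambda>z. f (y, z))"
        using bf y by (intro B.integrable_bounded[of _ r]) (auto simp: space_pair_measure)
      then show ?thesis by (simp add: F_def B.prob_space)
    qed
    finally have "exp (G x) \<le> exp (F y + c\<^sub>1 x y)" by (simp add: eG x)
    then show "G x - F y \<le> c\<^sub>1 x y" by simp
  qed
  also have "(\<integral>x. exp (G x) \<partial>\<mu>) = (\<integral>x. (\<integral>z. exp (g (x, z)) \<partial>\<nu>) \<partial>\<mu>)"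
    by (intro Bochner_Integration.integral_cong) (auto simp: eG)
  also have "\<dots> = (\<integral>x. exp (g x) \<partial>(\<mu> \<Otimes>\<^sub>M \<nu>))"
  proof (intro P.integral_fst' P.integrable_bounded[of _ "exp r"])
    fix x assume "x \<in> space (\<mu> \<Otimes>\<^sub>M \<nu>)"
    then show "\<bar>exp (g x)\<bar> \<le> exp r" using bg[of x] by (simp add: abs_le_iff)
  qed measurable
  also have "(\<integral>x. F x \<partial>\<mu>) = (\<integral>x. f x \<partial>(\<mu> \<Otimes>\<^sub>M \<nu>))"
    unfolding F_def by (intro P.integral_fst' P.integrable_bounded[of _ r] bf f)
  finally show "(\<integral>x. exp (g x) \<partial>(\<mu> \<Otimes>\<^sub>M \<nu>)) \<le> exp (\<integral>x. f x \<partial>(\<mu> \<Otimes>\<^sub>M \<nu>))" .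
qed

lemma dual_transport_PiM:
  fixes M :: "'i \<Rightarrow> 'a measure"
  assumes "finite I" "\<And>i. i \<in> I \<Longrightarrow> dual_transport (M i) (c i)"
  shows "dual_transport (Pi\<^sub>M I M) (\<lambda>x y. \<Sum>i\<in>I. c i (x i) (y i))"
  using assms
proof (induction I)
  case empty
  interpret prob_space "Pi\<^sub>M {} M" by (intro prob_space_PiM) auto
  show ?case
  proof (rule dual_transportI)
    fix f g :: "('i \<Rightarrow> 'a) \<Rightarrow> real" and r
    assume "f \<in> borel_measurable (Pi\<^sub>M {} M)" "g \<in> borel_measurable (Pi\<^sub>M {} M)"
      and "\<And>x y. x \<in> space (Pi\<^sub>M {} M) \<Longrightarrow> y \<in> space (Pi\<^sub>M {} M) \<Longrightarrow> g x - f y \<le> (\<Sum>i\<in>{}. c i (x i) (y i))"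
    \<comment> \<open>The empty product space has a single point and the empty sum is 0, so
      admissibility is an inequality between the values at that point.\<close>
    then have "g (\<lambda>_. undefined) \<le> f (\<lambda>_. undefined)" by (fastforce simp: space_PiM)
    moreover have "(\<integral>x. exp (g x) \<partial>Pi\<^sub>M {} M) = (\<integral>x. exp (g (\<lambda>_. undefined)) \<partial>Pi\<^sub>M {} M)"
      by (intro Bochner_Integration.integral_cong) (auto simp: space_PiM)
    moreover have "(\<integral>x. f x \<partial>Pi\<^sub>M {} M) = (\<integral>x. f (\<lambda>_. undefined) \<partial>Pi\<^sub>M {} M)"
      by (intro Bochner_Integration.integral_cong) (auto simp: space_PiM)
    ultimately show "(\<integral>x. exp (g x) \<partial>Pi\<^sub>M {} M) \<le> exp (\<integral>x. f x \<partial>Pi\<^sub>M {} M)"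
      by (simp add: prob_space)
  qed (rule prob_space_axioms)
next
  case (insert i I)
  have "dual_transport (distr (M i \<Otimes>\<^sub>M Pi\<^sub>M I M) (Pi\<^sub>M (insert i I) M) (\<lambda>(x, X). X(i := x)))
    (\<lambda>x y. \<Sum>i\<in>insert i I. c i (x i) (y i))"
  proof (rule dual_transport_distr[OF dual_transport_pair[OF insert.prems[of i] insert.IH]])
    fix x y :: "'a \<times> ('i \<Rightarrow> 'a)"
    have "(\<Sum>j\<in>I. c j (((snd x)(i := fst x)) j) (((snd y)(i := fst y)) j)) = (\<Sum>j\<in>I. c j (snd x j) (snd y j))"
      using insert.hyps by (intro sum.cong) auto
    then show "(\<Sum>j\<in>insert i I. c j ((case x of (x, X) \<Rightarrow> X(i := x)) j) ((case y of (x, X) \<Rightarrow> X(i := x)) j))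
        \<le> c i (fst x) (fst y) + (\<Sum>j\<in>I. c j (snd x j) (snd y j))"
      using insert.hyps by (simp add: case_prod_beta)
  qed (use insert.prems in auto)
  then show ?case
    by (subst (asm) distr_pair_PiM_eq_PiM) (use insert.prems dual_transport_prob_space in auto)
qed

section \<open>The Gaussian measure\<close>

lemma cdf_density_has_real_derivative:
  fixes u :: "real \<Rightarrow> real"
  assumes u: "continuous_on UNIV u" "\<And>x. 0 \<le> u x" "integrable lborel u"
  shows "(cdf (density lborel u) has_real_derivative u x) (at x)"
proof -
  have fin: "emeasure (density lborel u) UNIV < \<infinity>"
  proof -
    have "(\<integral>\<^sup>+ x. ennreal (u x) \<partial>lborel) < \<infinity>"
      using u(2,3) by (subst nn_integral_eq_integral) auto
    then show ?thesis
      using u(3) by (simp add: emeasure_density)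
  qed
  interpret finite_borel_measure "density lborel u"
    using fin by (intro finite_borel_measure.intro finite_measureI finite_borel_measure_axioms.intro) auto
  have [measurable]: "u \<in> borel_measurable borel"
    using u(1) by (rule borel_measurable_continuous_onI)
  \<comment> \<open>The fundamental theorem of calculus is applied on a compact interval. Its left
    end \<open>x - 1\<close> lies strictly to the left of \<open>x\<close>, so the formula holds in
    a whole neighbourhood of \<open>x\<close> and gives a two-sided derivative.\<close>
  have eq: "cdf (density lborel u) y = cdf (density lborel u) (x - 1) + integral {x - 1..y} u"
    if y: "x - 1 \<le> y" for y
  proof -
    have ud: "set_integrable lborel {x - 1<..y} u" 
      using u(3) unfolding set_integrable_def by (intro integrable_mult_indicator) auto
    have "measure (density lborel u) {x - 1<..y} = (\<integral>z. indicator {x - 1<..y} z \<partial>density lborel u)"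
      by simp
    also have "\<dots> = (LINT z:{x - 1<..y}|lborel. u z)"
      by (subst integral_density) (auto simp: u(2) set_lebesgue_integral_def mult.commute)
    also have "\<dots> = integral {x - 1<..y} u"
      using ud by (rule set_borel_integral_eq_integral)
    also have "\<dots> = integral {x - 1..y} u"
    proof (rule integral_subset_negligible)
      have "{x - 1..y} - {x - 1<..y} \<subseteq> {x - 1}" by auto
      then show "negligible ({x - 1..y} - {x - 1<..y})"
        by (rule negligible_subset[rotated]) auto
    qed auto
    finally have m: "measure (density lborel u) {x - 1<..y} = integral {x - 1..y} u" .
    show ?thesis
    proof (cases "x - 1 = y")
      case False
      then show ?thesis using cdf_diff_eq[of "x - 1" y] m y by simp
    qed simp
  qed
  have "((\<lambda>y. integral {x - 1..y} u) has_real_derivative u x) (at x within {x - 1..x + 1})"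
    by (intro integral_has_real_derivative continuous_on_subset[OF u(1)]) auto
  then have "((\<lambda>y. integral {x - 1..y} u) has_real_derivative u x) (at x)"
    by (subst (asm) at_within_interior) auto
  then have "((\<lambda>y. cdf (density lborel u) (x - 1) + integral {x - 1..y} u) has_real_derivative u x) (at x)"
    by (auto intro!: derivative_eq_intros)
  then show ?thesis
  proof (rule has_field_derivative_transform_within[of _ _ _ _ 1])
    fix y assume "dist y x < 1"
    then show "cdf (density lborel u) (x - 1) + integral {x - 1..y} u = cdf (density lborel u) y"
      by (subst eq) (auto simp: dist_real_def)
  qed auto
qed

text \<open>The distribution function of the measure with density \<open>u\<close> serves as
  antiderivative: its limits come from continuity of the measure, and it stays strictly between them
  because it is strictly increasing.\<close>

lemma exists_antiderivative_limits:
  fixes u :: "real \<Rightarrow> real"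
  assumes u: "continuous_on UNIV u" "\<And>x. 0 < u x" "integrable lborel u"
  obtains U where "\<And>x. (U has_real_derivative u x) (at x)" "strict_mono U"
    "(U \<longlongrightarrow> 0) at_bot" "(U \<longlongrightarrow> integral\<^sup>L lborel u) at_top"
    "\<And>x. 0 < U x" "\<And>x. U x < integral\<^sup>L lborel u"
proof -
  let ?U = "cdf (density lborel u)"
  have u0: "0 \<le> u x" for x using u(2)[of x] by simp
  have em: "emeasure (density lborel u) UNIV = integral\<^sup>L lborel u"
    using u(3) u0 by (subst nn_integral_eq_integral[symmetric]) (auto simp: emeasure_density)
  interpret finite_borel_measure "density lborel u"
    using em by (intro finite_borel_measure.intro finite_measureI finite_borel_measure_axioms.intro) auto
  have D: "(?U has_real_derivative u x) (at x)" for x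
    using u u0 by (intro cdf_density_has_real_derivative)
  have mono: "strict_mono ?U"
  proof (rule strict_monoI)
    fix x y :: real assume "x < y"
    then show "?U x < ?U y" by (rule DERIV_pos_imp_increasing) (use D u(2) in blast)
  qed
  have bot: "(?U \<longlongrightarrow> 0) at_bot" by (rule cdf_lim_at_bot)
  have top: "(?U \<longlongrightarrow> integral\<^sup>L lborel u) at_top"
    using cdf_lim_at_top em u0 by (simp add: measure_def)
  have "0 < ?U x" for x
    using strict_monoD[OF mono, of "x - 1" x] cdf_nonneg[of "x - 1"] by linarith
  moreover have "?U x < integral\<^sup>L lborel u" for x
    using strict_monoD[OF mono, of x "x + 1"] cdf_bounded[of "x + 1"] em u0
    by (simp add: measure_def)
  ultimately show thesis using that D mono bot top by blast
qed

text \<open>The monotone map \<open>\<tau>\<close> transporting the normalised density \<open>u\<close> to the normalised density \<open>v\<close> has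
  derivative \<open>(B / A) * u / (v \<circ> \<tau>)\<close>; by AM-GM the map \<open>(id + \<tau>) / 2\<close> then pulls \<open>p\<close> back to a
  density above \<open>sqrt (B / A) * u\<close>.\<close>

lemma prekopa_leindler_real:
  fixes u v p :: "real \<Rightarrow> real"
  assumes u: "continuous_on UNIV u" "\<And>x. 0 < u x" "integrable lborel u"
    and v: "continuous_on UNIV v" "\<And>x. 0 < v x" "integrable lborel v"
    and p: "continuous_on UNIV p" "\<And>x. 0 < p x" "integrable lborel p"
    and uvp: "\<And>x y. u x * v y \<le> (p ((x + y) / 2))\<^sup>2"
  shows "integral\<^sup>L lborel u * integral\<^sup>L lborel v \<le> (integral\<^sup>L lborel p)\<^sup>2"
proof -
  define A B C where "A = integral\<^sup>L lborel u" and "B = integral\<^sup>L lborel v" and "C = integral\<^sup>L lborel p"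
  obtain U where U: "\<And>x. (U has_real_derivative u x) (at x)" "strict_mono U"
    "(U \<longlongrightarrow> 0) at_bot" "(U \<longlongrightarrow> A) at_top" "\<And>x. 0 < U x" "\<And>x. U x < A"
    using exists_antiderivative_limits[OF u] unfolding A_def by metis
  obtain V where V: "\<And>x. (V has_real_derivative v x) (at x)" "strict_mono V"
    "(V \<longlongrightarrow> 0) at_bot" "(V \<longlongrightarrow> B) at_top" "\<And>x. 0 < V x" "\<And>x. V x < B"
    using exists_antiderivative_limits[OF v] unfolding B_def by metis
  obtain P where P: "\<And>x. (P has_real_derivative p x) (at x)" "\<And>x. 0 < P x" "\<And>x. P x < C"
    using exists_antiderivative_limits[OF p] unfolding C_def by metis
  have A: "0 < A" and B: "0 < B" using U(5,6)[of 0] V(5,6)[of 0] by linarith+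
  have Vc: "continuous_on S V" for S
    using V(1) DERIV_isCont by (blast intro: continuous_at_imp_continuous_on)
  have inj: "inj V" using V(2) by (rule strict_mono_imp_inj_on)
  define \<tau> where "\<tau> x = inv V (B / A * U x)" for x
  \<comment> \<open>\<open>inv V\<close> is meaningful only on the range of \<open>V\<close>. The
    value \<open>B / A * U x\<close> lies strictly between 0 and \<open>B\<close>, the limits of
    \<open>V\<close>, hence in this range.\<close>
  have V\<tau>: "V (\<tau> x) = B / A * U x" for x
  proof -
    have "0 < B / A * U x" using A B U(5) by simp
    then obtain l where l: "V l < B / A * U x"
      using order_tendstoD(2)[OF V(3)] eventually_at_bot_linorder by (metis order_refl)
    have "B / A * U x < B" using A B U(6)[of x] by (simp add: field_simps)
    then obtain h where h: "B / A * U x < V h"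
      using order_tendstoD(1)[OF V(4)] eventually_at_top_linorder by (metis order_refl)
    have "l \<le> h" using l h V(2) by (smt (verit) strict_monoD)
    then obtain y where "V y = B / A * U x"
      using IVT'[of V l "B / A * U x" h] l h Vc by fastforce
    then show ?thesis unfolding \<tau>_def by (metis f_inv_into_f rangeI)
  qed
  have D\<tau>: "(\<tau> has_real_derivative (B / A * u x / v (\<tau> x))) (at x)" for x
  proof -
    have "(inv V has_derivative (*) (inverse (v (\<tau> x)))) (at (V (\<tau> x)))"
    proof (rule has_derivative_inverse_strong[where S = UNIV and f = V and x = "\<tau> x" and f' = "(*) (v (\<tau> x))"])
      show "(V has_derivative (*) (v (\<tau> x))) (at (\<tau> x))"
        using V(1) by (simp add: has_field_derivative_def)
      show "(*) (v (\<tau> x)) \<circ> (*) (inverse (v (\<tau> x))) = id"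
        using v(2)[of "\<tau> x"] by (simp add: fun_eq_iff)
    qed (use inj Vc in auto)
    then have "(inv V has_real_derivative inverse (v (\<tau> x))) (at (B / A * U x))"
      unfolding V\<tau> has_field_derivative_def .
    then have "((\<lambda>x. inv V (B / A * U x)) has_real_derivative inverse (v (\<tau> x)) * (B / A * u x)) (at x)"
      by (rule DERIV_chain2) (rule DERIV_cmult[OF U(1)])
    then show ?thesis unfolding \<tau>_def[abs_def, symmetric] by (simp add: field_simps)
  qed
  \<comment> \<open>Monotonicity of \<open>H\<close> takes the place of a change of variables in the
    integral of \<open>p\<close>: increments of \<open>P\<close> along
    \<open>(x + \<tau> x) / 2\<close> are compared with increments of \<open>U\<close>.\<close>
  define H where "H x = P ((x + \<tau> x) / 2) - sqrt (B / A) * U x" for x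
  have DH: "(H has_real_derivative
      (p ((x + \<tau> x) / 2) * ((1 + B / A * u x / v (\<tau> x)) / 2) - sqrt (B / A) * u x)) (at x)" for x
    unfolding H_def
    by (rule derivative_eq_intros DERIV_chain2[OF P(1)] D\<tau> U(1) refl | simp)+
  have H': "sqrt (B / A) * u x \<le> p ((x + \<tau> x) / 2) * ((1 + B / A * u x / v (\<tau> x)) / 2)" for x
  proof -
    define w where "w = B / A * u x / v (\<tau> x)"
    have w: "0 < w" unfolding w_def using A B u(2)[of x] v(2)[of "\<tau> x"] by simp
    have "sqrt (B / A) * u x = sqrt (B / A * (u x)\<^sup>2)"
      using u(2)[of x] by (simp only: real_sqrt_mult real_sqrt_abs)
    also have "B / A * (u x)\<^sup>2 = (u x * v (\<tau> x)) * w"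
      using v(2)[of "\<tau> x"] by (simp add: w_def power2_eq_square field_simps)
    also have "sqrt \<dots> = sqrt (u x * v (\<tau> x)) * sqrt w"
      by (simp add: real_sqrt_mult)
    also have "\<dots> \<le> p ((x + \<tau> x) / 2) * ((1 + w) / 2)"
    proof (rule mult_mono)
      show "sqrt (u x * v (\<tau> x)) \<le> p ((x + \<tau> x) / 2)"
        using uvp[of x "\<tau> x"] p(2)[of "(x + \<tau> x) / 2"] by (intro real_le_lsqrt) auto
      show "sqrt w \<le> (1 + w) / 2"
        using arith_geo_mean_sqrt[of 1 w] w by simp
    qed (use p(2)[of "(x + \<tau> x) / 2"] w in auto)
    finally show ?thesis unfolding w_def .
  qed
  \<comment> \<open>\<open>P\<close> has values between 0 and \<open>C\<close>, so its increment is
    at most \<open>C\<close>. As \<open>x\<close> tends to infinity, the left side tends to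
    \<open>sqrt (B / A) * A\<close>, which is \<open>sqrt (A * B)\<close>.\<close>
  have "sqrt (B / A) * (U x - U (- x)) \<le> C" if "0 \<le> x" for x
  proof -
    have "H (- x) \<le> H x"
    proof (rule DERIV_nonneg_imp_nondecreasing[where f = H])
      show "\<exists>D. (H has_real_derivative D) (at y) \<and> 0 \<le> D" for y
        using DH[of y] H'[of y] diff_ge_0_iff_ge by blast
    qed (use that in simp)
    moreover have "P ((x + \<tau> x) / 2) \<le> C" "0 \<le> P ((- x + \<tau> (- x)) / 2)"
      using P(2,3) by (auto intro: less_imp_le)
    ultimately show ?thesis unfolding H_def right_diff_distrib by linarith
  qed
  then have "eventually (\<lambda>x. sqrt (B / A) * (U x - U (- x)) \<le> C) at_top"
    by (intro eventually_mono[OF eventually_ge_at_top[of 0]])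
  moreover have "((\<lambda>x. sqrt (B / A) * (U x - U (- x))) \<longlongrightarrow> sqrt (B / A) * (A - 0)) at_top"
    by (intro tendsto_intros U(4) filterlim_compose[OF U(3)] filterlim_uminus_at_bot_at_top)
  ultimately have "sqrt (B / A) * A \<le> C"
    using tendsto_upperbound by fastforce
  then have "(sqrt (B / A) * A)\<^sup>2 \<le> C\<^sup>2"
    using A B by (intro power_mono) auto
  then show ?thesis
  proof -
    have "(sqrt (B / A) * A)\<^sup>2 = B / A * A\<^sup>2"
      using A B by (subst power_mult_distrib) simp
    then show ?thesis
      using A \<open>(sqrt (B / A) * A)\<^sup>2 \<le> C\<^sup>2\<close>
      by (simp add: A_def[symmetric] B_def[symmetric] C_def[symmetric] power2_eq_square mult_ac)
  qed
qed

section \<open>Inf-convolution with a quadratic cost\<close>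

definition inf_conv :: "real \<Rightarrow> (real \<Rightarrow> real) \<Rightarrow> real \<Rightarrow> real" where
  "inf_conv k f x = (INF y. f y + k * (x - y)\<^sup>2)"

context
  fixes k r :: real and f :: "real \<Rightarrow> real"
  assumes k: "0 < k" and f: "\<And>y. \<bar>f y\<bar> \<le> r"
begin

lemma inf_conv_lower: "inf_conv k f x \<le> f y + k * (x - y)\<^sup>2"
proof -
  have "- r \<le> f y + k * (x - y)\<^sup>2" for y
    using k f[of y] by (smt (verit) mult_nonneg_nonneg zero_le_power2)
  then show ?thesis unfolding inf_conv_def by (intro cINF_lower bdd_belowI2[where m = "- r"]) auto
qed

lemma inf_conv_greatest: "(\<And>y. a \<le> f y + k * (x - y)\<^sup>2) \<Longrightarrow> a \<le> inf_conv k f x"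
  unfolding inf_conv_def by (intro cINF_greatest) auto

lemma abs_inf_conv_le: "\<bar>inf_conv k f x\<bar> \<le> r"
proof -
  have "- r \<le> inf_conv k f x"
    using k f by (intro inf_conv_greatest) (smt (verit) mult_nonneg_nonneg zero_le_power2)
  moreover have "inf_conv k f x \<le> r" using inf_conv_lower[of x x] f[of x] by simp
  ultimately show ?thesis by simp
qed

text \<open>The square root is a radius: for \<open>y\<close> farther than this from
  \<open>x'\<close> the quadratic term is at least \<open>2 * r\<close>, which bounds the
  oscillation of \<open>f\<close>, so these points do not lower the infimum. For the other
  \<open>y\<close> the quadratic term changes by at most the right-hand side when \<open>x'\<close>
  is replaced by \<open>x\<close>.\<close>

lemma inf_conv_diff_le:
  "inf_conv k f x - inf_conv k f x' \<le> k * \<bar>x - x'\<bar> * (\<bar>x - x'\<bar> + 2 * sqrt ((2 * r + 1) / k))"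
proof -
  define R where "R = sqrt ((2 * r + 1) / k)"
  have "inf_conv k f x - k * \<bar>x - x'\<bar> * (\<bar>x - x'\<bar> + 2 * R) \<le> inf_conv k f x'"
  proof (rule inf_conv_greatest)
    fix y
    have r: "0 \<le> r" using f[of 0] by linarith
    show "inf_conv k f x - k * \<bar>x - x'\<bar> * (\<bar>x - x'\<bar> + 2 * R) \<le> f y + k * (x' - y)\<^sup>2"
    proof (cases "\<bar>x' - y\<bar> \<le> R")
      case True
      have "(x - y)\<^sup>2 - (x' - y)\<^sup>2 = (x - x') * ((x - x') + 2 * (x' - y))"
        by (simp add: power2_eq_square algebra_simps)
      also have "\<dots> \<le> \<bar>x - x'\<bar> * (\<bar>x - x'\<bar> + 2 * R)"
      proof -
        have "(x - x') * ((x - x') + 2 * (x' - y)) \<le> \<bar>x - x'\<bar> * \<bar>(x - x') + 2 * (x' - y)\<bar>"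
          by (metis abs_ge_self abs_mult)
        also have "\<dots> \<le> \<bar>x - x'\<bar> * (\<bar>x - x'\<bar> + 2 * R)"
          using True by (intro mult_left_mono) auto
        finally show ?thesis .
      qed
      finally have "k * ((x - y)\<^sup>2 - (x' - y)\<^sup>2) \<le> k * (\<bar>x - x'\<bar> * (\<bar>x - x'\<bar> + 2 * R))"
        using k by (intro mult_left_mono) auto
      then show ?thesis using inf_conv_lower[of x y] by (simp add: algebra_simps)
    next
      case False
      then have "R\<^sup>2 \<le> \<bar>x' - y\<bar>\<^sup>2" using k r by (intro power_mono) (auto simp: R_def)
      then have "(2 * r + 1) / k \<le> (x' - y)\<^sup>2" using k r by (simp add: R_def)
      then have "2 * r \<le> k * (x' - y)\<^sup>2" using k by (simp add: field_simps)
      moreover have "0 \<le> k * \<bar>x - x'\<bar> * (\<bar>x - x'\<bar> + 2 * R)"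
        using k r by (auto simp: R_def)
      ultimately show ?thesis using abs_inf_conv_le[of x] f[of y] by linarith
    qed
  qed
  then show ?thesis unfolding R_def by simp
qed

lemma continuous_inf_conv: "continuous_on UNIV (inf_conv k f)"
proof -
  define \<rho> where "\<rho> x' x = k * \<bar>x - x'\<bar> * (\<bar>x - x'\<bar> + 2 * sqrt ((2 * r + 1) / k))" for x x'
  have "isCont (inf_conv k f) x'" for x'
  proof -
    have "(\<rho> x' \<longlongrightarrow> \<rho> x' x') (at x')" unfolding \<rho>_def by (intro tendsto_intros)
    then have lim: "(\<rho> x' \<longlongrightarrow> 0) (at x')" by (simp add: \<rho>_def)
    have le: "\<bar>inf_conv k f x - inf_conv k f x'\<bar> \<le> \<rho> x' x" for x
      using inf_conv_diff_le[of x x'] inf_conv_diff_le[of x' x]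
      by (simp add: \<rho>_def abs_minus_commute abs_le_iff)
    have "((\<lambda>x. inf_conv k f x - inf_conv k f x') \<longlongrightarrow> 0) (at x')"
      by (rule Lim_null_comparison[OF _ lim]) (simp add: le)
    then show ?thesis unfolding isCont_def by (rule LIM_zero_cancel)
  qed
  then show ?thesis by (simp add: continuous_on_eq_continuous_at)
qed

end

text \<open>Jensen's inequality: the tangent to \<open>exp\<close> at the mean lies below the
  graph.\<close>

lemma (in prob_space) exp_integral_le:
  fixes f :: "'a \<Rightarrow> real"
  assumes "integrable M f" "integrable M (\<lambda>x. exp (f x))"
  shows "exp (\<integral>x. f x \<partial>M) \<le> (\<integral>x. exp (f x) \<partial>M)"
proof -
  define m where "m = (\<integral>x. f x \<partial>M)"
  have "exp m = (\<integral>x. exp m * (1 + (f x - m)) \<partial>M)"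
    using assms(1) by (simp add: m_def prob_space)
  also have "\<dots> \<le> (\<integral>x. exp (f x) \<partial>M)"
  proof (rule integral_mono)
    show "exp m * (1 + (f x - m)) \<le> exp (f x)" for x
    proof -
      have "exp m * (1 + (f x - m)) \<le> exp m * exp (f x - m)"
        by (intro mult_left_mono exp_ge_add_one_self) auto
      then show ?thesis by (simp add: exp_diff)
    qed
  qed (use assms in auto)
  finally show ?thesis unfolding m_def .
qed

text \<open>The identity x^2 + y^2 = 2 ((x + y) / 2)^2 + (x - y)^2 / 2 in the exponents. The last
  factor is what the quadratic cost has to compensate, whence the constant 1 / (4 s^2).\<close>

lemma normal_density_mult:
  assumes "0 < s"
  shows "normal_density 0 s x * normal_density 0 s y =
    (normal_density 0 s ((x + y) / 2))\<^sup>2 * exp (- (1 / (4 * s\<^sup>2) * (x - y)\<^sup>2))"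
proof -
  have "- x\<^sup>2 / (2 * s\<^sup>2) + - y\<^sup>2 / (2 * s\<^sup>2)
      = 2 * (- ((x + y) / 2)\<^sup>2 / (2 * s\<^sup>2)) + - (1 / (4 * s\<^sup>2) * (x - y)\<^sup>2)"
    using assms by (simp add: field_simps power2_eq_square)
  then have "exp (- x\<^sup>2 / (2 * s\<^sup>2)) * exp (- y\<^sup>2 / (2 * s\<^sup>2))
      = (exp (- ((x + y) / 2)\<^sup>2 / (2 * s\<^sup>2)))\<^sup>2 * exp (- (1 / (4 * s\<^sup>2) * (x - y)\<^sup>2))"
    by (simp only: exp_add[symmetric] exp_double[symmetric])
  then show ?thesis
    unfolding normal_density_def power_mult_distrib diff_0_right
    by (simp only: power2_eq_square mult_ac)
qed

text \<open>Replacing \<open>f\<close> and \<open>g\<close> by inf-convolutions makes both continuous and sharpens the inequality.\<close>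

lemma dual_transport_normal:
  assumes s: "0 < s"
  shows "dual_transport (density lborel (normal_density 0 s)) (\<lambda>x y. 1 / (4 * s\<^sup>2) * (x - y)\<^sup>2)"
    (is "dual_transport ?N _")
proof (rule dual_transportI)
  interpret prob_space ?N using s by (rule prob_space_normal_density)
  show "prob_space ?N" by (rule prob_space_axioms)
  fix f g :: "real \<Rightarrow> real" and r
  assume "f \<in> borel_measurable ?N" "g \<in> borel_measurable ?N"
    and "\<And>x. x \<in> space ?N \<Longrightarrow> \<bar>f x\<bar> \<le> r" "\<And>x. x \<in> space ?N \<Longrightarrow> \<bar>g x\<bar> \<le> r"
    and "\<And>x y. x \<in> space ?N \<Longrightarrow> y \<in> space ?N \<Longrightarrow> g x - f y \<le> 1 / (4 * s\<^sup>2) * (x - y)\<^sup>2"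
  then have [measurable]: "f \<in> borel_measurable borel" "g \<in> borel_measurable borel"
    and bf: "\<And>x. \<bar>f x\<bar> \<le> r" and bg: "\<And>x. \<bar>g x\<bar> \<le> r"
    and d: "\<And>x y. g x - f y \<le> 1 / (4 * s\<^sup>2) * (x - y)\<^sup>2"
    by auto
  define k where "k = 1 / (4 * s\<^sup>2)"
  have k: "0 < k" using s by (simp add: k_def)
  \<comment> \<open>\<open>g'\<close> is the largest function admissible together with
    \<open>f\<close>, and the \<open>f'\<close> below is then the smallest one admissible together
    with \<open>g'\<close>. Their continuity is what the Prekopa-Leindler inequality above asks of
    the integrands.\<close>
  define g' where "g' = inf_conv k f"
  have bg': "\<bar>- g' x\<bar> \<le> r" for x using abs_inf_conv_le[where f = f, OF k bf] by (simp add: g'_def)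
  define f' where "f' x = - inf_conv k (\<lambda>x. - g' x) x" for x
  have bf': "\<bar>f' x\<bar> \<le> r" for x using abs_inf_conv_le[where f = "\<lambda>x. - g' x", OF k bg'] by (simp add: f'_def)
  have c[continuous_intros]: "continuous_on UNIV g'" "continuous_on UNIV f'"
    using continuous_inf_conv[where f = f, OF k bf]
      continuous_on_minus[OF continuous_inf_conv[where f = "\<lambda>x. - g' x", OF k bg']]
    unfolding f'_def g'_def by auto
  then have [measurable]: "g' \<in> borel_measurable borel" "f' \<in> borel_measurable borel"
    by (auto intro: borel_measurable_continuous_onI)
  have gg': "g x \<le> g' x" for x
    unfolding g'_def using d[of x] by (intro inf_conv_greatest[where f = f, OF k bf]) (simp add: k_def algebra_simps)
  have ff': "f' x \<le> f x" for x
  proof -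
    have "- f x \<le> inf_conv k (\<lambda>x. - g' x) x"
    proof (rule inf_conv_greatest[where f = "\<lambda>x. - g' x", OF k bg'])
      fix y show "- f x \<le> - g' y + k * (x - y)\<^sup>2"
        using inf_conv_lower[where f = f, OF k bf, of y x] by (simp add: g'_def power2_commute)
    qed
    then show ?thesis by (simp add: f'_def)
  qed
  have d': "g' y - f' x \<le> k * (x - y)\<^sup>2" for x y
    using inf_conv_lower[where f = "\<lambda>x. - g' x", OF k bg', of x y] by (simp add: f'_def)
  have int[simp]: "integrable ?N (\<lambda>x. exp (h x))" "integrable ?N h"
    if "h \<in> borel_measurable borel" "\<And>x. \<bar>h x\<bar> \<le> r" for h
  proof -
    show "integrable ?N h" using that by (intro integrable_bounded[of h r]) auto
    show "integrable ?N (\<lambda>x. exp (h x))"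
      using that by (intro integrable_bounded[of _ "exp r"]) (auto simp: abs_le_iff)
  qed
  have N: "integrable lborel (\<lambda>x. normal_density 0 s x * exp (h x))"
    "(\<integral>x. exp (h x) \<partial>?N) = (\<integral>x. normal_density 0 s x * exp (h x) \<partial>lborel)"
    if "h \<in> borel_measurable borel" "\<And>x. \<bar>h x\<bar> \<le> r" for h
    using int(1)[OF that] that(1) s
    by (simp_all add: integrable_density integral_density normal_density_nonneg)
  have cn[continuous_intros]: "continuous_on UNIV (normal_density 0 s)"
    unfolding normal_density_def by (intro continuous_intros) (use s in auto)
  \<comment> \<open>This is Maurey's property (tau): the third function is the Gaussian density
    itself, with integral 1. Jensen's inequality then replaces the integral of
    \<open>exp (- f')\<close> by the exponential of the integral of \<open>- f'\<close>.\<close>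
  have "(\<integral>x. normal_density 0 s x * exp (- f' x) \<partial>lborel) * (\<integral>x. normal_density 0 s x * exp (g' x) \<partial>lborel)
    \<le> (\<integral>x. normal_density 0 s x \<partial>lborel)\<^sup>2"
  proof (rule prekopa_leindler_real)
    fix x y
    have "normal_density 0 s x * exp (- f' x) * (normal_density 0 s y * exp (g' y))
        = normal_density 0 s x * normal_density 0 s y * exp (g' y - f' x)"
      by (simp add: exp_diff exp_minus field_simps)
    also have "\<dots> = (normal_density 0 s ((x + y) / 2))\<^sup>2 * exp (g' y - f' x - k * (x - y)\<^sup>2)"
      by (simp add: normal_density_mult[OF s] k_def mult_exp_exp)
    also have "\<dots> \<le> (normal_density 0 s ((x + y) / 2))\<^sup>2 * 1"
      using d'[of y x] by (intro mult_left_mono) auto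
    finally show "normal_density 0 s x * exp (- f' x) * (normal_density 0 s y * exp (g' y))
        \<le> (normal_density 0 s ((x + y) / 2))\<^sup>2" by simp
  qed (use s bf' bg' N(1)[of "\<lambda>x. - f' x"] N(1)[of g'] in
      \<open>auto intro!: continuous_intros mult_pos_pos normal_density_pos\<close>)
  also have "(\<integral>x. normal_density 0 s x \<partial>lborel) = 1" using s by simp
  finally have "(\<integral>x. exp (- f' x) \<partial>?N) * (\<integral>x. exp (g' x) \<partial>?N) \<le> 1"
    using N(2)[of "\<lambda>x. - f' x"] N(2)[of g'] bf' bg' by simp
  moreover have "exp (\<integral>x. - f' x \<partial>?N) \<le> (\<integral>x. exp (- f' x) \<partial>?N)"
    using bf' by (intro exp_integral_le int) auto
  moreover have "0 \<le> (\<integral>x. exp (g' x) \<partial>?N)" by (intro integral_nonneg_AE) auto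
  ultimately have "exp (\<integral>x. - f' x \<partial>?N) * (\<integral>x. exp (g' x) \<partial>?N) \<le> 1"
    by (meson mult_right_mono order_trans)
  then have "(\<integral>x. exp (g' x) \<partial>?N) \<le> exp (\<integral>x. f' x \<partial>?N)"
    by (simp add: exp_minus field_simps)
  moreover have "(\<integral>x. exp (g x) \<partial>?N) \<le> (\<integral>x. exp (g' x) \<partial>?N)"
    using gg' bg bg' by (intro integral_mono int) auto
  moreover have "(\<integral>x. f' x \<partial>?N) \<le> (\<integral>x. f x \<partial>?N)"
    using ff' bf bf' by (intro integral_mono int) auto
  ultimately show "(\<integral>x. exp (g x) \<partial>?N) \<le> exp (\<integral>x. f x \<partial>?N)"
    by (meson exp_le_cancel_iff order_trans)
qed

section \<open>Gaussian measures on vectors\<close>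

lemma measurable_vec_lambda:
  assumes "\<And>k. (\<lambda>x. f x k) \<in> borel_measurable M"
  shows "(\<lambda>x. \<chi> k. f x k :: real ^ 'd) \<in> borel_measurable M"
  using assms by (auto simp: borel_measurable_euclidean_space[of "\<lambda>x. \<chi> k. f x k"] Basis_vec_def inner_axis)

text \<open>The coordinate map, in the opposite direction, is treated first: a product measure is
  determined by its values on boxes, and there the Lebesgue integral factorises. Pushing the result
  forward by the inverse map gives the claim.\<close>

lemma distr_PiM_vec_lambda_density:
  fixes h :: "real \<Rightarrow> real"
  assumes h: "h \<in> borel_measurable borel" "\<And>x. 0 \<le> h x" and p: "prob_space (density lborel h)"
  shows "distr (Pi\<^sub>M (UNIV :: 'd::finite set) (\<lambda>_. density lborel h)) borel (\<lambda>f. \<chi> k. f k) =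
    density lborel (\<lambda>x. ennreal (\<Prod>k\<in>UNIV. h (x $ k)))"
proof -
  note h(1)[measurable]
  interpret prob_space "density lborel h" by fact
  interpret product_prob_space "\<lambda>_::'d. density lborel h" UNIV ..
  define D where "D = density lborel (\<lambda>x :: real ^ 'd. ennreal (\<Prod>k\<in>UNIV. h (x $ k)))"
  have [measurable]: "(\<lambda>x :: real ^ 'd. x $ k) \<in> borel_measurable borel" for k
    by (intro borel_measurable_continuous_onI continuous_intros)
  have m1: "(\<lambda>x k. x $ k) \<in> measurable (borel :: (real ^ 'd) measure) (Pi\<^sub>M UNIV (\<lambda>_. density lborel h))"
    by (rule measurable_PiM_single') auto
  have m2: "(\<lambda>f. \<chi> k. f k) \<in> borel_measurable (Pi\<^sub>M (UNIV :: 'd set) (\<lambda>_. density lborel h))"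
    by (rule measurable_vec_lambda) measurable
  have [simp]: "sets D = sets borel" "space D = UNIV" by (auto simp: D_def)
  have B: "Basis = range (\<lambda>k :: 'd. axis k (1 :: real))" and inj: "inj (\<lambda>k :: 'd. axis k (1 :: real))"
    by (auto simp: Basis_vec_def inj_on_def axis_eq_axis)
  have "distr D (Pi\<^sub>M UNIV (\<lambda>_. density lborel h)) (\<lambda>x k. x $ k) = Pi\<^sub>M UNIV (\<lambda>_. density lborel h)"
  proof (rule PiM_eqI)
    fix A :: "'d \<Rightarrow> real set" assume "\<And>i. i \<in> UNIV \<Longrightarrow> A i \<in> sets (density lborel h)"
    then have A[measurable]: "A i \<in> sets borel" for i by simp
    have [measurable]: "{x :: real ^ 'd. \<forall>k. x $ k \<in> A k} \<in> sets borel" by measurable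
    let ?H = "\<lambda>k x. ennreal (h x) * indicator (A k) x"
    \<comment> \<open>Lebesgue measure factorises over \<open>Basis\<close>, while the boxes are
      indexed by \<open>'d\<close>; \<open>ix\<close> recovers the index from a basis
      vector.\<close>
    define ix where "ix = inv (\<lambda>k :: 'd. axis k (1 :: real))"
    have ix: "ix (axis k 1) = k" for k unfolding ix_def using inj by (rule inv_f_f)
    have "emeasure (distr D (Pi\<^sub>M UNIV (\<lambda>_. density lborel h)) (\<lambda>x k. x $ k)) (Pi\<^sub>E UNIV A)
      = emeasure D {x. \<forall>k. x $ k \<in> A k}"
    proof (subst emeasure_distr)
      show "(\<lambda>x k. x $ k) \<in> measurable D (Pi\<^sub>M UNIV (\<lambda>_. density lborel h))"
        using m1 by (simp add: D_def cong: measurable_cong_sets)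
      show "Pi\<^sub>E UNIV A \<in> sets (Pi\<^sub>M UNIV (\<lambda>_. density lborel h))"
        by (rule sets_PiM_I_finite) auto
    qed (auto simp: vimage_def Pi_iff intro!: arg_cong[where f = "emeasure D"])
    also have "\<dots> = (\<integral>\<^sup>+ x. ennreal (\<Prod>k\<in>UNIV. h (x $ k)) * indicator {x. \<forall>k. x $ k \<in> A k} x \<partial>lborel)"
      unfolding D_def by (rule emeasure_density) measurable
    also have "\<dots> = (\<integral>\<^sup>+ x. (\<Prod>b\<in>Basis. ?H (ix b) (x \<bullet> b)) \<partial>lborel)"
    proof (rule nn_integral_cong)
      fix x :: "real ^ 'd"
      have "(\<Prod>b\<in>Basis. ?H (ix b) (x \<bullet> b)) = (\<Prod>k\<in>UNIV. ?H k (x $ k))"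
        unfolding B by (subst prod.reindex[OF inj]) (simp add: ix inner_axis)
      also have "\<dots> = (\<Prod>k\<in>UNIV. ennreal (h (x $ k))) * (\<Prod>k\<in>UNIV. indicator (A k) (x $ k))"
        by (rule prod.distrib)
      also have "(\<Prod>k\<in>UNIV. indicator (A k) (x $ k)) = (indicator {x. \<forall>k. x $ k \<in> A k} x :: ennreal)"
      proof (cases "\<forall>k. x $ k \<in> A k")
        case False
        then obtain k where "x $ k \<notin> A k" by blast
        then have "(\<Prod>k\<in>UNIV. indicator (A k) (x $ k)) = (0 :: ennreal)"
          by (intro prod_zero bexI[of _ k]) auto
        with False show ?thesis by simp
      qed simp
      finally show "ennreal (\<Prod>k\<in>UNIV. h (x $ k)) * indicator {x. \<forall>k. x $ k \<in> A k} x
          = (\<Prod>b\<in>Basis. ?H (ix b) (x \<bullet> b))"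
        by (simp add: prod_ennreal h(2))
    qed
    also have "\<dots> = (\<Prod>b\<in>Basis. \<integral>\<^sup>+ x. ?H (ix b) x \<partial>lborel)"
      by (rule nn_integral_lborel_prod) auto
    also have "\<dots> = (\<Prod>k\<in>UNIV. \<integral>\<^sup>+ x. ?H k x \<partial>lborel)"
      unfolding B by (subst prod.reindex[OF inj]) (simp add: ix)
    also have "\<dots> = (\<Prod>k\<in>UNIV. emeasure (density lborel h) (A k))"
      by (simp add: emeasure_density)
    finally show "emeasure (distr D (Pi\<^sub>M UNIV (\<lambda>_. density lborel h)) (\<lambda>x k. x $ k)) (Pi\<^sub>E UNIV A)
      = (\<Prod>k\<in>UNIV. emeasure (density lborel h) (A k))" .
  qed auto
  then have "distr (Pi\<^sub>M UNIV (\<lambda>_. density lborel h)) borel (\<lambda>f. \<chi> k. f k)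
    = distr (distr D (Pi\<^sub>M UNIV (\<lambda>_. density lborel h)) (\<lambda>x k. x $ k)) borel (\<lambda>f. \<chi> k. f k)"
    by simp
  also have "\<dots> = distr D borel (\<lambda>x. x)"
    using m1 m2 by (subst distr_distr) (auto simp: comp_def D_def)
  also have "\<dots> = D" by (rule distr_id2) simp
  finally show ?thesis unfolding D_def .
qed

lemma dual_transport_normal_vec:
  assumes s: "0 < s"
  shows "dual_transport (density lborel (\<lambda>x :: real ^ 'd. ennreal (\<Prod>k\<in>UNIV. normal_density 0 s (x $ k))))
    (\<lambda>x y. 1 / (4 * s\<^sup>2) * (norm (x - y))\<^sup>2)"
proof -
  have "dual_transport (distr (Pi\<^sub>M (UNIV :: 'd set) (\<lambda>_. density lborel (normal_density 0 s))) borel (\<lambda>f. \<chi> k. f k))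
    (\<lambda>x y. 1 / (4 * s\<^sup>2) * (norm (x - y))\<^sup>2)"
  proof (rule dual_transport_distr[OF dual_transport_PiM[OF _ dual_transport_normal[OF s]]])
    show "(\<lambda>f. \<chi> k. f k) \<in> borel_measurable (Pi\<^sub>M (UNIV :: 'd set) (\<lambda>_. density lborel (normal_density 0 s)))"
      by (rule measurable_vec_lambda) measurable
  qed (auto simp: norm_vec_def L2_set_def sum_nonneg sum_distrib_left)
  then show ?thesis
    using s by (subst (asm) distr_PiM_vec_lambda_density) (auto intro: prob_space_normal_density)
qed

section \<open>The initial distribution\<close>

text \<open>The transport inequality is applied to the measure with density proportional to \<open>exp g\<close>.\<close>

lemma dual_transport_of_wasserstein:
  fixes \<mu> :: "'a::euclidean_space measure"
  assumes "prob_space \<mu>" and sets: "sets \<mu> = sets borel" and \<kappa>: "0 \<le> \<kappa>\<^sub>0" "\<kappa>\<^sub>0 \<le> \<kappa>" "0 < \<kappa>"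
    and transport: "\<And>\<nu>. prob_space \<nu> \<Longrightarrow> sets \<nu> = sets borel \<Longrightarrow> absolutely_continuous \<mu> \<nu> \<Longrightarrow>
          rel_entropy \<nu> \<mu> \<noteq> \<infinity> \<Longrightarrow>
          wasserstein 2 \<mu> \<nu> \<le> ennreal (sqrt (2 * \<kappa>\<^sub>0 * real_of_ereal (rel_entropy \<nu> \<mu>)))"
  shows "dual_transport \<mu> (\<lambda>x y. (norm (x - y))\<^sup>2 / (2 * \<kappa>))"
proof (rule dual_transportI)
  show "prob_space \<mu>" by fact
  interpret prob_space \<mu> by fact
  interpret information_space \<mu> "exp 1" by unfold_locales auto
  have [simp]: "space \<mu> = UNIV" using sets_eq_imp_space_eq[OF sets] by simp
  have [measurable_cong]: "sets \<mu> = sets borel" by fact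
  fix f g r
  assume f[measurable]: "f \<in> borel_measurable \<mu>" and g[measurable]: "g \<in> borel_measurable \<mu>"
    and "\<And>x. x \<in> space \<mu> \<Longrightarrow> \<bar>f x\<bar> \<le> r" "\<And>x. x \<in> space \<mu> \<Longrightarrow> \<bar>g x\<bar> \<le> r"
    and "\<And>x y. x \<in> space \<mu> \<Longrightarrow> y \<in> space \<mu> \<Longrightarrow> g x - f y \<le> (norm (x - y))\<^sup>2 / (2 * \<kappa>)"
  then have bf: "\<And>x. \<bar>f x\<bar> \<le> r" and bg: "\<And>x. \<bar>g x\<bar> \<le> r"
    and d: "\<And>x y. g x - f y \<le> (norm (x - y))\<^sup>2 / (2 * \<kappa>)" by auto
  define Z where "Z = (\<integral>x. exp (g x) \<partial>\<mu>)"
  have Zb: "exp (- r) \<le> Z" "Z \<le> exp r"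
    unfolding Z_def using bg by (auto intro!: integral_in_interval simp: abs_le_iff minus_le_iff)
  have Z: "0 < Z" using Zb(1) exp_gt_zero[of "- r"] by linarith
  have ieg: "integrable \<mu> (\<lambda>x. exp (g x))"
    using bg by (intro integrable_bounded[of _ "exp r"]) (auto simp: abs_le_iff)
  define h where "h x = exp (g x) / Z" for x
  have [measurable]: "h \<in> borel_measurable \<mu>" unfolding h_def by measurable
  have h0: "0 < h x" for x using Z by (simp add: h_def)
  have lnh: "ln (h x) = g x - ln Z" for x using Z by (simp add: h_def ln_div)
  define \<nu> where "\<nu> = density \<mu> h"
  have \<nu>: "prob_space \<nu>"
  proof
    have "emeasure \<nu> (space \<nu>) = (\<integral>\<^sup>+ x. ennreal (h x) \<partial>\<mu>)"
      by (simp add: \<nu>_def emeasure_density)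
    also have "\<dots> = ennreal (\<integral>x. h x \<partial>\<mu>)"
      using ieg h0 by (intro nn_integral_eq_integral) (auto simp: h_def less_imp_le)
    also have "(\<integral>x. h x \<partial>\<mu>) = 1" using Z by (simp add: h_def Z_def)
    finally show "emeasure \<nu> (space \<nu>) = 1" by simp
  qed
  interpret N: prob_space \<nu> by fact
  have sets\<nu>: "sets \<nu> = sets borel" by (simp add: \<nu>_def sets)
  then have [simp]: "space \<nu> = UNIV" using sets_eq_imp_space_eq by force
  have [measurable_cong]: "sets \<nu> = sets borel" by fact
  have ac: "absolutely_continuous \<mu> \<nu>" by (simp add: \<nu>_def absolutely_continuousI_density)
  \<comment> \<open>The entropy is defined through the Radon-Nikodym derivative, which equals
    \<open>h\<close> only almost everywhere. Since \<open>ln (h x) = g x - ln Z\<close>, the entropy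
    of \<open>\<nu>\<close> is the integral of \<open>g\<close> minus \<open>ln Z\<close>: the
    equality case of the Gibbs variational principle, which is the reason for this choice of
    \<open>\<nu>\<close>.\<close>
  have RN: "AE x in \<mu>. ennreal (h x) = RN_deriv \<mu> \<nu> x"
    by (rule RN_deriv_unique) (auto simp: \<nu>_def)
  have dens: "AE x in \<nu>. entropy_density (exp 1) \<mu> \<nu> x = g x - ln Z"
  proof -
    have "AE x in \<mu>. entropy_density (exp 1) \<mu> \<nu> x = g x - ln Z"
      using RN
    proof eventually_elim
      case (elim x)
      then show ?case using h0[of x] lnh[of x] by (simp add: entropy_density_def elim[symmetric] log_def)
    qed
    then show ?thesis by (intro absolutely_continuous_AE[OF _ ac]) (simp_all add: \<nu>_def)
  qed
  have ig: "integrable \<nu> g" using bg by (intro N.integrable_bounded[of _ r]) auto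
  have "integrable \<nu> (\<lambda>x. g x - ln Z)" using ig by simp
  moreover have "entropy_density (exp 1) \<mu> \<nu> \<in> borel_measurable \<nu>"
    unfolding \<nu>_def by simp
  ultimately have ent: "integrable \<nu> (entropy_density (exp 1) \<mu> \<nu>)"
    using dens by (subst integrable_cong_AE[of _ _ "\<lambda>x. g x - ln Z"]) auto
  have KL: "KL_divergence (exp 1) \<mu> \<nu> = (\<integral>x. g x \<partial>\<nu>) - ln Z"
  proof -
    have "KL_divergence (exp 1) \<mu> \<nu> = (\<integral>x. g x - ln Z \<partial>\<nu>)"
      unfolding KL_divergence_def using dens \<open>entropy_density (exp 1) \<mu> \<nu> \<in> borel_measurable \<nu>\<close>
      by (intro integral_cong_AE) auto
    then show ?thesis using ig N.prob_space by simp
  qed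
  define R where "R = (\<integral>x. g x \<partial>\<nu>) - ln Z"
  have re: "rel_entropy \<nu> \<mu> = ereal R"
    unfolding rel_entropy_def R_def using ac ent KL by (simp add: sets sets\<nu>)
  have R0: "0 \<le> R"
  proof -
    have "0 \<le> KL_divergence (exp 1) \<mu> (density \<mu> h)"
    proof (rule KL_nonneg)
      show "integrable \<mu> (\<lambda>x. h x * log (exp 1) (h x))"
      proof (rule integrable_bounded[of _ "exp r / Z * (r + \<bar>ln Z\<bar>)"])
        fix x
        have "\<bar>h x * log (exp 1) (h x)\<bar> = h x * \<bar>g x - ln Z\<bar>"
          using h0[of x] by (simp add: log_def lnh abs_mult)
        also have "\<dots> \<le> exp r / Z * (r + \<bar>ln Z\<bar>)"
          using bg[of x] Z by (intro mult_mono) (auto simp: h_def divide_right_mono abs_le_iff)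
        finally show "\<bar>h x * log (exp 1) (h x)\<bar> \<le> exp r / Z * (r + \<bar>ln Z\<bar>)" .
      qed simp
    qed (use \<nu> h0 in \<open>auto simp: \<nu>_def less_imp_le\<close>)
    then show ?thesis using KL by (simp add: \<nu>_def R_def)
  qed
  have W: "wasserstein 2 \<mu> \<nu> \<le> ennreal (sqrt (2 * \<kappa>\<^sub>0 * R))"
    using transport[OF \<nu> sets\<nu> ac] re by simp
  have tc: "transport_cost 2 \<mu> \<nu> \<le> ennreal (2 * \<kappa>\<^sub>0 * R)"
  proof -
    have fin: "transport_cost 2 \<mu> \<nu> \<noteq> \<infinity>"
      using W by (auto simp: wasserstein_def top_unique split: if_splits)
    define t where "t = enn2real (transport_cost 2 \<mu> \<nu>)"
    have t: "transport_cost 2 \<mu> \<nu> = ennreal t" "0 \<le> t" using fin by (simp_all add: t_def less_top)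
    have "ennreal (t powr (1 / 2)) \<le> ennreal (sqrt (2 * \<kappa>\<^sub>0 * R))"
      using W fin by (simp add: wasserstein_def t_def)
    then have "sqrt t \<le> sqrt (2 * \<kappa>\<^sub>0 * R)"
      using t \<kappa> R0 by (simp add: powr_half_sqrt)
    then show ?thesis using t by (simp add: ennreal_leI)
  qed
  have "(\<integral>x. g x \<partial>\<nu>) - (\<integral>x. f x \<partial>\<mu>) \<le> R"
  proof (cases "(\<integral>x. g x \<partial>\<nu>) - (\<integral>x. f x \<partial>\<mu>) \<le> 0")
    case False
    \<comment> \<open>The easy half of Kantorovich duality: the admissibility condition, integrated
      against an arbitrary coupling, bounds the difference of the two integrals by the cost of the
      coupling.\<close>
    have "ennreal (2 * \<kappa> * ((\<integral>x. g x \<partial>\<nu>) - (\<integral>x. f x \<partial>\<mu>))) \<le> transport_cost 2 \<mu> \<nu>"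
      unfolding transport_cost_def
    proof (rule INF_greatest)
      fix \<pi> assume "\<pi> \<in> couplings \<mu> \<nu>"
      then have s\<pi>: "sets \<pi> = sets (borel \<Otimes>\<^sub>M borel)" and p1: "distr \<pi> borel fst = \<mu>" and p2: "distr \<pi> borel snd = \<nu>"
        by (auto simp: couplings_def)
      have [measurable_cong]: "sets \<pi> = sets (borel \<Otimes>\<^sub>M borel)" by fact
      interpret C: prob_space \<pi>
      proof (rule prob_space_distrD)
        show "fst \<in> measurable \<pi> (borel :: 'a measure)" by measurable
        show "prob_space (distr \<pi> borel fst)" unfolding p1 by fact
      qed
      have i1: "integrable \<pi> (\<lambda>z. f (fst z))" and i2: "integrable \<pi> (\<lambda>z. g (snd z))"
        using bf bg by (auto intro!: C.integrable_bounded[of _ r])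
      have e1: "(\<integral>x. f x \<partial>\<mu>) = (\<integral>z. f (fst z) \<partial>\<pi>)"
        unfolding p1[symmetric] using f by (intro integral_distr) (auto simp: measurable_cong_sets[OF sets refl])
      have e2: "(\<integral>x. g x \<partial>\<nu>) = (\<integral>z. g (snd z) \<partial>\<pi>)"
        unfolding p2[symmetric] using g by (intro integral_distr) (auto simp: measurable_cong_sets[OF sets refl])
      have "ennreal (2 * \<kappa> * ((\<integral>x. g x \<partial>\<nu>) - (\<integral>x. f x \<partial>\<mu>)))
          = ennreal (\<integral>z. 2 * \<kappa> * (g (snd z) - f (fst z)) \<partial>\<pi>)"
        using i1 i2 by (simp add: e1 e2)
      also have "\<dots> \<le> ennreal (\<integral>z. max 0 (2 * \<kappa> * (g (snd z) - f (fst z))) \<partial>\<pi>)"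
        using i1 i2 by (intro ennreal_leI integral_mono) auto
      also have "\<dots> = (\<integral>\<^sup>+ z. ennreal (max 0 (2 * \<kappa> * (g (snd z) - f (fst z)))) \<partial>\<pi>)"
        using i1 i2 by (intro nn_integral_eq_integral[symmetric]) auto
      also have "\<dots> \<le> (\<integral>\<^sup>+ z. ennreal (norm (fst z - snd z) powr 2) \<partial>\<pi>)"
      proof (intro nn_integral_mono ennreal_leI)
        fix z
        show "max 0 (2 * \<kappa> * (g (snd z) - f (fst z))) \<le> norm (fst z - snd z) powr 2"
          using d[of "snd z" "fst z"] \<kappa> by (simp add: field_simps norm_minus_commute)
      qed
      finally show "ennreal (2 * \<kappa> * ((\<integral>x. g x \<partial>\<nu>) - (\<integral>x. f x \<partial>\<mu>)))
          \<le> (\<integral>\<^sup>+ z. ennreal (norm (fst z - snd z) powr 2) \<partial>\<pi>)" .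
    qed
    also note tc
    finally have "2 * \<kappa> * ((\<integral>x. g x \<partial>\<nu>) - (\<integral>x. f x \<partial>\<mu>)) \<le> 2 * \<kappa>\<^sub>0 * R"
      using \<kappa> R0 by (subst (asm) ennreal_le_iff) auto
    also have "\<dots> \<le> 2 * \<kappa> * R" using \<kappa> R0 by (intro mult_right_mono) auto
    finally show ?thesis using \<kappa> by simp
  qed (use R0 in simp)
  \<comment> \<open>\<open>R\<close> contains the same integral of \<open>g\<close> under
    \<open>\<nu>\<close>, which cancels.\<close>
  then have "ln Z \<le> (\<integral>x. f x \<partial>\<mu>)" by (simp add: R_def)
  then show "(\<integral>x. exp (g x) \<partial>\<mu>) \<le> exp (\<integral>x. f x \<partial>\<mu>)"
    unfolding Z_def[symmetric] using Z by (metis exp_le_cancel_iff exp_ln)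
qed

section \<open>Lipschitz functionals of paths\<close>

definition sup_norm :: "real \<Rightarrow> (real \<Rightarrow> 'a::euclidean_space) \<Rightarrow> real" where
  "sup_norm T x = (SUP t\<in>{0..T}. norm (x t))"

lemma norm_le_sup_norm:
  assumes "continuous_on {0..T} x" "t \<in> {0..T}"
  shows "norm (x t) \<le> sup_norm T x"
proof -
  have "compact ((\<lambda>t. norm (x t)) ` {0..T})"
    using assms(1) by (intro compact_continuous_image continuous_intros) auto
  then show ?thesis
    unfolding sup_norm_def using assms(2)
    by (intro cSUP_upper) (auto intro: bounded_imp_bdd_above compact_imp_bounded)
qed

lemma sup_norm_le: "0 \<le> T \<Longrightarrow> (\<And>t. t \<in> {0..T} \<Longrightarrow> norm (x t) \<le> c) \<Longrightarrow> sup_norm T x \<le> c"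
  unfolding sup_norm_def by (intro cSUP_least) auto

lemma sup_norm_nonneg: "0 \<le> T \<Longrightarrow> continuous_on {0..T} x \<Longrightarrow> 0 \<le> sup_norm T x"
  by (rule order_trans[OF norm_ge_zero norm_le_sup_norm[of T x 0]]) auto

lemma path_norm_eq_L2_set: "path_norm T n x = L2_set (\<lambda>i. sup_norm T (x i)) {..<n}"
  by (simp add: path_norm_def L2_set_def sup_norm_def)

lemma path_norm_nonneg: "0 \<le> path_norm T n x"
  by (simp add: path_norm_eq_L2_set)

lemma path_norm_zero: "0 \<le> T \<Longrightarrow> path_norm T n (\<lambda>i t. 0) = 0"
  by (simp add: path_norm_def)

lemma path_norm_minus_commute: "path_norm T n (\<lambda>i t. x i t - y i t) = path_norm T n (\<lambda>i t. y i t - x i t)"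
  by (simp add: path_norm_def norm_minus_commute)

lemma path_norm_le_L2_set:
  assumes "0 \<le> T" "x \<in> paths T n" "\<And>i t. i < n \<Longrightarrow> t \<in> {0..T} \<Longrightarrow> norm (x i t) \<le> c i"
  shows "path_norm T n x \<le> L2_set c {..<n}"
  unfolding path_norm_eq_L2_set using assms
  by (intro L2_set_mono sup_norm_le sup_norm_nonneg) (auto simp: paths_def)

lemma paths_diff: "x \<in> paths T n \<Longrightarrow> y \<in> paths T n \<Longrightarrow> (\<lambda>i t. x i t - y i t) \<in> paths T n"
  by (auto simp: paths_def intro!: continuous_intros)

lemma path_norm_triangle:
  assumes "0 \<le> T" and p: "x \<in> paths T n" "y \<in> paths T n" "z \<in> paths T n"
  shows "path_norm T n (\<lambda>i t. x i t - z i t)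
    \<le> path_norm T n (\<lambda>i t. x i t - y i t) + path_norm T n (\<lambda>i t. y i t - z i t)"
proof -
  have "path_norm T n (\<lambda>i t. x i t - z i t)
    \<le> L2_set (\<lambda>i. sup_norm T (\<lambda>t. x i t - y i t) + sup_norm T (\<lambda>t. y i t - z i t)) {..<n}"
  proof (rule path_norm_le_L2_set[OF assms(1) paths_diff[OF p(1,3)]])
    fix i t assume i: "i < n" and t: "t \<in> {0..T}"
    have "norm (x i t - z i t) \<le> norm (x i t - y i t) + norm (y i t - z i t)"
      by (rule norm_diff_triangle_le) auto
    also have "\<dots> \<le> sup_norm T (\<lambda>t. x i t - y i t) + sup_norm T (\<lambda>t. y i t - z i t)"
      using p i t
      by (intro add_mono norm_le_sup_norm[of T "\<lambda>t. x i t - y i t"] norm_le_sup_norm[of T "\<lambda>t. y i t - z i t"])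
        (auto simp: paths_def intro!: continuous_intros)
    finally show "norm (x i t - z i t)
      \<le> sup_norm T (\<lambda>t. x i t - y i t) + sup_norm T (\<lambda>t. y i t - z i t)" .
  qed
  also have "\<dots> \<le> path_norm T n (\<lambda>i t. x i t - y i t) + path_norm T n (\<lambda>i t. y i t - z i t)"
    unfolding path_norm_eq_L2_set by (rule L2_set_triangle_ineq)
  finally show ?thesis .
qed

definition path_lipschitz ::
  "real \<Rightarrow> real \<Rightarrow> nat \<Rightarrow> ((nat \<Rightarrow> real \<Rightarrow> 'a::euclidean_space) \<Rightarrow> real) \<Rightarrow> bool" where
  "path_lipschitz C T n \<Psi> \<longleftrightarrow>
     (\<forall>x\<in>paths T n. \<forall>y\<in>paths T n. \<bar>\<Psi> x - \<Psi> y\<bar> \<le> C * path_norm T n (\<lambda>i t. x i t - y i t))"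

lemma path_lipschitzD:
  "path_lipschitz C T n \<Psi> \<Longrightarrow> x \<in> paths T n \<Longrightarrow> y \<in> paths T n \<Longrightarrow>
    \<bar>\<Psi> x - \<Psi> y\<bar> \<le> C * path_norm T n (\<lambda>i t. x i t - y i t)"
  by (simp add: path_lipschitz_def)

lemma lipschitz1_paths_iff: "lipschitz1_paths T n \<Phi> \<longleftrightarrow> path_lipschitz 1 T n \<Phi>"
  by (simp add: lipschitz1_paths_def path_lipschitz_def)

text \<open>\<open>\<Psi>\<close> acts on representatives, but the seminorm sees only
  \<open>i < n\<close> and \<open>t \<in> {0..T}\<close>. This is the licence to change a
  representative elsewhere.\<close>

lemma path_lipschitz_cong:
  assumes "0 \<le> T" "path_lipschitz C T n \<Psi>" "x \<in> paths T n" "y \<in> paths T n"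
    and eq: "\<And>i t. i < n \<Longrightarrow> t \<in> {0..T} \<Longrightarrow> x i t = y i t"
  shows "\<Psi> x = \<Psi> y"
proof -
  have "path_norm T n (\<lambda>i t. x i t - y i t) \<le> L2_set (\<lambda>_. 0) {..<n}"
    using eq by (intro path_norm_le_L2_set assms(1) paths_diff assms(3,4)) auto
  then have "path_norm T n (\<lambda>i t. x i t - y i t) = 0"
    using path_norm_nonneg[of T n "\<lambda>i t. x i t - y i t"] by (simp add: L2_set_def)
  then show ?thesis using path_lipschitzD[OF assms(2-4)] by simp
qed

text \<open>McShane's formula: \<open>F\<close> is the infimum of the cones with apex
  \<open>\<phi> s\<close> and height \<open>h s\<close>, which the triangle inequality bounds from
  below. The data are indexed by \<open>S\<close>, and \<open>\<phi>\<close> may identify indices;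
  the bound on \<open>h\<close> then forces equal values. In the application \<open>S\<close>
  consists of outcomes, \<open>\<phi>\<close> gives their driving paths, and \<open>d\<close> is a
  multiple of a seminorm distance.\<close>

lemma lipschitz_extension:
  fixes d :: "'a \<Rightarrow> 'a \<Rightarrow> real" and h :: "'b \<Rightarrow> real"
  assumes "S \<noteq> {}" and \<phi>: "\<And>s. s \<in> S \<Longrightarrow> \<phi> s \<in> A"
    and d0: "\<And>x. x \<in> A \<Longrightarrow> d x x = 0" and sym: "\<And>x y. x \<in> A \<Longrightarrow> y \<in> A \<Longrightarrow> d x y = d y x"
    and tri: "\<And>x y z. x \<in> A \<Longrightarrow> y \<in> A \<Longrightarrow> z \<in> A \<Longrightarrow> d x z \<le> d x y + d y z"
    and h: "\<And>s s'. s \<in> S \<Longrightarrow> s' \<in> S \<Longrightarrow> \<bar>h s - h s'\<bar> \<le> d (\<phi> s) (\<phi> s')"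
  obtains F where "\<And>s. s \<in> S \<Longrightarrow> F (\<phi> s) = h s"
    "\<And>x y. x \<in> A \<Longrightarrow> y \<in> A \<Longrightarrow> \<bar>F x - F y\<bar> \<le> d x y"
proof -
  obtain s\<^sub>0 where s\<^sub>0: "s\<^sub>0 \<in> S" using assms(1) by blast
  define F where "F x = (INF s\<in>S. h s + d x (\<phi> s))" for x
  have lower: "F x \<le> h s + d x (\<phi> s)" if "x \<in> A" "s \<in> S" for x s
  proof -
    have "h s\<^sub>0 - d x (\<phi> s\<^sub>0) \<le> h s + d x (\<phi> s)" if "s \<in> S" for s
      using h[OF s\<^sub>0 that] tri[of "\<phi> s\<^sub>0" x "\<phi> s"] sym[of x "\<phi> s\<^sub>0"] \<phi>[OF s\<^sub>0] \<phi>[OF that] \<open>x \<in> A\<close>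
      by linarith
    then show ?thesis unfolding F_def
      using that(2) by (intro cINF_lower bdd_belowI2[where m = "h s\<^sub>0 - d x (\<phi> s\<^sub>0)"]) auto
  qed
  have le: "F x - F y \<le> d x y" if "x \<in> A" "y \<in> A" for x y
  proof -
    have "F x - d x y \<le> h s + d y (\<phi> s)" if "s \<in> S" for s
      using lower[of x s] tri[of x y "\<phi> s"] \<phi>[of s] that \<open>x \<in> A\<close> \<open>y \<in> A\<close> by linarith
    then have "F x - d x y \<le> F y" unfolding F_def[of y] using assms(1) by (intro cINF_greatest) auto
    then show ?thesis by simp
  qed
  have "F (\<phi> s) = h s" if s: "s \<in> S" for s
  proof (rule antisym)
    show "F (\<phi> s) \<le> h s" using lower[of "\<phi> s" s] d0 \<phi> s by simp
    have "h s \<le> h s' + d (\<phi> s) (\<phi> s')" if "s' \<in> S" for s'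
      using h[OF s that] by linarith
    then show "h s \<le> F (\<phi> s)" unfolding F_def using assms(1) by (intro cINF_greatest) auto
  qed
  moreover have "\<bar>F x - F y\<bar> \<le> d x y" if "x \<in> A" "y \<in> A" for x y
    using le[OF that] le[OF that(2,1)] sym[OF that] by simp
  ultimately show thesis by (rule that)
qed

lemma path_lipschitz_extension:
  fixes h :: "'w \<Rightarrow> real" and \<phi> :: "'w \<Rightarrow> nat \<Rightarrow> real \<Rightarrow> 'a::euclidean_space"
  assumes "0 \<le> T" "0 \<le> C" "S \<noteq> {}" "\<And>s. s \<in> S \<Longrightarrow> \<phi> s \<in> paths T n"
    and "\<And>s s'. s \<in> S \<Longrightarrow> s' \<in> S \<Longrightarrow> \<bar>h s - h s'\<bar> \<le> C * path_norm T n (\<lambda>i t. \<phi> s i t - \<phi> s' i t)"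
  obtains \<Psi> where "path_lipschitz C T n \<Psi>" "\<And>s. s \<in> S \<Longrightarrow> \<Psi> (\<phi> s) = h s"
proof -
  obtain \<Psi> where "\<And>s. s \<in> S \<Longrightarrow> \<Psi> (\<phi> s) = h s"
    "\<And>x y. x \<in> paths T n \<Longrightarrow> y \<in> paths T n \<Longrightarrow> \<bar>\<Psi> x - \<Psi> y\<bar> \<le> C * path_norm T n (\<lambda>i t. x i t - y i t)"
  proof (rule lipschitz_extension[of S \<phi> "paths T n" "\<lambda>x y. C * path_norm T n (\<lambda>i t. x i t - y i t)" h])
    fix x y z :: "nat \<Rightarrow> real \<Rightarrow> 'a"
    assume "x \<in> paths T n" "y \<in> paths T n" "z \<in> paths T n"
    then show "C * path_norm T n (\<lambda>i t. x i t - z i t)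
        \<le> C * path_norm T n (\<lambda>i t. x i t - y i t) + C * path_norm T n (\<lambda>i t. y i t - z i t)"
      unfolding distrib_left[symmetric] using assms(1,2) by (intro mult_left_mono path_norm_triangle)
  next
    fix x y :: "nat \<Rightarrow> real \<Rightarrow> 'a"
    show "C * path_norm T n (\<lambda>i t. x i t - x i t) = 0"
      using path_norm_zero[OF assms(1), of n, where 'a = 'a] by simp
    show "C * path_norm T n (\<lambda>i t. x i t - y i t) = C * path_norm T n (\<lambda>i t. y i t - x i t)"
      by (subst path_norm_minus_commute) simp
  qed (use assms in \<open>blast+\<close>)
  then show thesis by (intro that[of \<Psi>]) (auto simp: path_lipschitz_def)
qed

section \<open>Stability of the particle system\<close>

lemma prob_space_uniform_count: "0 < n \<Longrightarrow> prob_space (uniform_count_measure {..<n::nat})"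
  by (intro prob_space_uniform_count_measure) auto

lemma empirical_in_prob_moment:
  fixes x :: "nat \<Rightarrow> 'a::euclidean_space"
  assumes "0 < n"
  shows "empirical n x \<in> prob_moment p"
proof -
  have m: "x \<in> measurable (uniform_count_measure {..<n}) borel"
    by (simp add: uniform_count_measure_def)
  have "integrable (uniform_count_measure {..<n}) (\<lambda>i. norm (x i) powr p)"
    by (simp add: uniform_count_measure_def integrable_point_measure_finite)
  then have "integrable (empirical n x) (\<lambda>y. norm y powr p)"
    unfolding empirical_def using m by (subst integrable_distr_eq) auto
  moreover have "prob_space (empirical n x)"
    unfolding empirical_def by (rule prob_space.prob_space_distr[OF prob_space_uniform_count[OF assms] m])
  ultimately show ?thesis by (simp add: prob_moment_def empirical_def)
qed

text \<open>Coupling the two empirical measures through the common index.\<close>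

lemma wasserstein_empirical_le:
  fixes x y :: "nat \<Rightarrow> 'a::euclidean_space"
  assumes n: "0 < n"
  shows "wasserstein 2 (empirical n x) (empirical n y)
    \<le> ennreal (L2_set (\<lambda>i. norm (x i - y i)) {..<n} / sqrt n)"
proof -
  let ?U = "uniform_count_measure {..<n}"
  define S where "S = (\<Sum>i<n. (norm (x i - y i))\<^sup>2) / n"
  have S: "0 \<le> S" by (simp add: S_def sum_nonneg)
  define \<pi> where "\<pi> = distr ?U (borel \<Otimes>\<^sub>M borel) (\<lambda>i. (x i, y i))"
  have m: "h \<in> measurable ?U N \<longleftrightarrow> h \<in> {..<n} \<rightarrow> space N" for h and N :: "'b measure"
    by (simp add: uniform_count_measure_def)
  have "\<pi> \<in> couplings (empirical n x) (empirical n y)"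
    unfolding couplings_def \<pi>_def empirical_def
    by (auto simp: distr_distr m comp_def space_pair_measure)
  then have "transport_cost 2 (empirical n x) (empirical n y)
      \<le> (\<integral>\<^sup>+ z. ennreal (norm (fst z - snd z) powr 2) \<partial>\<pi>)"
    unfolding transport_cost_def by (rule INF_lower)
  also have "\<dots> = (\<integral>\<^sup>+ i. ennreal (norm (x i - y i) powr 2) \<partial>?U)"
    unfolding \<pi>_def by (subst nn_integral_distr) (auto simp: m space_pair_measure)
  also have "\<dots> = (\<Sum>i<n. ennreal (1 / n) * ennreal ((norm (x i - y i))\<^sup>2))"
    by (simp add: uniform_count_measure_def nn_integral_point_measure_finite)
  also have "\<dots> = ennreal S"
    by (simp add: S_def ennreal_mult[symmetric] sum_ennreal sum_divide_distrib)
  finally have tc: "transport_cost 2 (empirical n x) (empirical n y) \<le> ennreal S" .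
  then have "transport_cost 2 (empirical n x) (empirical n y) \<noteq> \<infinity>" by (auto simp: top_unique)
  moreover have "enn2real (transport_cost 2 (empirical n x) (empirical n y)) \<le> S"
    using tc S by (simp add: enn2real_leI)
  then have "enn2real (transport_cost 2 (empirical n x) (empirical n y)) powr (1 / 2) \<le> sqrt S"
    by (simp add: powr_half_sqrt)
  ultimately have "wasserstein 2 (empirical n x) (empirical n y) \<le> ennreal (sqrt S)"
    by (simp add: wasserstein_def ennreal_leI)
  then show ?thesis by (simp add: S_def L2_set_def real_sqrt_divide)
qed

text \<open>In the norm weighted by \<open>exp (- \<beta> t)\<close> with \<open>\<beta>\<close> large the integral term is a contraction,
  which replaces Gronwall's inequality. The empirical measures contribute the quadratic mean \<open>P\<close>
  of the weighted norms, whose \<open>\<ell>\<^sup>2\<close> norm over the particles is that of the weighted norms.\<close>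

lemma integral_equation_stable:
  fixes b :: "real \<Rightarrow> 'a::euclidean_space \<Rightarrow> 'a measure \<Rightarrow> 'a"
  assumes T: "0 < T" and L: "0 \<le> L" and n: "0 < n"
    and b_lipschitz: "\<And>t x x' m m'. t \<in> {0..T} \<Longrightarrow> m \<in> prob_moment 2 \<Longrightarrow> m' \<in> prob_moment 2 \<Longrightarrow>
          ennreal (norm (b t x m - b t x' m'))
            \<le> ennreal L * (ennreal (norm (x - x')) + wasserstein 2 m m')"
    and p: "x \<in> paths T n" "y \<in> paths T n" "z \<in> paths T n" "w \<in> paths T n"
    and ix: "\<And>i t. i < n \<Longrightarrow> t \<in> {0..T} \<Longrightarrow>
      set_integrable lborel {0..t} (\<lambda>s. b s (x i s) (empirical n (\<lambda>j. x j s)))"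
    and x: "\<And>i t. i < n \<Longrightarrow> t \<in> {0..T} \<Longrightarrow>
      x i t = z i t + (LINT s:{0..t}|lborel. b s (x i s) (empirical n (\<lambda>j. x j s)))"
    and iy: "\<And>i t. i < n \<Longrightarrow> t \<in> {0..T} \<Longrightarrow>
      set_integrable lborel {0..t} (\<lambda>s. b s (y i s) (empirical n (\<lambda>j. y j s)))"
    and y: "\<And>i t. i < n \<Longrightarrow> t \<in> {0..T} \<Longrightarrow>
      y i t = w i t + (LINT s:{0..t}|lborel. b s (y i s) (empirical n (\<lambda>j. y j s)))"
  shows "path_norm T n (\<lambda>i t. x i t - y i t)
    \<le> 2 * exp (4 * (L + 1) * T) * path_norm T n (\<lambda>i t. z i t - w i t)"
proof -
  \<comment> \<open>The factor 4 makes the integral term cost a quarter of \<open>q i + P\<close>,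
    and \<open>L + 1\<close> keeps \<beta> positive when \<open>L = 0\<close>. Removing the weight
    at the end costs \<open>exp (\<beta> * T)\<close>, the exponential in the claim.\<close>
  define \<beta> where "\<beta> = 4 * (L + 1)"
  have \<beta>: "0 < \<beta>" "L / \<beta> \<le> 1 / 4" using L by (auto simp: \<beta>_def field_simps)
  define a where "a i = sup_norm T (\<lambda>t. z i t - w i t)" for i
  define q where "q i = sup_norm T (\<lambda>t. exp (- \<beta> * t) *\<^sub>R (x i t - y i t))" for i
  define P where "P = L2_set q {..<n} / sqrt n"
  have c: "continuous_on {0..T} (\<lambda>t. exp (- \<beta> * t) *\<^sub>R (x i t - y i t))"
    "continuous_on {0..T} (\<lambda>t. z i t - w i t)" if "i < n" for i
    using p that by (auto simp: paths_def intro!: continuous_intros)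
  have q0: "0 \<le> q i" if "i < n" for i
    unfolding q_def using T c[OF that] by (intro sup_norm_nonneg) auto
  have P0: "0 \<le> P" by (simp add: P_def)
  have D: "norm (x i t - y i t) \<le> exp (\<beta> * t) * q i" if "i < n" "t \<in> {0..T}" for i t
  proof -
    have "exp (- \<beta> * t) * norm (x i t - y i t) \<le> q i"
      unfolding q_def using norm_le_sup_norm[OF c(1)[OF that(1)] that(2)] by simp
    then show ?thesis by (simp add: exp_minus field_simps)
  qed
  have W: "wasserstein 2 (empirical n (\<lambda>j. x j t)) (empirical n (\<lambda>j. y j t)) \<le> ennreal (exp (\<beta> * t) * P)"
    if t: "t \<in> {0..T}" for t
  proof -
    have "L2_set (\<lambda>i. norm (x i t - y i t)) {..<n} \<le> L2_set (\<lambda>i. exp (\<beta> * t) * q i) {..<n}"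
      using D t by (intro L2_set_mono) auto
    also have "\<dots> = exp (\<beta> * t) * L2_set q {..<n}" by (rule L2_set_right_distrib[symmetric]) simp
    finally have "L2_set (\<lambda>i. norm (x i t - y i t)) {..<n} / sqrt n \<le> exp (\<beta> * t) * P"
      using n by (simp add: P_def divide_right_mono)
    then show ?thesis by (rule order_trans[OF wasserstein_empirical_le[OF n] ennreal_leI])
  qed
  have B: "norm (b s (x i s) (empirical n (\<lambda>j. x j s)) - b s (y i s) (empirical n (\<lambda>j. y j s)))
      \<le> L * (q i + P) * exp (\<beta> * s)" if i: "i < n" and s: "s \<in> {0..T}" for i s
  proof -
    have "ennreal (norm (b s (x i s) (empirical n (\<lambda>j. x j s)) - b s (y i s) (empirical n (\<lambda>j. y j s))))
        \<le> ennreal L * (ennreal (norm (x i s - y i s)) + wasserstein 2 (empirical n (\<lambda>j. x j s)) (empirical n (\<lambda>j. y j s)))"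
      by (intro b_lipschitz s empirical_in_prob_moment n)
    also have "\<dots> \<le> ennreal L * (ennreal (exp (\<beta> * s) * q i) + ennreal (exp (\<beta> * s) * P))"
      using D[OF i s] W[OF s] by (intro mult_left_mono add_mono ennreal_leI) auto
    also have "\<dots> = ennreal (L * (q i + P) * exp (\<beta> * s))"
      using L q0[OF i] P0 by (simp add: ennreal_mult[symmetric] ennreal_plus[symmetric] algebra_simps del: ennreal_plus)
    finally show ?thesis using L q0[OF i] P0 by (subst (asm) ennreal_le_iff) auto
  qed
  have q: "q i \<le> a i + (q i + P) / 4" if i: "i < n" for i
  proof (subst q_def, rule sup_norm_le)
    fix t assume t: "t \<in> {0..T}"
    let ?f = "\<lambda>s. b s (x i s) (empirical n (\<lambda>j. x j s)) - b s (y i s) (empirical n (\<lambda>j. y j s))"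
    let ?g = "\<lambda>s. L * (q i + P) * exp (\<beta> * s)"
    have if': "set_integrable lborel {0..t} ?f"
      by (intro set_integral_diff ix iy i t)
    have ig: "set_integrable lborel {0..t} ?g"
      by (intro borel_integrable_compact[unfolded set_integrable_def[symmetric]] continuous_intros) auto
    have "x i t - y i t = (z i t - w i t) + (LINT s:{0..t}|lborel. ?f s)"
      using x[OF i t] y[OF i t] set_integral_diff(2)[OF ix[OF i t] iy[OF i t]] by simp
    then have "norm (x i t - y i t) \<le> norm (z i t - w i t) + norm (LINT s:{0..t}|lborel. ?f s)"
      by (simp only: norm_triangle_ineq)
    moreover have "norm (z i t - w i t) \<le> a i"
      unfolding a_def using norm_le_sup_norm[OF c(2)[OF i] t] .
    moreover have "norm (LINT s:{0..t}|lborel. ?f s) \<le> (LINT s:{0..t}|lborel. ?g s)"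
      unfolding set_lebesgue_integral_def
    proof (rule Bochner_Integration.integral_norm_bound_integral)
      fix s
      show "norm (indicator {0..t} s *\<^sub>R ?f s) \<le> indicator {0..t} s *\<^sub>R ?g s"
        using B[OF i, of s] t by (cases "s \<in> {0..t}") auto
    qed (use if' ig in \<open>auto simp: set_integrable_def\<close>)
    moreover have "(LINT s:{0..t}|lborel. ?g s) \<le> exp (\<beta> * t) * ((q i + P) / 4)"
    proof -
      have "(LINT s:{0..t}|lborel. ?g s) = (\<integral>s. ?g s * indicator {0..t} s \<partial>lborel)"
        unfolding set_lebesgue_integral_def by (simp add: mult.commute)
      also have "\<dots> = L * (q i + P) / \<beta> * exp (\<beta> * t) - L * (q i + P) / \<beta> * exp (\<beta> * 0)"
        using t \<beta> by (intro integral_FTC_Icc_real[where F = "\<lambda>s. L * (q i + P) / \<beta> * exp (\<beta> * s)"])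
          (auto intro!: derivative_eq_intros)
      also have "\<dots> \<le> L * (q i + P) / \<beta> * exp (\<beta> * t)"
        using L \<beta> P0 q0[OF i] by simp
      also have "\<dots> = (L / \<beta>) * (exp (\<beta> * t) * (q i + P))" by simp
      also have "\<dots> \<le> (1 / 4) * (exp (\<beta> * t) * (q i + P))"
        using \<beta> P0 q0[OF i] by (intro mult_right_mono) auto
      finally show ?thesis by simp
    qed
    ultimately have "norm (x i t - y i t) \<le> a i + exp (\<beta> * t) * ((q i + P) / 4)" by linarith
    then have "exp (- \<beta> * t) * norm (x i t - y i t) \<le> exp (- \<beta> * t) * (a i + exp (\<beta> * t) * ((q i + P) / 4))"
      by (intro mult_left_mono) auto
    also have "\<dots> = exp (- \<beta> * t) * a i + (q i + P) / 4"
      by (simp add: exp_minus field_simps)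
    also have "\<dots> \<le> 1 * a i + (q i + P) / 4"
      unfolding a_def using \<beta> t T c(2)[OF i] by (intro add_mono mult_right_mono sup_norm_nonneg) auto
    finally show "norm (exp (- \<beta> * t) *\<^sub>R (x i t - y i t)) \<le> a i + (q i + P) / 4" by simp
  qed (use T in simp)
  \<comment> \<open>The constant family \<open>P\<close> has the same l2 norm as \<open>q\<close>.
    So the two quarters together absorb half of the left side, which leaves the factor 2.\<close>
  have "L2_set q {..<n} \<le> L2_set (\<lambda>i. a i + (q i / 4 + P / 4)) {..<n}"
    using q q0 by (intro L2_set_mono) (auto simp: add_divide_distrib)
  also have "\<dots> \<le> L2_set a {..<n} + L2_set (\<lambda>i. q i / 4 + P / 4) {..<n}"
    by (rule L2_set_triangle_ineq)
  also have "L2_set (\<lambda>i. q i / 4 + P / 4) {..<n} \<le> L2_set (\<lambda>i. q i / 4) {..<n} + L2_set (\<lambda>i. P / 4) {..<n}"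
    by (rule L2_set_triangle_ineq)
  also have "L2_set (\<lambda>i. q i / 4) {..<n} = L2_set q {..<n} / 4"
    using L2_set_right_distrib[of "1 / 4" q "{..<n}"] by simp
  also have "L2_set (\<lambda>i. P / 4) {..<n} = L2_set q {..<n} / 4"
    using P0 n by (simp add: L2_set_constant P_def)
  finally have "L2_set q {..<n} \<le> 2 * L2_set a {..<n}" by simp
  then have qa: "exp (\<beta> * T) * L2_set q {..<n} \<le> exp (\<beta> * T) * (2 * L2_set a {..<n})"
    by (intro mult_left_mono) auto
  have "path_norm T n (\<lambda>i t. x i t - y i t) \<le> L2_set (\<lambda>i. exp (\<beta> * T) * q i) {..<n}"
  proof (rule path_norm_le_L2_set)
    fix i t assume i: "i < n" and t: "t \<in> {0..T}"
    have "exp (\<beta> * t) * q i \<le> exp (\<beta> * T) * q i"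
      using \<beta> t q0[OF i] by (intro mult_right_mono) auto
    then show "norm (x i t - y i t) \<le> exp (\<beta> * T) * q i" using D[OF i t] by simp
  qed (use T p in \<open>auto intro: paths_diff\<close>)
  also have "\<dots> = exp (\<beta> * T) * L2_set q {..<n}" by (rule L2_set_right_distrib[symmetric]) simp
  also note qa
  also have "L2_set a {..<n} = path_norm T n (\<lambda>i t. z i t - w i t)"
    by (simp add: path_norm_eq_L2_set a_def[abs_def])
  finally show ?thesis by (simp add: \<beta>_def)
qed

section \<open>Polygonal approximation\<close>

text \<open>The polygonal path on the grid \<open>j * T / K\<close> with initial value \<open>x\<^sub>0\<close> and increments \<open>\<Delta>\<close>.\<close>

definition polygon :: "real \<Rightarrow> nat \<Rightarrow> 'a::euclidean_space \<Rightarrow> (nat \<Rightarrow> 'a) \<Rightarrow> real \<Rightarrow> 'a" where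
  "polygon T K x\<^sub>0 \<Delta> t = x\<^sub>0 + (\<Sum>j<K. max 0 (min 1 (t * K / T - j)) *\<^sub>R \<Delta> j)"

definition increments :: "real \<Rightarrow> nat \<Rightarrow> (real \<Rightarrow> 'a::euclidean_space) \<Rightarrow> nat \<Rightarrow> 'a" where
  "increments T K x j = x (real (Suc j) * T / K) - x (real j * T / K)"

lemma continuous_polygon: "continuous_on S (polygon T K x\<^sub>0 \<Delta>)"
  unfolding polygon_def times_divide_eq_right[symmetric] by (intro continuous_intros)

lemma polygon_in_paths: "(\<lambda>i. polygon T K (x\<^sub>0 i) (\<Delta> i)) \<in> paths T n"
  by (simp add: paths_def continuous_polygon)

text \<open>The ramps multiplying the increments have values in [0, 1]. The bound does not depend on
  \<open>t\<close> and hence controls the sup norm.\<close>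

lemma norm_polygon_diff_le:
  "norm (polygon T K x\<^sub>0 \<Delta> t - polygon T K y\<^sub>0 \<Delta>' t) \<le> norm (x\<^sub>0 - y\<^sub>0) + (\<Sum>j<K. norm (\<Delta> j - \<Delta>' j))"
proof -
  let ?c = "\<lambda>j. max 0 (min 1 (t * K / T - real j))"
  have "polygon T K x\<^sub>0 \<Delta> t - polygon T K y\<^sub>0 \<Delta>' t = (x\<^sub>0 - y\<^sub>0) + (\<Sum>j<K. ?c j *\<^sub>R (\<Delta> j - \<Delta>' j))"
    by (simp add: polygon_def scaleR_diff_right sum_subtractf)
  also have "norm \<dots> \<le> norm (x\<^sub>0 - y\<^sub>0) + (\<Sum>j<K. norm (?c j *\<^sub>R (\<Delta> j - \<Delta>' j)))"
    by (intro norm_triangle_le add_mono norm_sum order_refl)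
  also have "(\<Sum>j<K. norm (?c j *\<^sub>R (\<Delta> j - \<Delta>' j))) \<le> (\<Sum>j<K. 1 * norm (\<Delta> j - \<Delta>' j))"
    unfolding norm_scaleR by (intro sum_mono mult_right_mono) auto
  finally show ?thesis by simp
qed

text \<open>For \<open>t\<close> in cell \<open>k\<close> the ramps of the earlier cells equal 1 and
  their increments telescope, those of the later cells vanish, and ramp \<open>k\<close>
  interpolates linearly.\<close>

lemma polygon_between_grid_points:
  assumes T: "0 < T" and k: "k < K" and t: "real k \<le> t * K / T" "t * K / T \<le> real k + 1"
  shows "polygon T K (x 0) (increments T K x) t =
    x (real k * T / K) + (t * K / T - k) *\<^sub>R (x (real (Suc k) * T / K) - x (real k * T / K))"
proof -
  let ?u = "t * K / T"
  have K: "0 < real K" using k by simp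
  have "(\<Sum>j<K. max 0 (min 1 (?u - real j)) *\<^sub>R increments T K x j)
    = (\<Sum>j<Suc k. max 0 (min 1 (?u - real j)) *\<^sub>R increments T K x j)"
  proof (rule sum.mono_neutral_right)
    show "\<forall>j\<in>{..<K} - {..<Suc k}. max 0 (min 1 (?u - real j)) *\<^sub>R increments T K x j = 0"
    proof
      fix j assume "j \<in> {..<K} - {..<Suc k}"
      then have "real k + 1 \<le> real j" by simp
      then have "max 0 (min 1 (?u - real j)) = 0" using t by linarith
      then show "max 0 (min 1 (?u - real j)) *\<^sub>R increments T K x j = 0" by simp
    qed
  qed (use k in auto)
  also have "\<dots> = (\<Sum>j<k. max 0 (min 1 (?u - real j)) *\<^sub>R increments T K x j) + (?u - k) *\<^sub>R increments T K x k"
    using t by simp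
  also have "(\<Sum>j<k. max 0 (min 1 (?u - real j)) *\<^sub>R increments T K x j) = (\<Sum>j<k. increments T K x j)"
  proof (rule sum.cong)
    fix j assume "j \<in> {..<k}"
    then have "real j + 1 \<le> real k" by simp
    then have "max 0 (min 1 (?u - real j)) = 1" using t by linarith
    then show "max 0 (min 1 (?u - real j)) *\<^sub>R increments T K x j = increments T K x j" by simp
  qed simp
  also have "\<dots> = x (real k * T / K) - x 0"
    unfolding increments_def by (subst sum_lessThan_telescope) simp
  finally show ?thesis by (simp add: polygon_def increments_def)
qed

lemma sup_norm_polygon_tendsto:
  fixes x :: "real \<Rightarrow> 'a::euclidean_space"
  assumes T: "0 < T" and x: "continuous_on {0..T} x"
  shows "(\<lambda>K. sup_norm T (\<lambda>t. polygon T K (x 0) (increments T K x) t - x t)) \<longlonglongrightarrow> 0"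
proof (rule LIMSEQ_I)
  fix \<epsilon> :: real assume "0 < \<epsilon>"
  have "uniformly_continuous_on {0..T} x"
    using x by (intro compact_uniformly_continuous) auto
  then obtain \<delta> where \<delta>: "0 < \<delta>"
    "\<And>s t. s \<in> {0..T} \<Longrightarrow> t \<in> {0..T} \<Longrightarrow> \<bar>s - t\<bar> < \<delta> \<Longrightarrow> norm (x s - x t) < \<epsilon> / 2"
    using \<open>0 < \<epsilon>\<close> unfolding uniformly_continuous_on_def dist_norm
    by (metis half_gt_zero real_norm_def)
  obtain K\<^sub>0 :: nat where K\<^sub>0: "T / \<delta> < K\<^sub>0" using reals_Archimedean2 by blast
  show "\<exists>N. \<forall>K\<ge>N. norm (sup_norm T (\<lambda>t. polygon T K (x 0) (increments T K x) t - x t) - 0) < \<epsilon>"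
  proof (intro exI allI impI)
    fix K assume "K \<ge> K\<^sub>0"
    then have TK: "T / \<delta> < real K" using K\<^sub>0 by linarith
    then have K: "0 < real K" using T \<delta>(1) by (smt (verit) divide_pos_pos)
    then have h: "T / K < \<delta>" using TK \<delta>(1) by (simp add: field_simps)
    have "sup_norm T (\<lambda>t. polygon T K (x 0) (increments T K x) t - x t) \<le> \<epsilon> / 2"
    proof (rule sup_norm_le)
      fix t assume t: "t \<in> {0..T}"
      let ?u = "t * K / T"
      \<comment> \<open>At \<open>t = T\<close> the floor is \<open>K\<close>, and no cell has this
        number; the minimum puts the right end point into the last cell.\<close>
      define k where "k = min (nat \<lfloor>?u\<rfloor>) (K - 1)"
      have u: "0 \<le> ?u" "?u \<le> K" using t T K by (auto simp: field_simps)
      have k: "k < K" "real k \<le> ?u" "?u \<le> real k + 1"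
      proof -
        show "k < K" using K by (simp add: k_def)
        show "real k \<le> ?u" using u(1) unfolding k_def by (smt (verit) min.cobounded1 of_nat_floor of_nat_mono)
        show "?u \<le> real k + 1"
        proof (cases "nat \<lfloor>?u\<rfloor> \<le> K - 1")
          case True
          then have "k = nat \<lfloor>?u\<rfloor>" by (simp add: k_def)
          then show ?thesis using u(1) by linarith
        next
          case False
          then have "real k + 1 = K" using K by (simp add: k_def)
          then show ?thesis using u(2) by simp
        qed
      qed
      define \<theta> where "\<theta> = ?u - k"
      have \<theta>: "0 \<le> \<theta>" "\<theta> \<le> 1" using k by (auto simp: \<theta>_def)
      define s s' where "s = real k * T / K" and "s' = real (Suc k) * T / K"
      have "real k * T \<le> real K * T" "real (Suc k) * T \<le> real K * T"
        using k(1) T by (auto intro!: mult_right_mono simp del: of_nat_Suc)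
      then have s: "s \<in> {0..T}" "s' \<in> {0..T}"
        using T K by (auto simp: s_def s'_def divide_le_eq mult.commute)
      have "s \<le> t" "t \<le> s'" "s' - s = T / K"
        using k(2,3) T K by (auto simp: s_def s'_def field_simps)
      then have d: "\<bar>s - t\<bar> < \<delta>" "\<bar>s' - t\<bar> < \<delta>" using h by linarith+
      have "polygon T K (x 0) (increments T K x) t - x t = (1 - \<theta>) *\<^sub>R (x s - x t) + \<theta> *\<^sub>R (x s' - x t)"
        unfolding polygon_between_grid_points[OF T k] s_def[symmetric] s'_def[symmetric] \<theta>_def[symmetric]
        by (simp add: algebra_simps)
      also have "norm \<dots> \<le> norm ((1 - \<theta>) *\<^sub>R (x s - x t)) + norm (\<theta> *\<^sub>R (x s' - x t))"
        by (rule norm_triangle_ineq)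
      also have "\<dots> = (1 - \<theta>) * norm (x s - x t) + \<theta> * norm (x s' - x t)"
        using \<theta> by simp
      also have "\<dots> \<le> (1 - \<theta>) * (\<epsilon> / 2) + \<theta> * (\<epsilon> / 2)"
        using \<theta> \<delta>(2)[OF s(1) t d(1)] \<delta>(2)[OF s(2) t d(2)]
        by (intro add_mono mult_left_mono) auto
      also have "\<dots> = \<epsilon> / 2" by (simp add: field_simps)
      finally show "norm (polygon T K (x 0) (increments T K x) t - x t) \<le> \<epsilon> / 2" .
    qed (use T in simp)
    moreover have "0 \<le> sup_norm T (\<lambda>t. polygon T K (x 0) (increments T K x) t - x t)"
      using T x by (intro sup_norm_nonneg continuous_on_diff continuous_polygon) auto
    ultimately show "norm (sup_norm T (\<lambda>t. polygon T K (x 0) (increments T K x) t - x t) - 0) < \<epsilon>"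
      using \<open>0 < \<epsilon>\<close> by simp
  qed
qed

lemma path_lipschitz_polygon_tendsto:
  assumes T: "0 < T" and \<Psi>: "path_lipschitz C T n \<Psi>" and x: "x \<in> paths T n"
  shows "(\<lambda>K. \<Psi> (\<lambda>i. polygon T K (x i 0) (increments T K (x i)))) \<longlonglongrightarrow> \<Psi> x"
proof -
  have "(\<lambda>K. sup_norm T (\<lambda>t. polygon T K (x i 0) (increments T K (x i)) t - x i t)) \<longlonglongrightarrow> 0"
    if "i < n" for i
    using that x by (intro sup_norm_polygon_tendsto T) (auto simp: paths_def)
  then have "(\<lambda>K. sqrt (\<Sum>i<n. (sup_norm T (\<lambda>t. polygon T K (x i 0) (increments T K (x i)) t - x i t))\<^sup>2))
      \<longlonglongrightarrow> sqrt (\<Sum>i<n. 0\<^sup>2)"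
    by (intro tendsto_intros) auto
  then have "(\<lambda>K. path_norm T n (\<lambda>i t. polygon T K (x i 0) (increments T K (x i)) t - x i t)) \<longlonglongrightarrow> 0"
    by (simp add: path_norm_def sup_norm_def)
  then have lim: "(\<lambda>K. C * path_norm T n (\<lambda>i t. polygon T K (x i 0) (increments T K (x i)) t - x i t)) \<longlonglongrightarrow> 0"
    using tendsto_mult_right_zero by blast
  have "(\<lambda>K. \<Psi> (\<lambda>i. polygon T K (x i 0) (increments T K (x i))) - \<Psi> x) \<longlonglongrightarrow> 0"
    by (rule Lim_null_comparison[OF _ lim])
      (use path_lipschitzD[OF \<Psi> polygon_in_paths x] in \<open>simp add: always_eventually\<close>)
  then show ?thesis by (simp add: LIM_zero_iff)
qed

section \<open>Measurability of path functionals\<close>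

lemma borel_measurable_lipschitz_coordinates:
  fixes F :: "('i::countable \<Rightarrow> 'a::euclidean_space) \<Rightarrow> real"
  assumes F: "\<And>v w. \<bar>F v - F w\<bar> \<le> C * (\<Sum>j\<in>J. norm (v j - w j))"
    and V: "\<And>j. (\<lambda>\<omega>. V \<omega> j) \<in> borel_measurable M"
  shows "(\<lambda>\<omega>. F (V \<omega>)) \<in> borel_measurable M"
proof -
  have "continuous_on UNIV F"
    unfolding continuous_on_def
  proof
    fix v :: "'i \<Rightarrow> 'a"
    have "((\<lambda>w. C * (\<Sum>j\<in>J. norm (w j - v j))) \<longlongrightarrow> C * (\<Sum>j\<in>J. norm (v j - v j))) (at v)"
    proof (intro tendsto_intros)
      fix j
      show "((\<lambda>w. w j) \<longlongrightarrow> v j) (at v)"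
        using continuous_on_product_coordinates[of j] unfolding continuous_on_def by auto
    qed
    then have "((\<lambda>w. C * (\<Sum>j\<in>J. norm (w j - v j))) \<longlongrightarrow> 0) (at v)" by simp
    then have "((\<lambda>w. F w - F v) \<longlongrightarrow> 0) (at v)"
      by (rule Lim_null_comparison[rotated]) (use F in simp)
    then show "(F \<longlongrightarrow> F v) (at v within UNIV)" by (rule LIM_zero_cancel)
  qed
  then have "F \<in> borel_measurable borel" by (rule borel_measurable_continuous_onI)
  \<comment> \<open>The index type is countable, so the Borel sets of the product topology are
    generated by the coordinates.\<close>
  moreover have "V \<in> borel_measurable M"
    using V by (rule measurable_coordinatewise_then_product)
  ultimately show ?thesis by measurable
qed

text \<open>\<open>\<Psi>\<close> is only known to be Lipschitz for the seminorm. On polygons this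
  makes it a continuous function of finitely many vectors, and measurability comes from
  there.\<close>

lemma borel_measurable_polygon_functional:
  fixes \<Psi> :: "(nat \<Rightarrow> real \<Rightarrow> 'a::euclidean_space) \<Rightarrow> real"
  assumes T: "0 < T" and C: "0 \<le> C" and \<Psi>: "path_lipschitz C T n \<Psi>"
    and \<xi>: "\<And>i. i < n \<Longrightarrow> \<xi> i \<in> borel_measurable M"
    and \<Delta>: "\<And>i j. i < n \<Longrightarrow> j < K \<Longrightarrow> \<Delta> i j \<in> borel_measurable M"
  shows "(\<lambda>\<omega>. \<Psi> (\<lambda>i. polygon T K (\<xi> i \<omega>) (\<lambda>j. \<Delta> i j \<omega>))) \<in> borel_measurable M"
proof -
  \<comment> \<open>Column 0 holds the initial values and column \<open>j + 1\<close> the increment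
    \<open>j\<close>. The value 0 elsewhere makes every coordinate measurable, although
    \<open>\<xi>\<close> and \<open>\<Delta>\<close> are measurable only in the relevant
    range.\<close>
  define V where "V \<omega> = (\<lambda>(i, j). if i < n \<and> j \<le> K then if j = 0 then \<xi> i \<omega> else \<Delta> i (j - 1) \<omega> else 0)" for \<omega>
  define F where "F v = \<Psi> (\<lambda>i. polygon T K (v (i, 0)) (\<lambda>j. v (i, Suc j)))" for v :: "nat \<times> nat \<Rightarrow> 'a"
  have "(\<lambda>\<omega>. F (V \<omega>)) \<in> borel_measurable M"
  proof (rule borel_measurable_lipschitz_coordinates[where F = F and V = V and C = C and J = "{..<n} \<times> {..<Suc K}"])
    fix p :: "nat \<times> nat"
    have "snd p - 1 < K" if "snd p \<le> K" "snd p \<noteq> 0" using that by linarith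
    then show "(\<lambda>\<omega>. V \<omega> p) \<in> borel_measurable M"
      unfolding V_def case_prod_beta using \<xi>[of "fst p"] \<Delta>[of "fst p" "snd p - 1"]
      by (cases "fst p < n \<and> snd p \<le> K"; cases "snd p = 0") auto
  next
    fix v w :: "nat \<times> nat \<Rightarrow> 'a"
    have "\<bar>F v - F w\<bar> \<le> C * path_norm T n (\<lambda>i t. polygon T K (v (i, 0)) (\<lambda>j. v (i, Suc j)) t
        - polygon T K (w (i, 0)) (\<lambda>j. w (i, Suc j)) t)"
      unfolding F_def by (rule path_lipschitzD[OF \<Psi> polygon_in_paths polygon_in_paths])
    also have "path_norm T n (\<lambda>i t. polygon T K (v (i, 0)) (\<lambda>j. v (i, Suc j)) t
          - polygon T K (w (i, 0)) (\<lambda>j. w (i, Suc j)) t)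
        \<le> L2_set (\<lambda>i. norm (v (i, 0) - w (i, 0)) + (\<Sum>j<K. norm (v (i, Suc j) - w (i, Suc j)))) {..<n}"
      using T by (intro path_norm_le_L2_set norm_polygon_diff_le paths_diff polygon_in_paths) auto
    also have "\<dots> \<le> (\<Sum>i<n. norm (v (i, 0) - w (i, 0)) + (\<Sum>j<K. norm (v (i, Suc j) - w (i, Suc j))))"
      by (intro L2_set_le_sum add_nonneg_nonneg sum_nonneg) auto
    also have "\<dots> = (\<Sum>i<n. \<Sum>j<Suc K. norm (v (i, j) - w (i, j)))"
      by (simp only: sum.lessThan_Suc_shift)
    also have "\<dots> = (\<Sum>p\<in>{..<n} \<times> {..<Suc K}. norm (v p - w p))"
      by (subst sum.cartesian_product) (simp add: split_def)
    finally show "\<bar>F v - F w\<bar> \<le> C * (\<Sum>p\<in>{..<n} \<times> {..<Suc K}. norm (v p - w p))"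
      using C by (auto intro: mult_left_mono)
  qed
  moreover have "F (V \<omega>) = \<Psi> (\<lambda>i. polygon T K (\<xi> i \<omega>) (\<lambda>j. \<Delta> i j \<omega>))" for \<omega>
    unfolding F_def
  proof (rule path_lipschitz_cong[OF less_imp_le[OF T] \<Psi> polygon_in_paths polygon_in_paths])
    fix i t assume "i < n"
    then show "polygon T K (V \<omega> (i, 0)) (\<lambda>j. V \<omega> (i, Suc j)) t = polygon T K (\<xi> i \<omega>) (\<lambda>j. \<Delta> i j \<omega>) t"
      unfolding polygon_def by (intro arg_cong2[where f = "(+)"] sum.cong) (auto simp: V_def)
  qed
  ultimately show ?thesis by simp
qed

text \<open>A pointwise limit of values at polygonal interpolations. It makes \<Phi>(X) a random
  variable although \<Phi> is assumed to be no more than Lipschitz.\<close>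

lemma borel_measurable_path_functional:
  fixes \<Psi> :: "(nat \<Rightarrow> real \<Rightarrow> 'a::euclidean_space) \<Rightarrow> real"
  assumes T: "0 < T" and C: "0 \<le> C" and \<Psi>: "path_lipschitz C T n \<Psi>"
    and c: "\<And>\<omega>. \<omega> \<in> space M \<Longrightarrow> (\<lambda>i t. Y i t \<omega>) \<in> paths T n"
    and m: "\<And>i t. i < n \<Longrightarrow> t \<in> {0..T} \<Longrightarrow> Y i t \<in> borel_measurable M"
  shows "(\<lambda>\<omega>. \<Psi> (\<lambda>i t. Y i t \<omega>)) \<in> borel_measurable M"
proof (rule borel_measurable_LIMSEQ_real)
  fix \<omega> assume "\<omega> \<in> space M"
  then show "(\<lambda>K. \<Psi> (\<lambda>i. polygon T K (Y i 0 \<omega>) (increments T K (\<lambda>t. Y i t \<omega>)))) \<longlonglongrightarrow> \<Psi> (\<lambda>i t. Y i t \<omega>)"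
    by (intro path_lipschitz_polygon_tendsto[OF T \<Psi> c])
next
  fix K
  show "(\<lambda>\<omega>. \<Psi> (\<lambda>i. polygon T K (Y i 0 \<omega>) (increments T K (\<lambda>t. Y i t \<omega>)))) \<in> borel_measurable M"
  proof (rule borel_measurable_polygon_functional[OF T C \<Psi>])
    fix i j assume i: "i < n" and j: "j < K"
    have "real (Suc j) * T / K \<in> {0..T}" "real j * T / K \<in> {0..T}"
      using T j by (auto simp: divide_le_eq mult.commute simp del: of_nat_Suc intro!: mult_right_mono)
    then show "(\<lambda>\<omega>. increments T K (\<lambda>t. Y i t \<omega>) j) \<in> borel_measurable M"
      unfolding increments_def using m[OF i] by measurable
  qed (use m T in auto)
qed

section \<open>Concentration from the Laplace transform\<close>

definition clip :: "real \<Rightarrow> real \<Rightarrow> real" where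
  "clip r x = max (- r) (min r x)"

lemma abs_clip_le: "0 \<le> r \<Longrightarrow> \<bar>clip r x\<bar> \<le> r"
  by (auto simp: clip_def)

lemma abs_clip_diff_le: "\<bar>clip r x - clip r y\<bar> \<le> \<bar>x - y\<bar>"
  by (auto simp: clip_def)

lemma clip_eq: "\<bar>x\<bar> \<le> r \<Longrightarrow> clip r x = x"
  by (auto simp: clip_def)

lemma borel_measurable_clip[measurable]: "clip r \<in> borel_measurable borel"
  unfolding clip_def by measurable

lemma isCont_clip: "isCont (clip r) x"
  unfolding clip_def by (intro continuous_intros)

lemma clip_of_nat_tendsto: "(\<lambda>k. clip (real k) x) \<longlonglongrightarrow> x"
proof (rule tendsto_eventually)
  obtain N :: nat where "\<bar>x\<bar> \<le> real N" using real_arch_simple by blast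
  then have "clip (real k) x = x" if "k \<ge> N" for k
    using that by (intro clip_eq) linarith
  then show "\<forall>\<^sub>F k in sequentially. clip (real k) x = x"
    using eventually_sequentially by blast
qed

text \<open>The clipped means are bounded because by the variance bound \<open>clip k Y\<close> stays close to its mean,
  while \<open>Y\<close> itself stays in a fixed ball with probability at least \<open>1 / 2\<close>. Fatou's lemma does
  the rest.\<close>

lemma (in prob_space) integrable_of_clip_variance:
  fixes Y :: "'a \<Rightarrow> real"
  assumes [measurable]: "Y \<in> borel_measurable M"
    and var: "\<And>k::nat. (\<integral>x. (clip k (Y x) - (\<integral>y. clip k (Y y) \<partial>M))\<^sup>2 \<partial>M) \<le> V"
  shows "integrable M Y"
proof -
  define m where "m k = (\<integral>y. clip (real k) (Y y) \<partial>M)" for k :: nat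
  have b: "\<bar>clip (real k) (Y x)\<bar> \<le> k" for k x by (rule abs_clip_le) simp
  have ic: "integrable M (\<lambda>x. clip (real k) (Y x))" for k
    using b by (intro integrable_bounded[of _ k]) auto
  have ic2: "integrable M (\<lambda>x. (clip (real k) (Y x) - c)\<^sup>2)" for k c
  proof (rule integrable_bounded)
    fix x
    have "\<bar>clip (real k) (Y x) - c\<bar> \<le> k + \<bar>c\<bar>" using b[of k x] by linarith
    then have "\<bar>clip (real k) (Y x) - c\<bar>\<^sup>2 \<le> (k + \<bar>c\<bar>)\<^sup>2" by (rule power_mono) simp
    then show "\<bar>(clip (real k) (Y x) - c)\<^sup>2\<bar> \<le> (k + \<bar>c\<bar>)\<^sup>2" by simp
  qed measurable
  have V: "0 \<le> V" using var[of 0] by (rule order_trans[rotated]) (intro integral_nonneg_AE, simp)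
  have "(\<lambda>N. prob {x \<in> space M. \<bar>Y x\<bar> \<le> real N}) \<longlonglongrightarrow> prob (\<Union>N. {x \<in> space M. \<bar>Y x\<bar> \<le> real N})"
    by (intro finite_Lim_measure_incseq) (auto simp: incseq_def)
  also have "(\<Union>N. {x \<in> space M. \<bar>Y x\<bar> \<le> real N}) = space M"
    using real_arch_simple by auto
  finally have "\<forall>\<^sub>F N in sequentially. 1 / 2 < prob {x \<in> space M. \<bar>Y x\<bar> \<le> real N}"
    by (rule order_tendstoD(1)) (simp add: prob_space)
  then obtain N where N: "1 / 2 < prob {x \<in> space M. \<bar>Y x\<bar> \<le> real N}"
    by (auto simp: eventually_sequentially)
  \<comment> \<open>If the absolute mean exceeded \<open>N\<close> by \<open>e\<close>, the clipped
    variable would differ from its mean by at least \<open>e\<close> on an event of probability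
    above 1 / 2, and therefore \<open>e\<^sup>2 / 2 \<le> V\<close>.\<close>
  have mb: "\<bar>m k\<bar> \<le> N + sqrt (2 * V)" if k: "k \<ge> N" for k
  proof (cases "\<bar>m k\<bar> \<le> N")
    case False
    define e where "e = \<bar>m k\<bar> - N"
    have e: "0 < e" using False by (simp add: e_def)
    have "e\<^sup>2 * (1 / 2) \<le> e\<^sup>2 * prob {x \<in> space M. \<bar>Y x\<bar> \<le> real N}"
      using N by (intro mult_left_mono) auto
    also have "\<dots> = (\<integral>x. e\<^sup>2 * indicator {x \<in> space M. \<bar>Y x\<bar> \<le> real N} x \<partial>M)"
      by simp
    also have "\<dots> \<le> (\<integral>x. (clip k (Y x) - m k)\<^sup>2 \<partial>M)"
    proof (rule integral_mono[OF _ ic2])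
      fix x
      show "e\<^sup>2 * indicator {x \<in> space M. \<bar>Y x\<bar> \<le> real N} x \<le> (clip k (Y x) - m k)\<^sup>2"
      proof (cases "\<bar>Y x\<bar> \<le> real N")
        case True
        then have "clip k (Y x) = Y x" using k by (intro clip_eq) linarith
        then have "e \<le> \<bar>clip k (Y x) - m k\<bar>" using True by (simp add: e_def)
        then have "e\<^sup>2 \<le> \<bar>clip k (Y x) - m k\<bar>\<^sup>2" using e by (intro power_mono) auto
        then show ?thesis by (simp add: indicator_def)
      qed simp
    qed (intro integrable_mult_right integrable_real_indicator, simp_all add: emeasure_eq_measure)
    also have "\<dots> \<le> V" using var[of k] by (simp add: m_def)
    finally have "e\<^sup>2 \<le> 2 * V" by simp
    then have "e \<le> sqrt (2 * V)" by (rule real_le_rsqrt)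
    then show ?thesis by (simp add: e_def)
  qed (use V in \<open>simp add: add_increasing2\<close>)
  \<comment> \<open>The bound on the means, plus \<open>1 + V\<close> from integrating
    \<open>\<bar>u\<bar> \<le> 1 + u\<^sup>2\<close> for the deviation \<open>u\<close> from the
    mean.\<close>
  define A where "A = N + sqrt (2 * V) + 1 + V"
  have A: "(\<integral>\<^sup>+ x. ennreal \<bar>clip (real k) (Y x)\<bar> \<partial>M) \<le> ennreal A" if k: "k \<ge> N" for k
  proof -
    have "(\<integral>x. \<bar>clip (real k) (Y x)\<bar> \<partial>M) \<le> (\<integral>x. (\<bar>m k\<bar> + 1) + (clip k (Y x) - m k)\<^sup>2 \<partial>M)"
    proof (rule integral_mono)
      fix x
      have "\<bar>clip k (Y x)\<bar> \<le> \<bar>m k\<bar> + \<bar>clip k (Y x) - m k\<bar>" by linarith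
      also have "\<bar>u\<bar> \<le> 1 + u\<^sup>2" for u :: real
        using zero_le_power2[of "\<bar>u\<bar> - 1 / 2"] by (simp add: power2_diff power_divide)
      finally show "\<bar>clip k (Y x)\<bar> \<le> \<bar>m k\<bar> + 1 + (clip k (Y x) - m k)\<^sup>2" by simp
    qed (use ic ic2 in auto)
    also have "\<dots> = \<bar>m k\<bar> + 1 + (\<integral>x. (clip k (Y x) - m k)\<^sup>2 \<partial>M)"
      using ic2[of k "m k"] prob_space by simp
    also have "\<dots> \<le> A" using mb[OF k] var[of k] by (simp add: A_def m_def)
    finally have "(\<integral>x. \<bar>clip (real k) (Y x)\<bar> \<partial>M) \<le> A" .
    then show ?thesis
      using ic by (subst nn_integral_eq_integral) (auto intro: ennreal_leI)
  qed
  have "(\<integral>\<^sup>+ x. ennreal \<bar>Y x\<bar> \<partial>M) = (\<integral>\<^sup>+ x. liminf (\<lambda>k. ennreal \<bar>clip (real k) (Y x)\<bar>) \<partial>M)"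
    by (intro nn_integral_cong lim_imp_Liminf[symmetric] tendsto_ennrealI tendsto_rabs clip_of_nat_tendsto) simp
  also have "\<dots> \<le> liminf (\<lambda>k. \<integral>\<^sup>+ x. ennreal \<bar>clip (real k) (Y x)\<bar> \<partial>M)"
    by (rule nn_integral_liminf) measurable
  also have "\<dots> \<le> ennreal A"
    using A by (intro Liminf_le) (auto simp: eventually_sequentially)
  finally show ?thesis
    by (intro integrableI_bounded) (auto simp: le_less_trans)
qed

text \<open>The exponential bounds at \<theta> = 1 and \<theta> = -1 control the variances of all
  truncations at once, which makes \<open>Y\<close> integrable. The truncated means then converge by
  dominated convergence, and Fatou's lemma transfers the exponential bound. As an integral in
  \<open>ennreal\<close>, that bound includes the integrability of the exponential.\<close>

lemma (in prob_space) subgaussian_of_clip: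
  fixes Y :: "'a \<Rightarrow> real"
  assumes [measurable]: "Y \<in> borel_measurable M"
    and exp_clip: "\<And>(k::nat) \<theta>. (\<integral>x. exp (\<theta> * clip k (Y x)) \<partial>M) \<le> exp (\<theta> * (\<integral>x. clip k (Y x) \<partial>M) + c * \<theta>\<^sup>2)"
  shows "integrable M Y"
    and "(\<integral>\<^sup>+ x. ennreal (exp (\<theta> * (Y x - (\<integral>x. Y x \<partial>M)))) \<partial>M) \<le> ennreal (exp (c * \<theta>\<^sup>2))"
proof -
  define m where "m k = (\<integral>y. clip (real k) (Y y) \<partial>M)" for k :: nat
  have b: "\<bar>clip (real k) (Y x)\<bar> \<le> k" for k x by (rule abs_clip_le) simp
  have ie: "integrable M (\<lambda>x. exp (\<theta> * clip (real k) (Y x)))" for k \<theta>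
  proof (rule integrable_bounded)
    fix x
    have "\<theta> * clip (real k) (Y x) \<le> \<bar>\<theta>\<bar> * \<bar>clip (real k) (Y x)\<bar>" by (metis abs_ge_self abs_mult)
    also have "\<dots> \<le> \<bar>\<theta>\<bar> * k" using b by (intro mult_left_mono) auto
    finally show "\<bar>exp (\<theta> * clip (real k) (Y x))\<bar> \<le> exp (\<bar>\<theta>\<bar> * k)" by simp
  qed measurable
  have ie': "integrable M (\<lambda>x. exp (\<theta> * (clip (real k) (Y x) - m k)))" for k \<theta>
    using integrable_mult_left[OF ie[of \<theta> k], of "exp (- (\<theta> * m k))"]
    by (simp add: exp_add[symmetric] algebra_simps)
  have e: "(\<integral>x. exp (\<theta> * (clip (real k) (Y x) - m k)) \<partial>M) \<le> exp (c * \<theta>\<^sup>2)" for k \<theta>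
  proof -
    have "(\<integral>x. exp (\<theta> * (clip (real k) (Y x) - m k)) \<partial>M) = (\<integral>x. exp (- (\<theta> * m k)) * exp (\<theta> * clip (real k) (Y x)) \<partial>M)"
      by (simp add: exp_add[symmetric] algebra_simps)
    also have "\<dots> = exp (- (\<theta> * m k)) * (\<integral>x. exp (\<theta> * clip (real k) (Y x)) \<partial>M)"
      by simp
    also have "\<dots> \<le> exp (- (\<theta> * m k)) * exp (\<theta> * m k + c * \<theta>\<^sup>2)"
      unfolding m_def by (intro mult_left_mono exp_clip) simp
    also have "\<dots> = exp (c * \<theta>\<^sup>2)" by (simp add: exp_add[symmetric])
    finally show ?thesis .
  qed
  show iY: "integrable M Y"
  proof (rule integrable_of_clip_variance)
    fix k :: nat
    have "(\<integral>x. (clip k (Y x) - m k)\<^sup>2 \<partial>M)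
        \<le> (\<integral>x. 4 * (exp (1 * (clip (real k) (Y x) - m k)) + exp (- 1 * (clip (real k) (Y x) - m k))) \<partial>M)"
    proof (rule integral_mono)
      show "integrable M (\<lambda>x. (clip k (Y x) - m k)\<^sup>2)"
      proof (rule integrable_bounded)
        fix x
        have "\<bar>clip (real k) (Y x) - m k\<bar> \<le> k + \<bar>m k\<bar>" using b[of k x] by linarith
        then have "\<bar>clip (real k) (Y x) - m k\<bar>\<^sup>2 \<le> (k + \<bar>m k\<bar>)\<^sup>2" by (rule power_mono) simp
        then show "\<bar>(clip (real k) (Y x) - m k)\<^sup>2\<bar> \<le> (k + \<bar>m k\<bar>)\<^sup>2" by simp
      qed measurable
      fix x
      define u where "u = clip (real k) (Y x) - m k"
      have "u\<^sup>2 \<le> 4 * (exp u + exp (- u))"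
      proof -
        have "\<bar>u\<bar> / 2 \<le> exp (\<bar>u\<bar> / 2)" using exp_ge_add_one_self[of "\<bar>u\<bar> / 2"] by linarith
        then have "(\<bar>u\<bar> / 2)\<^sup>2 \<le> (exp (\<bar>u\<bar> / 2))\<^sup>2" by (rule power_mono) simp
        also have "\<dots> = exp \<bar>u\<bar>" by (simp add: exp_double[symmetric])
        also have "\<dots> \<le> exp u + exp (- u)" by (cases "0 \<le> u") auto
        finally show ?thesis by (simp add: power_divide)
      qed
      then show "(clip k (Y x) - m k)\<^sup>2 \<le> 4 * (exp (1 * (clip (real k) (Y x) - m k)) + exp (- 1 * (clip (real k) (Y x) - m k)))"
        by (simp add: u_def)
    qed (use ie'[of 1 k] ie'[of "- 1" k] in simp)
    also have "\<dots> \<le> 4 * (exp (c * 1\<^sup>2) + exp (c * (- 1)\<^sup>2))"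
      using ie'[of 1 k] ie'[of "- 1" k] e[of 1 k] e[of "- 1" k] by simp
    finally show "(\<integral>x. (clip k (Y x) - (\<integral>y. clip k (Y y) \<partial>M))\<^sup>2 \<partial>M) \<le> 8 * exp c"
      by (simp add: m_def)
  qed simp
  have m: "m \<longlonglongrightarrow> (\<integral>x. Y x \<partial>M)"
    unfolding m_def
  proof (rule integral_dominated_convergence[where w = "\<lambda>x. \<bar>Y x\<bar>"])
    show "AE x in M. norm (clip (real k) (Y x)) \<le> \<bar>Y x\<bar>" for k
      using abs_clip_diff_le[of "real k" _ 0] by (auto simp: clip_def)
  qed (use iY clip_of_nat_tendsto in auto)
  have "(\<integral>\<^sup>+ x. ennreal (exp (\<theta> * (Y x - (\<integral>x. Y x \<partial>M)))) \<partial>M)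
      = (\<integral>\<^sup>+ x. liminf (\<lambda>k. ennreal (exp (\<theta> * (clip (real k) (Y x) - m k)))) \<partial>M)"
    by (intro nn_integral_cong lim_imp_Liminf[symmetric] tendsto_intros clip_of_nat_tendsto m) simp
  also have "\<dots> \<le> liminf (\<lambda>k. \<integral>\<^sup>+ x. ennreal (exp (\<theta> * (clip (real k) (Y x) - m k))) \<partial>M)"
    by (rule nn_integral_liminf) measurable
  also have "\<dots> \<le> ennreal (exp (c * \<theta>\<^sup>2))"
  proof (rule Liminf_le)
    have "(\<integral>\<^sup>+ x. ennreal (exp (\<theta> * (clip (real k) (Y x) - m k))) \<partial>M) \<le> ennreal (exp (c * \<theta>\<^sup>2))" for k
      using ie'[of \<theta> k] e[of \<theta> k] by (subst nn_integral_eq_integral) (auto intro: ennreal_leI)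
    then show "\<forall>\<^sub>F k in sequentially. (\<integral>\<^sup>+ x. ennreal (exp (\<theta> * (clip (real k) (Y x) - m k))) \<partial>M) \<le> ennreal (exp (c * \<theta>\<^sup>2))"
      by simp
  qed simp
  finally show "(\<integral>\<^sup>+ x. ennreal (exp (\<theta> * (Y x - (\<integral>x. Y x \<partial>M)))) \<partial>M) \<le> ennreal (exp (c * \<theta>\<^sup>2))" .
qed

lemma (in prob_space) prob_gt_le_of_subgaussian:
  fixes Y :: "'a \<Rightarrow> real"
  assumes [measurable]: "Y \<in> borel_measurable M" and c: "0 < c" and a: "0 < a"
    and e: "\<And>\<theta>. (\<integral>\<^sup>+ x. ennreal (exp (\<theta> * (Y x - m))) \<partial>M) \<le> ennreal (exp (c * \<theta>\<^sup>2))"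
  shows "prob {x \<in> space M. Y x - m > a} \<le> exp (- (1 / (4 * c)) * a\<^sup>2)"
proof -
  \<comment> \<open>Chernoff's bound at the minimiser of
    \<open>- \<theta> * a + c * \<theta>\<^sup>2\<close>, where the value is
    \<open>- a\<^sup>2 / (4 * c)\<close>.\<close>
  define \<theta> where "\<theta> = a / (2 * c)"
  have \<theta>: "0 < \<theta>" using a c by (simp add: \<theta>_def)
  have "emeasure M {x \<in> space M. Y x - m > a} = (\<integral>\<^sup>+ x. indicator {x \<in> space M. Y x - m > a} x \<partial>M)"
    by simp
  also have "\<dots> \<le> (\<integral>\<^sup>+ x. ennreal (exp (- \<theta> * a)) * ennreal (exp (\<theta> * (Y x - m))) \<partial>M)"
  proof (rule nn_integral_mono)
    fix x
    have "1 \<le> ennreal (exp (- \<theta> * a) * exp (\<theta> * (Y x - m)))" if "Y x - m > a"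
    proof -
      have "0 \<le> \<theta> * (Y x - m - a)" using \<theta> that by simp
      then have "1 \<le> exp (- \<theta> * a) * exp (\<theta> * (Y x - m))"
        by (simp add: exp_add[symmetric] algebra_simps)
      then show ?thesis by (simp del: mult_minus_left)
    qed
    then show "indicator {x \<in> space M. Y x - m > a} x \<le> ennreal (exp (- \<theta> * a)) * ennreal (exp (\<theta> * (Y x - m)))"
      by (auto simp: indicator_def ennreal_mult[symmetric])
  qed
  also have "\<dots> = ennreal (exp (- \<theta> * a)) * (\<integral>\<^sup>+ x. ennreal (exp (\<theta> * (Y x - m))) \<partial>M)"
    by (rule nn_integral_cmult) measurable
  also have "\<dots> \<le> ennreal (exp (- \<theta> * a)) * ennreal (exp (c * \<theta>\<^sup>2))"
    by (intro mult_left_mono e) simp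
  also have "\<dots> = ennreal (exp (- \<theta> * a + c * \<theta>\<^sup>2))"
    by (simp add: ennreal_mult[symmetric] mult_exp_exp)
  also have "- \<theta> * a + c * \<theta>\<^sup>2 = - (1 / (4 * c)) * a\<^sup>2"
    using c by (simp add: \<theta>_def power2_eq_square field_simps)
  finally show ?thesis by (simp add: emeasure_eq_measure)
qed

section \<open>Concentration for the driving paths\<close>

lemma grid_point_in_interval:
  assumes "0 < T" "j \<le> K" "0 < K"
  shows "real j * T / real K \<in> {0..T}"
proof -
  have "real j * T \<le> real K * T" using assms by (intro mult_right_mono) auto
  then show ?thesis using assms by (auto simp: divide_le_eq mult.commute)
qed

lemma measurable_restrict_increments:
  assumes "0 < T" "0 < K" and x: "\<And>t. t \<in> {0..T} \<Longrightarrow> (\<lambda>\<omega>. x \<omega> t) \<in> borel_measurable N"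
  shows "(\<lambda>\<omega>. \<lambda>j\<in>{..<K}. increments T K (x \<omega>) j) \<in> measurable N (Pi\<^sub>M {..<K} (\<lambda>_. borel :: 'a::euclidean_space measure))"
proof (rule measurable_restrict)
  fix j assume "j \<in> {..<K}"
  then have "real (Suc j) * T / real K \<in> {0..T}" "real j * T / real K \<in> {0..T}"
    using assms(1,2) by (simp_all add: grid_point_in_interval del: of_nat_Suc atLeastAtMost_iff)
  then show "(\<lambda>\<omega>. increments T K (x \<omega>) j) \<in> borel_measurable N"
    unfolding increments_def by (intro borel_measurable_diff x)
qed

text \<open>Independence of the noise is stated for paths restricted to \<open>{0..T}\<close>. All
  grid points lie there, so the increments do not notice the restriction.\<close>

lemma restrict_increments_restrict:
  assumes "0 < T" "0 < K"
  shows "(\<lambda>j\<in>{..<K}. increments T K (\<lambda>t\<in>{0..T}. x t) j) = (\<lambda>j\<in>{..<K}. increments T K x j)"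
proof (rule restrict_ext)
  fix j assume "j \<in> {..<K}"
  then have "real (Suc j) * T / real K \<in> {0..T}" "real j * T / real K \<in> {0..T}"
    using assms(1,2) by (simp_all add: grid_point_in_interval del: of_nat_Suc atLeastAtMost_iff)
  then show "increments T K (\<lambda>t\<in>{0..T}. x t) j = increments T K x j"
    unfolding increments_def by (simp only: restrict_apply if_True)
qed

text \<open>Each coordinate of an increment has variance \<open>T / K\<close>, so the Gaussian
  constant 1 / (4 s^2) becomes \<open>K / (4 * T)\<close>; independence of the increments makes
  their joint law a product.\<close>

lemma dual_transport_wiener_increments:
  fixes W :: "real \<Rightarrow> 'w \<Rightarrow> real ^ 'd"
  assumes "prob_space M" and W: "std_wiener M T W" and T: "0 < T" and K: "0 < K"
  shows "dual_transport
    (distr M (Pi\<^sub>M {..<K} (\<lambda>_. borel)) (\<lambda>\<omega>. \<lambda>j\<in>{..<K}. increments T K (\<lambda>t. W t \<omega>) j))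
    (\<lambda>x y. \<Sum>j<K. real K / (4 * T) * (norm (x j - y j))\<^sup>2)"
proof -
  interpret prob_space M by fact
  define \<tau> where "\<tau> j = real j * T / real K" for j
  have \<tau>: "\<tau> j \<in> {0..T}" if "j \<le> K" for j
    using grid_point_in_interval[OF T that K] by (simp add: \<tau>_def)
  have \<tau>d: "\<tau> (Suc j) - \<tau> j = T / K" for j using K by (simp add: \<tau>_def field_simps)
  have \<tau>l: "\<tau> j < \<tau> (Suc j)" for j using \<tau>d[of j] T K by (smt (verit) divide_pos_pos of_nat_0_less_iff)
  have inc: "(\<lambda>\<omega>. increments T K (\<lambda>t. W t \<omega>) j) = (\<lambda>\<omega>. W (\<tau> (Suc j)) \<omega> - W (\<tau> j) \<omega>)" for j
    by (simp add: increments_def \<tau>_def)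
  have ind: "indep_vars (\<lambda>_. borel) (\<lambda>j \<omega>. increments T K (\<lambda>t. W t \<omega>) j) {..<K}"
    using W \<tau> \<tau>l unfolding std_wiener_def inc by blast
  have mW: "W t \<in> borel_measurable M" if "t \<in> {0..T}" for t
    using W that by (simp add: std_wiener_def)
  have rv: "random_variable borel (\<lambda>\<omega>. increments T K (\<lambda>t. W t \<omega>) j)" if "j \<in> {..<K}" for j
    unfolding inc using that by (intro borel_measurable_diff mW \<tau>) auto
  have "dual_transport (distr M borel (\<lambda>\<omega>. increments T K (\<lambda>t. W t \<omega>) j))
      (\<lambda>x y. real K / (4 * T) * (norm (x - y))\<^sup>2)" if j: "j \<in> {..<K}" for j
  proof -
    have "distributed M lborel (\<lambda>\<omega>. W (\<tau> (Suc j)) \<omega> - W (\<tau> j) \<omega>)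
        (\<lambda>x. ennreal (\<Prod>k\<in>UNIV. normal_density 0 (sqrt (\<tau> (Suc j) - \<tau> j)) (x $ k)))"
      using W \<tau>[of j] \<tau>[of "Suc j"] \<tau>l[of j] j by (auto simp: std_wiener_def)
    then have "distr M lborel (\<lambda>\<omega>. W (\<tau> (Suc j)) \<omega> - W (\<tau> j) \<omega>)
        = density lborel (\<lambda>x. ennreal (\<Prod>k\<in>UNIV. normal_density 0 (sqrt (T / K)) (x $ k)))"
      unfolding \<tau>d by (rule distributed_distr_eq_density)
    moreover have "distr M lborel (\<lambda>\<omega>. W (\<tau> (Suc j)) \<omega> - W (\<tau> j) \<omega>) = distr M borel (\<lambda>\<omega>. W (\<tau> (Suc j)) \<omega> - W (\<tau> j) \<omega>)"
      by (rule distr_cong) auto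
    moreover have "1 / (4 * (sqrt (T / K))\<^sup>2) = K / (4 * T)"
      using T K by simp
    ultimately show ?thesis
      unfolding inc using dual_transport_normal_vec[of "sqrt (T / K)", where 'd = 'd] T K by simp
  qed
  then have "dual_transport (Pi\<^sub>M {..<K} (\<lambda>j. distr M borel (\<lambda>\<omega>. increments T K (\<lambda>t. W t \<omega>) j)))
      (\<lambda>x y. \<Sum>j<K. real K / (4 * T) * (norm (x j - y j))\<^sup>2)"
    by (intro dual_transport_PiM) auto
  moreover have "distr M (Pi\<^sub>M {..<K} (\<lambda>_. borel)) (\<lambda>\<omega>. \<lambda>j\<in>{..<K}. increments T K (\<lambda>t. W t \<omega>) j)
      = Pi\<^sub>M {..<K} (\<lambda>j. distr M borel (\<lambda>\<omega>. increments T K (\<lambda>t. W t \<omega>) j))"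
    using K rv ind by (subst indep_vars_iff_distr_eq_PiM'[symmetric]) auto
  ultimately show ?thesis by simp
qed

text \<open>Independence is given for the \<sigma>-algebra of the whole noise, whereas only the
  increments enter the estimate: preimages under \<open>g \<circ> Y\<close> belong to the
  \<sigma>-algebra generated by \<open>Y\<close>.\<close>

lemma (in prob_space) distr_pair_of_indep_set:
  assumes X: "X \<in> measurable M S" and Y: "Y \<in> measurable M N"
    and ind: "indep_set (sets (vimage_algebra (space M) X S)) (sets (vimage_algebra (space M) Y N))"
    and g: "g \<in> measurable N U"
  shows "distr M S X \<Otimes>\<^sub>M distr M U (\<lambda>\<omega>. g (Y \<omega>)) = distr M (S \<Otimes>\<^sub>M U) (\<lambda>\<omega>. (X \<omega>, g (Y \<omega>)))"
proof (rule pair_measure_eqI)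
  note [measurable] = X Y g
  interpret A: prob_space "distr M S X" by (rule prob_space_distr) measurable
  interpret B: prob_space "distr M U (\<lambda>\<omega>. g (Y \<omega>))" by (rule prob_space_distr) measurable
  show "sigma_finite_measure (distr M S X)" "sigma_finite_measure (distr M U (\<lambda>\<omega>. g (Y \<omega>)))"
    by unfold_locales
  fix a b assume "a \<in> sets (distr M S X)" "b \<in> sets (distr M U (\<lambda>\<omega>. g (Y \<omega>)))"
  then have [measurable]: "a \<in> sets S" "b \<in> sets U" by auto
  have "(\<lambda>\<omega>. g (Y \<omega>)) -` b \<inter> space M = Y -` (g -` b \<inter> space N) \<inter> space M"
    using measurable_space[OF Y] by auto
  also have "\<dots> \<in> sets (vimage_algebra (space M) Y N)"
    by (rule in_vimage_algebra) measurable
  finally have "prob ((X -` a \<inter> space M) \<inter> ((\<lambda>\<omega>. g (Y \<omega>)) -` b \<inter> space M))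
      = prob (X -` a \<inter> space M) * prob ((\<lambda>\<omega>. g (Y \<omega>)) -` b \<inter> space M)"
    by (intro indep_setD[OF ind] in_vimage_algebra) auto
  moreover have "(\<lambda>\<omega>. (X \<omega>, g (Y \<omega>))) -` (a \<times> b) \<inter> space M
      = (X -` a \<inter> space M) \<inter> ((\<lambda>\<omega>. g (Y \<omega>)) -` b \<inter> space M)" by auto
  ultimately show "emeasure (distr M S X) a * emeasure (distr M U (\<lambda>\<omega>. g (Y \<omega>))) b
      = emeasure (distr M (S \<Otimes>\<^sub>M U) (\<lambda>\<omega>. (X \<omega>, g (Y \<omega>)))) (a \<times> b)"
    by (simp add: emeasure_distr emeasure_eq_measure ennreal_mult)
qed simp

text \<open>Independence between particles and independence of initial states and noise each turn a
  joint law into a product, as independence in time did for a single process. The inequality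
  tensorises at every level, and the costs add up.\<close>

lemma dual_transport_initial_and_increments:
  fixes B :: "nat \<Rightarrow> real \<Rightarrow> 'w \<Rightarrow> real ^ 'd" and \<xi> :: "nat \<Rightarrow> 'w \<Rightarrow> real ^ 'd"
  assumes M: "prob_space M" and T: "0 < T" and K: "0 < K" and n: "0 < n"
    and W: "\<And>i. i < n \<Longrightarrow> std_wiener M T (B i)"
    and iB: "prob_space.indep_vars M (\<lambda>_. Pi\<^sub>M {0..T} (\<lambda>_. borel)) (\<lambda>i \<omega>. \<lambda>t\<in>{0..T}. B i t \<omega>) {..<n}"
    and \<xi>: "\<And>i. i < n \<Longrightarrow> \<xi> i \<in> borel_measurable M" "\<And>i. i < n \<Longrightarrow> distr M borel (\<xi> i) = \<mu>"
    and i\<xi>: "prob_space.indep_vars M (\<lambda>_. borel) \<xi> {..<n}"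
    and ind: "prob_space.indep_set M
       (sets (vimage_algebra (space M) (\<lambda>\<omega>. \<lambda>i\<in>{..<n}. \<xi> i \<omega>) (Pi\<^sub>M {..<n} (\<lambda>_. borel))))
       (sets (vimage_algebra (space M) (\<lambda>\<omega>. \<lambda>i\<in>{..<n}. \<lambda>t\<in>{0..T}. B i t \<omega>)
          (Pi\<^sub>M {..<n} (\<lambda>_. Pi\<^sub>M {0..T} (\<lambda>_. borel)))))"
    and \<mu>: "dual_transport \<mu> c"
  shows "dual_transport
    (distr M (Pi\<^sub>M {..<n} (\<lambda>_. borel) \<Otimes>\<^sub>M Pi\<^sub>M {..<n} (\<lambda>_. Pi\<^sub>M {..<K} (\<lambda>_. borel)))
      (\<lambda>\<omega>. (\<lambda>i\<in>{..<n}. \<xi> i \<omega>, \<lambda>i\<in>{..<n}. \<lambda>j\<in>{..<K}. increments T K (\<lambda>t. B i t \<omega>) j)))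
    (\<lambda>x y. (\<Sum>i<n. c (fst x i) (fst y i)) + (\<Sum>i<n. \<Sum>j<K. real K / (4 * T) * (norm (snd x i j - snd y i j))\<^sup>2))"
proof -
  interpret prob_space M by fact
  have mB: "B i t \<in> borel_measurable M" if "i < n" "t \<in> {0..T}" for i t
    using W[OF that(1)] that(2) by (simp add: std_wiener_def)
  let ?D = "\<lambda>i \<omega>. \<lambda>j\<in>{..<K}. increments T K (\<lambda>t. B i t \<omega>) j"
  have mD: "random_variable (Pi\<^sub>M {..<K} (\<lambda>_. borel)) (?D i)" if "i < n" for i
    using that by (intro measurable_restrict_increments T K mB)
  have "indep_vars (\<lambda>_. Pi\<^sub>M {..<K} (\<lambda>_. borel))
      (\<lambda>i \<omega>. \<lambda>j\<in>{..<K}. increments T K (\<lambda>t\<in>{0..T}. B i t \<omega>) j) {..<n}"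
  proof (rule indep_vars_compose2[OF iB])
    show "(\<lambda>x. \<lambda>j\<in>{..<K}. increments T K x j) \<in> measurable (Pi\<^sub>M {0..T} (\<lambda>_. borel)) (Pi\<^sub>M {..<K} (\<lambda>_. borel :: (real ^ 'd) measure))"
      by (intro measurable_restrict_increments T K) measurable
  qed
  then have "indep_vars (\<lambda>_. Pi\<^sub>M {..<K} (\<lambda>_. borel)) ?D {..<n}"
    unfolding restrict_increments_restrict[OF T K] .
  then have D: "distr M (Pi\<^sub>M {..<n} (\<lambda>_. Pi\<^sub>M {..<K} (\<lambda>_. borel))) (\<lambda>\<omega>. \<lambda>i\<in>{..<n}. ?D i \<omega>)
      = Pi\<^sub>M {..<n} (\<lambda>i. distr M (Pi\<^sub>M {..<K} (\<lambda>_. borel)) (?D i))"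
    using n mD by (subst indep_vars_iff_distr_eq_PiM'[symmetric]) auto
  have X: "distr M (Pi\<^sub>M {..<n} (\<lambda>_. borel)) (\<lambda>\<omega>. \<lambda>i\<in>{..<n}. \<xi> i \<omega>) = Pi\<^sub>M {..<n} (\<lambda>i. distr M borel (\<xi> i))"
    using n \<xi>(1) i\<xi> by (subst indep_vars_iff_distr_eq_PiM'[symmetric]) auto
  have dX: "dual_transport (distr M (Pi\<^sub>M {..<n} (\<lambda>_. borel)) (\<lambda>\<omega>. \<lambda>i\<in>{..<n}. \<xi> i \<omega>)) (\<lambda>x y. \<Sum>i<n. c (x i) (y i))"
    unfolding X using \<mu> \<xi>(2) by (intro dual_transport_PiM) auto
  have dD: "dual_transport (distr M (Pi\<^sub>M {..<n} (\<lambda>_. Pi\<^sub>M {..<K} (\<lambda>_. borel))) (\<lambda>\<omega>. \<lambda>i\<in>{..<n}. ?D i \<omega>))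
      (\<lambda>x y. \<Sum>i<n. \<Sum>j<K. real K / (4 * T) * (norm (x i j - y i j))\<^sup>2)"
    unfolding D by (intro dual_transport_PiM dual_transport_wiener_increments M W T K) auto
  have coord: "(\<lambda>w. w i t) \<in> borel_measurable (Pi\<^sub>M {..<n} (\<lambda>_. Pi\<^sub>M {0..T} (\<lambda>_. borel :: (real ^ 'd) measure)))"
    if "i \<in> {..<n}" "t \<in> {0..T}" for i t
    by (rule measurable_compose[where f = "\<lambda>w. w i" and g = "\<lambda>x. x t" and N = "Pi\<^sub>M {0..T} (\<lambda>_. borel)"])
      (intro measurable_component_singleton that)+
  have "distr M (Pi\<^sub>M {..<n} (\<lambda>_. borel)) (\<lambda>\<omega>. \<lambda>i\<in>{..<n}. \<xi> i \<omega>) \<Otimes>\<^sub>M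
      distr M (Pi\<^sub>M {..<n} (\<lambda>_. Pi\<^sub>M {..<K} (\<lambda>_. borel)))
        (\<lambda>\<omega>. (\<lambda>w. \<lambda>i\<in>{..<n}. \<lambda>j\<in>{..<K}. increments T K (w i) j) (\<lambda>i\<in>{..<n}. \<lambda>t\<in>{0..T}. B i t \<omega>))
    = distr M (Pi\<^sub>M {..<n} (\<lambda>_. borel) \<Otimes>\<^sub>M Pi\<^sub>M {..<n} (\<lambda>_. Pi\<^sub>M {..<K} (\<lambda>_. borel)))
        (\<lambda>\<omega>. (\<lambda>i\<in>{..<n}. \<xi> i \<omega>,
          (\<lambda>w. \<lambda>i\<in>{..<n}. \<lambda>j\<in>{..<K}. increments T K (w i) j) (\<lambda>i\<in>{..<n}. \<lambda>t\<in>{0..T}. B i t \<omega>)))"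
  proof (rule distr_pair_of_indep_set[OF _ _ ind])
    show "(\<lambda>w. \<lambda>i\<in>{..<n}. \<lambda>j\<in>{..<K}. increments T K (w i) j)
      \<in> measurable (Pi\<^sub>M {..<n} (\<lambda>_. Pi\<^sub>M {0..T} (\<lambda>_. borel))) (Pi\<^sub>M {..<n} (\<lambda>_. Pi\<^sub>M {..<K} (\<lambda>_. borel :: (real ^ 'd) measure)))"
      by (rule measurable_restrict) (intro measurable_restrict_increments T K coord)
  qed (use \<xi>(1) mB in \<open>auto intro!: measurable_restrict\<close>)
  moreover have "(\<lambda>i\<in>{..<n}. \<lambda>j\<in>{..<K}. increments T K ((\<lambda>i\<in>{..<n}. \<lambda>t\<in>{0..T}. B i t \<omega>) i) j)
      = (\<lambda>i\<in>{..<n}. ?D i \<omega>)" for \<omega>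
  proof (rule restrict_ext)
    fix i assume "i \<in> {..<n}"
    then show "(\<lambda>j\<in>{..<K}. increments T K ((\<lambda>i\<in>{..<n}. \<lambda>t\<in>{0..T}. B i t \<omega>) i) j) = ?D i \<omega>"
      using restrict_increments_restrict[OF T K, of "\<lambda>t. B i t \<omega>"] by simp
  qed
  ultimately show ?thesis
    using dual_transport_pair[OF dX dD] by simp
qed

lemma norm_matrix_vector_le: "norm (A *v x) \<le> onorm ((*v) A) * norm x"
  for A :: "real ^ 'n ^ 'm"
  by (rule onorm) (rule matrix_vector_mul_bounded_linear)

text \<open>Cauchy-Schwarz turns the sum over the grid, which bounds the sup norm, into \<open>sqrt K\<close> times the
  \<open>\<ell>\<^sup>2\<close> norm; this compensates the factor \<open>K\<close> in the transport cost of the increments.\<close>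

lemma path_norm_polygon_sq_le:
  fixes \<sigma> :: "real ^ 'd ^ 'd" and x y :: "nat \<Rightarrow> real ^ 'd" and u v :: "nat \<Rightarrow> nat \<Rightarrow> real ^ 'd"
  assumes T: "0 < T" and K: "0 < K" and \<kappa>: "0 < \<kappa>"
  shows "(path_norm T n (\<lambda>i t. polygon T K (x i) (\<lambda>j. \<sigma> *v u i j) t - polygon T K (y i) (\<lambda>j. \<sigma> *v v i j) t))\<^sup>2
    \<le> (4 * \<kappa> + 8 * (onorm ((*v) \<sigma>))\<^sup>2 * T) *
      ((\<Sum>i<n. (norm (x i - y i))\<^sup>2 / (2 * \<kappa>)) + (\<Sum>i<n. \<Sum>j<K. real K / (4 * T) * (norm (u i j - v i j))\<^sup>2))"
proof -
  define s where "s = onorm ((*v) \<sigma>)"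
  have s: "0 \<le> s" unfolding s_def by (rule onorm_pos_le) (rule matrix_vector_mul_bounded_linear)
  \<comment> \<open>With \<open>(p + q)\<^sup>2 \<le> 2 * p\<^sup>2 + 2 * q\<^sup>2\<close>, the
    initial part is \<open>4 * \<kappa>\<close> times its cost
    \<open>p\<^sup>2 / (2 * \<kappa>)\<close>. For the noise, \<open>2 * s\<^sup>2 * K\<close> from
    Cauchy-Schwarz times \<open>4 * T / K\<close> from the cost is \<open>8 * s\<^sup>2 * T\<close>,
    without \<open>K\<close>.\<close>
  define Q where "Q = 4 * \<kappa> + 8 * s\<^sup>2 * T"
  have Q: "4 * \<kappa> \<le> Q" "8 * s\<^sup>2 * T \<le> Q" using \<kappa> T by (auto simp: Q_def)
  let ?p = "\<lambda>i. norm (x i - y i)" and ?q = "\<lambda>i. \<Sum>j<K. norm (\<sigma> *v u i j - \<sigma> *v v i j)"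
  have "path_norm T n (\<lambda>i t. polygon T K (x i) (\<lambda>j. \<sigma> *v u i j) t - polygon T K (y i) (\<lambda>j. \<sigma> *v v i j) t)
      \<le> L2_set (\<lambda>i. ?p i + ?q i) {..<n}"
    using T by (intro path_norm_le_L2_set norm_polygon_diff_le paths_diff polygon_in_paths) auto
  then have "(path_norm T n (\<lambda>i t. polygon T K (x i) (\<lambda>j. \<sigma> *v u i j) t - polygon T K (y i) (\<lambda>j. \<sigma> *v v i j) t))\<^sup>2
      \<le> (L2_set (\<lambda>i. ?p i + ?q i) {..<n})\<^sup>2"
    by (rule power_mono) (rule path_norm_nonneg)
  also have "\<dots> = (\<Sum>i<n. (?p i + ?q i)\<^sup>2)" by (simp add: L2_set_def sum_nonneg)
  also have "\<dots> \<le> (\<Sum>i<n. Q * ((?p i)\<^sup>2 / (2 * \<kappa>)) + Q * (\<Sum>j<K. real K / (4 * T) * (norm (u i j - v i j))\<^sup>2))"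
  proof (rule sum_mono)
    fix i
    have "?q i \<le> (\<Sum>j<K. s * norm (u i j - v i j))"
      using norm_matrix_vector_le[of \<sigma>]
      by (intro sum_mono) (simp add: s_def matrix_vector_mult_diff_distrib[symmetric])
    then have "(?q i)\<^sup>2 \<le> (\<Sum>j<K. s * norm (u i j - v i j))\<^sup>2"
      by (intro power_mono sum_nonneg) auto
    also have "\<dots> = s\<^sup>2 * (\<Sum>j<K. norm (u i j - v i j))\<^sup>2"
      by (simp add: sum_distrib_left[symmetric] power_mult_distrib)
    also have "\<dots> \<le> s\<^sup>2 * ((\<Sum>j<K. (norm (u i j - v i j))\<^sup>2) * real K)"
    proof -
      have "(\<Sum>j<K. norm (u i j - v i j) * 1)\<^sup>2 \<le> (\<Sum>j<K. (norm (u i j - v i j))\<^sup>2) * (\<Sum>j<K. 1\<^sup>2)"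
        by (rule Cauchy_Schwarz_ineq_sum)
      then show ?thesis by (intro mult_left_mono) auto
    qed
    finally have q: "(?q i)\<^sup>2 \<le> s\<^sup>2 * ((\<Sum>j<K. (norm (u i j - v i j))\<^sup>2) * real K)" .
    have "(?p i + ?q i)\<^sup>2 \<le> 2 * (?p i)\<^sup>2 + 2 * (?q i)\<^sup>2"
      using zero_le_power2[of "?p i - ?q i"] by (simp add: power2_sum power2_diff)
    also have "2 * (?p i)\<^sup>2 = 4 * \<kappa> * ((?p i)\<^sup>2 / (2 * \<kappa>))" using \<kappa> by simp
    also have "\<dots> \<le> Q * ((?p i)\<^sup>2 / (2 * \<kappa>))" using Q(1) \<kappa> by (intro mult_right_mono) auto
    also have "2 * (?q i)\<^sup>2 \<le> 2 * (s\<^sup>2 * ((\<Sum>j<K. (norm (u i j - v i j))\<^sup>2) * real K))" using q by simp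
    also have "\<dots> = 8 * s\<^sup>2 * T * (\<Sum>j<K. real K / (4 * T) * (norm (u i j - v i j))\<^sup>2)"
      by (subst sum_distrib_left[symmetric]) (use T in simp)
    also have "\<dots> \<le> Q * (\<Sum>j<K. real K / (4 * T) * (norm (u i j - v i j))\<^sup>2)"
      using Q(2) T by (intro mult_right_mono sum_nonneg) auto
    finally show "(?p i + ?q i)\<^sup>2 \<le> Q * ((?p i)\<^sup>2 / (2 * \<kappa>)) + Q * (\<Sum>j<K. real K / (4 * T) * (norm (u i j - v i j))\<^sup>2)"
      by simp
  qed
  also have "\<dots> = Q * ((\<Sum>i<n. (?p i)\<^sup>2 / (2 * \<kappa>)) + (\<Sum>i<n. \<Sum>j<K. real K / (4 * T) * (norm (u i j - v i j))\<^sup>2))"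
    by (simp only: sum.distrib sum_distrib_left distrib_left)
  finally show ?thesis unfolding Q_def s_def .
qed

context
  fixes M :: "'w measure" and T \<kappa> C :: real and n :: nat and \<sigma> :: "real ^ 'd ^ 'd"
    and B :: "nat \<Rightarrow> real \<Rightarrow> 'w \<Rightarrow> real ^ 'd" and \<xi> :: "nat \<Rightarrow> 'w \<Rightarrow> real ^ 'd"
    and \<mu> :: "(real ^ 'd) measure" and \<Psi> :: "(nat \<Rightarrow> real \<Rightarrow> real ^ 'd) \<Rightarrow> real"
  assumes M: "prob_space M" and T: "0 < T" and n: "0 < n" and \<kappa>: "0 < \<kappa>" and C: "0 \<le> C"
    and W: "\<And>i. i < n \<Longrightarrow> std_wiener M T (B i)"
    and iB: "prob_space.indep_vars M (\<lambda>_. Pi\<^sub>M {0..T} (\<lambda>_. borel)) (\<lambda>i \<omega>. \<lambda>t\<in>{0..T}. B i t \<omega>) {..<n}"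
    and \<xi>: "\<And>i. i < n \<Longrightarrow> \<xi> i \<in> borel_measurable M" "\<And>i. i < n \<Longrightarrow> distr M borel (\<xi> i) = \<mu>"
    and i\<xi>: "prob_space.indep_vars M (\<lambda>_. borel) \<xi> {..<n}"
    and ind: "prob_space.indep_set M
       (sets (vimage_algebra (space M) (\<lambda>\<omega>. \<lambda>i\<in>{..<n}. \<xi> i \<omega>) (Pi\<^sub>M {..<n} (\<lambda>_. borel))))
       (sets (vimage_algebra (space M) (\<lambda>\<omega>. \<lambda>i\<in>{..<n}. \<lambda>t\<in>{0..T}. B i t \<omega>)
          (Pi\<^sub>M {..<n} (\<lambda>_. Pi\<^sub>M {0..T} (\<lambda>_. borel)))))"
    and \<mu>: "dual_transport \<mu> (\<lambda>x y. (norm (x - y))\<^sup>2 / (2 * \<kappa>))"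
    and \<Psi>: "path_lipschitz C T n \<Psi>"
begin

text \<open>The dual inequality for the joint law of initial states and increments is applied to the
  pair \<theta> F + e and \<theta> F, which clipping makes bounded. A squared seminorm distance is
  at most \<open>Q\<close> times the cost, so the linear growth of \<theta> F is dominated by the
  cost up to the constant \<open>e\<close>. The resulting bound does not involve
  \<open>K\<close>.\<close>

lemma exp_polygon_functional_le:
  assumes K: "0 < K" and r: "0 \<le> r"
  defines "Y \<equiv> \<lambda>\<omega>. clip r (\<Psi> (\<lambda>i. polygon T K (\<xi> i \<omega>) (\<lambda>j. \<sigma> *v increments T K (\<lambda>t. B i t \<omega>) j)))"
  shows "Y \<in> borel_measurable M"
    and "(\<integral>\<omega>. exp (\<theta> * Y \<omega>) \<partial>M)
      \<le> exp (\<theta> * (\<integral>\<omega>. Y \<omega> \<partial>M) + C\<^sup>2 * (4 * \<kappa> + 8 * (onorm ((*v) \<sigma>))\<^sup>2 * T) / 4 * \<theta>\<^sup>2)"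
proof -
  interpret prob_space M by (rule M)
  define Q where "Q = 4 * \<kappa> + 8 * (onorm ((*v) \<sigma>))\<^sup>2 * T"
  have Q: "0 \<le> Q" using \<kappa> T by (simp add: Q_def)
  define S :: "(nat \<Rightarrow> real ^ 'd) measure" where "S = Pi\<^sub>M {..<n} (\<lambda>_. borel)"
  define U :: "(nat \<Rightarrow> nat \<Rightarrow> real ^ 'd) measure" where "U = Pi\<^sub>M {..<n} (\<lambda>_. Pi\<^sub>M {..<K} (\<lambda>_. borel))"
  define G where "G \<omega> = (\<lambda>i\<in>{..<n}. \<xi> i \<omega>, \<lambda>i\<in>{..<n}. \<lambda>j\<in>{..<K}. increments T K (\<lambda>t. B i t \<omega>) j)" for \<omega>
  define F where "F p = clip r (\<Psi> (\<lambda>i. polygon T K (fst p i) (\<lambda>j. \<sigma> *v snd p i j)))"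
    for p :: "(nat \<Rightarrow> real ^ 'd) \<times> (nat \<Rightarrow> nat \<Rightarrow> real ^ 'd)"
  have [measurable]: "(*v) \<sigma> \<in> borel_measurable borel"
    by (intro borel_measurable_continuous_onI linear_continuous_on matrix_vector_mul_bounded_linear)
  have F[measurable]: "F \<in> borel_measurable (S \<Otimes>\<^sub>M U)"
    unfolding F_def
  proof (intro measurable_compose[OF _ borel_measurable_clip] borel_measurable_polygon_functional[OF T C \<Psi>])
    fix i assume i: "i < n"
    have [measurable]: "(\<lambda>x. x i) \<in> measurable S borel"
      unfolding S_def using i by (intro measurable_component_singleton) simp
    show "(\<lambda>p. fst p i) \<in> borel_measurable (S \<Otimes>\<^sub>M U)" by measurable
    fix j assume j: "j < K"
    have [measurable]: "(\<lambda>x. x i) \<in> measurable U (Pi\<^sub>M {..<K} (\<lambda>_. borel))"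
      unfolding U_def using i by (intro measurable_component_singleton) simp
    have "(\<lambda>p. snd p i j) \<in> borel_measurable (S \<Otimes>\<^sub>M U)"
      by (rule measurable_compose[where f = "\<lambda>p. snd p i" and g = "\<lambda>x. x j" and N = "Pi\<^sub>M {..<K} (\<lambda>_. borel)"])
        (use j in \<open>auto intro: measurable_component_singleton\<close>)
    then show "(\<lambda>p. \<sigma> *v snd p i j) \<in> borel_measurable (S \<Otimes>\<^sub>M U)" by measurable
  qed
  have mB: "B i t \<in> borel_measurable M" if "i < n" "t \<in> {0..T}" for i t
    using W[OF that(1)] that(2) by (simp add: std_wiener_def)
  have G[measurable]: "G \<in> measurable M (S \<Otimes>\<^sub>M U)"
    unfolding G_def S_def U_def
  proof (rule measurable_Pair)
    show "(\<lambda>\<omega>. \<lambda>i\<in>{..<n}. \<xi> i \<omega>) \<in> measurable M (Pi\<^sub>M {..<n} (\<lambda>_. borel))"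
      using \<xi>(1) by (intro measurable_restrict) simp
    show "(\<lambda>\<omega>. \<lambda>i\<in>{..<n}. \<lambda>j\<in>{..<K}. increments T K (\<lambda>t. B i t \<omega>) j)
      \<in> measurable M (Pi\<^sub>M {..<n} (\<lambda>_. Pi\<^sub>M {..<K} (\<lambda>_. borel)))"
      by (rule measurable_restrict) (intro measurable_restrict_increments T K mB, simp_all)
  qed
  have FG: "F (G \<omega>) = Y \<omega>" for \<omega>
    unfolding F_def Y_def
  proof (intro arg_cong[where f = "clip r"] path_lipschitz_cong[OF less_imp_le[OF T] \<Psi> polygon_in_paths polygon_in_paths])
    fix i t assume "i < n"
    then show "polygon T K (fst (G \<omega>) i) (\<lambda>j. \<sigma> *v snd (G \<omega>) i j) t
        = polygon T K (\<xi> i \<omega>) (\<lambda>j. \<sigma> *v increments T K (\<lambda>t. B i t \<omega>) j) t"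
      unfolding polygon_def by (intro arg_cong2[where f = "(+)"] sum.cong) (auto simp: G_def)
  qed
  have "(\<lambda>\<omega>. F (G \<omega>)) \<in> borel_measurable M" by measurable
  then show Y[measurable]: "Y \<in> borel_measurable M" by (simp add: FG)
  \<comment> \<open>The maximum of |\<theta>| C N - N^2 / Q over N when Q is positive; the completed
    square below is this Young inequality multiplied by 4 Q.\<close>
  define e where "e = C\<^sup>2 * Q / 4 * \<theta>\<^sup>2"
  have e: "0 \<le> e" using Q by (simp add: e_def)
  have bF: "\<bar>\<theta> * F p\<bar> \<le> \<bar>\<theta>\<bar> * r" for p
    unfolding abs_mult F_def using r by (intro mult_left_mono abs_clip_le) auto
  have "(\<integral>p. exp (\<theta> * F p) \<partial>distr M (S \<Otimes>\<^sub>M U) G) \<le> exp (\<integral>p. \<theta> * F p + e \<partial>distr M (S \<Otimes>\<^sub>M U) G)"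
  proof (rule dual_transportD)
    show "dual_transport (distr M (S \<Otimes>\<^sub>M U) G) (\<lambda>x y. (\<Sum>i<n. (norm (fst x i - fst y i))\<^sup>2 / (2 * \<kappa>))
        + (\<Sum>i<n. \<Sum>j<K. real K / (4 * T) * (norm (snd x i j - snd y i j))\<^sup>2))"
      using dual_transport_initial_and_increments[OF M T K n W iB \<xi> i\<xi> ind \<mu>]
      unfolding G_def S_def U_def .
  next
    fix x
    show "\<bar>\<theta> * F x\<bar> \<le> \<bar>\<theta>\<bar> * r + e" "\<bar>\<theta> * F x + e\<bar> \<le> \<bar>\<theta>\<bar> * r + e"
      using bF[of x] e by linarith+
  next
    fix x y :: "(nat \<Rightarrow> real ^ 'd) \<times> (nat \<Rightarrow> nat \<Rightarrow> real ^ 'd)"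
    let ?c = "(\<Sum>i<n. (norm (fst x i - fst y i))\<^sup>2 / (2 * \<kappa>))
        + (\<Sum>i<n. \<Sum>j<K. real K / (4 * T) * (norm (snd x i j - snd y i j))\<^sup>2)"
    let ?N = "path_norm T n (\<lambda>i t. polygon T K (fst x i) (\<lambda>j. \<sigma> *v snd x i j) t
        - polygon T K (fst y i) (\<lambda>j. \<sigma> *v snd y i j) t)"
    have c: "0 \<le> ?c" using \<kappa> T by (intro add_nonneg_nonneg sum_nonneg) auto
    have N: "?N\<^sup>2 \<le> Q * ?c" unfolding Q_def by (rule path_norm_polygon_sq_le[OF T K \<kappa>])
    have "\<bar>F x - F y\<bar> \<le> C * ?N"
      unfolding F_def by (rule order_trans[OF abs_clip_diff_le path_lipschitzD[OF \<Psi> polygon_in_paths polygon_in_paths]])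
    then have "\<bar>\<theta>\<bar> * \<bar>F x - F y\<bar> \<le> \<bar>\<theta>\<bar> * (C * ?N)" by (intro mult_left_mono) auto
    moreover have "\<theta> * F x - \<theta> * F y \<le> \<bar>\<theta>\<bar> * \<bar>F x - F y\<bar>"
      unfolding right_diff_distrib[symmetric] abs_mult[symmetric] by (rule abs_ge_self)
    ultimately have "\<theta> * F x - \<theta> * F y \<le> \<bar>\<theta>\<bar> * C * ?N"
      by (simp only: mult.assoc)
    also have "\<dots> \<le> ?c + e"
    proof (cases "Q = 0")
      case True
      then have "?N = 0" using N by simp
      then show ?thesis using c e by simp
    next
      case False
      then have Q: "0 < Q" using Q by simp
      have "0 \<le> (2 * ?N - \<bar>\<theta>\<bar> * C * Q)\<^sup>2" by simp
      then have "4 * Q * (\<bar>\<theta>\<bar> * C * ?N) \<le> 4 * ?N\<^sup>2 + (\<bar>\<theta>\<bar> * C * Q)\<^sup>2"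
        by (simp add: power2_diff algebra_simps)
      also have "\<dots> \<le> 4 * (Q * ?c) + (\<bar>\<theta>\<bar> * C * Q)\<^sup>2" using N by simp
      also have "\<dots> = 4 * Q * (?c + e)"
        by (simp add: e_def power_mult_distrib power2_eq_square[of Q] algebra_simps)
      finally show ?thesis using Q by simp
    qed
    finally show "\<theta> * F x - (\<theta> * F y + e) \<le> ?c" by simp
  qed measurable
  then have "(\<integral>\<omega>. exp (\<theta> * F (G \<omega>)) \<partial>M) \<le> exp (\<integral>\<omega>. \<theta> * F (G \<omega>) + e \<partial>M)"
    by (simp add: integral_distr)
  moreover have "(\<integral>\<omega>. \<theta> * Y \<omega> + e \<partial>M) = \<theta> * (\<integral>\<omega>. Y \<omega> \<partial>M) + e"
  proof -
    have "integrable M Y"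
      unfolding Y_def using Y r by (intro integrable_bounded[of _ r] abs_clip_le) (auto simp: Y_def)
    then show ?thesis using prob_space by simp
  qed
  ultimately show "(\<integral>\<omega>. exp (\<theta> * Y \<omega>) \<partial>M)
      \<le> exp (\<theta> * (\<integral>\<omega>. Y \<omega> \<partial>M) + C\<^sup>2 * (4 * \<kappa> + 8 * (onorm ((*v) \<sigma>))\<^sup>2 * T) / 4 * \<theta>\<^sup>2)"
    by (simp add: FG e_def Q_def)
qed

text \<open>Refinement of the grid at a fixed level \<open>r\<close>, which provides the dominating
  constants. \<open>Y\<close> is a separate measurable function because the noise is continuous only
  almost surely, so that the functional of the driving paths has no evident measurability of its
  own.\<close>

lemma exp_path_functional_le:
  assumes r: "0 \<le> r" and [measurable]: "Y \<in> borel_measurable M"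
    and Y: "AE \<omega> in M. Y \<omega> = \<Psi> (\<lambda>i t. \<xi> i \<omega> + \<sigma> *v B i t \<omega>)"
  shows "(\<integral>\<omega>. exp (\<theta> * clip r (Y \<omega>)) \<partial>M)
      \<le> exp (\<theta> * (\<integral>\<omega>. clip r (Y \<omega>) \<partial>M) + C\<^sup>2 * (4 * \<kappa> + 8 * (onorm ((*v) \<sigma>))\<^sup>2 * T) / 4 * \<theta>\<^sup>2)"
proof -
  interpret prob_space M by (rule M)
  \<comment> \<open>\<open>Suc K\<close>, since the estimate on a grid asks for at least one
    cell.\<close>
  define Z where "Z K \<omega> = clip r (\<Psi> (\<lambda>i. polygon T (Suc K) (\<xi> i \<omega>) (\<lambda>j. \<sigma> *v increments T (Suc K) (\<lambda>t. B i t \<omega>) j)))"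
    for K \<omega>
  have [measurable]: "Z K \<in> borel_measurable M" for K
    unfolding Z_def using r by (intro exp_polygon_functional_le) auto
  have le: "(\<integral>\<omega>. exp (\<theta> * Z K \<omega>) \<partial>M)
      \<le> exp (\<theta> * (\<integral>\<omega>. Z K \<omega> \<partial>M) + C\<^sup>2 * (4 * \<kappa> + 8 * (onorm ((*v) \<sigma>))\<^sup>2 * T) / 4 * \<theta>\<^sup>2)" for K
    unfolding Z_def using r by (intro exp_polygon_functional_le(2)) auto
  have Zb: "\<bar>Z K \<omega>\<bar> \<le> r" for K \<omega> unfolding Z_def using r by (rule abs_clip_le)
  have "AE \<omega> in M. \<forall>i\<in>{..<n}. B i 0 \<omega> = 0 \<and> continuous_on {0..T} (\<lambda>t. B i t \<omega>)"
    using W by (intro AE_finite_allI) (auto simp: std_wiener_def)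
  then have lim: "AE \<omega> in M. (\<lambda>K. Z K \<omega>) \<longlonglongrightarrow> clip r (Y \<omega>)"
    using Y
  proof eventually_elim
    case (elim \<omega>)
    define z where "z i t = \<xi> i \<omega> + \<sigma> *v B i t \<omega>" for i t
    have z: "z \<in> paths T n"
      unfolding paths_def z_def using elim(1)
      by (auto intro!: continuous_intros bounded_linear.continuous_on[OF matrix_vector_mul_bounded_linear])
    \<comment> \<open>The interpolation of the driving path starts at
      \<open>\<xi> i \<omega>\<close> because the noise starts at 0, and linearity of \<sigma> turns
      its increments into those of the noise.\<close>
    have "\<Psi> (\<lambda>i. polygon T (Suc K) (z i 0) (increments T (Suc K) (z i)))
        = \<Psi> (\<lambda>i. polygon T (Suc K) (\<xi> i \<omega>) (\<lambda>j. \<sigma> *v increments T (Suc K) (\<lambda>t. B i t \<omega>) j))" for K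
    proof (rule path_lipschitz_cong[OF less_imp_le[OF T] \<Psi> polygon_in_paths polygon_in_paths])
      fix i t assume "i < n"
      then show "polygon T (Suc K) (z i 0) (increments T (Suc K) (z i)) t
          = polygon T (Suc K) (\<xi> i \<omega>) (\<lambda>j. \<sigma> *v increments T (Suc K) (\<lambda>t. B i t \<omega>) j) t"
        using elim(1) unfolding polygon_def
        by (simp add: z_def increments_def matrix_vector_mult_diff_distrib)
    qed
    then have "(\<lambda>K. \<Psi> (\<lambda>i. polygon T (Suc K) (\<xi> i \<omega>) (\<lambda>j. \<sigma> *v increments T (Suc K) (\<lambda>t. B i t \<omega>) j))) \<longlonglongrightarrow> \<Psi> z"
      using LIMSEQ_Suc[OF path_lipschitz_polygon_tendsto[OF T \<Psi> z]] by simp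
    then have "(\<lambda>K. Z K \<omega>) \<longlonglongrightarrow> clip r (\<Psi> z)"
      unfolding Z_def by (rule isCont_tendsto_compose[OF isCont_clip])
    then show ?case using elim(2) by (simp add: z_def[abs_def])
  qed
  have lim1: "(\<lambda>K. \<integral>\<omega>. exp (\<theta> * Z K \<omega>) \<partial>M) \<longlonglongrightarrow> (\<integral>\<omega>. exp (\<theta> * clip r (Y \<omega>)) \<partial>M)"
  proof (rule integral_dominated_convergence[where w = "\<lambda>_. exp (\<bar>\<theta>\<bar> * r)"])
    show "AE \<omega> in M. (\<lambda>K. exp (\<theta> * Z K \<omega>)) \<longlonglongrightarrow> exp (\<theta> * clip r (Y \<omega>))"
      using lim by eventually_elim (intro tendsto_intros)
    have "\<theta> * Z K \<omega> \<le> \<bar>\<theta>\<bar> * r" for K \<omega>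
      using mult_left_mono[OF Zb, of "\<bar>\<theta>\<bar>" K \<omega>] abs_ge_self[of "\<theta> * Z K \<omega>"] by (simp add: abs_mult)
    then show "AE \<omega> in M. norm (exp (\<theta> * Z K \<omega>)) \<le> exp (\<bar>\<theta>\<bar> * r)" for K by simp
  qed auto
  have "(\<lambda>K. \<integral>\<omega>. Z K \<omega> \<partial>M) \<longlonglongrightarrow> (\<integral>\<omega>. clip r (Y \<omega>) \<partial>M)"
    by (rule integral_dominated_convergence[where w = "\<lambda>_. r"]) (use lim Zb in auto)
  then have lim2: "(\<lambda>K. exp (\<theta> * (\<integral>\<omega>. Z K \<omega> \<partial>M) + C\<^sup>2 * (4 * \<kappa> + 8 * (onorm ((*v) \<sigma>))\<^sup>2 * T) / 4 * \<theta>\<^sup>2))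
    \<longlonglongrightarrow> exp (\<theta> * (\<integral>\<omega>. clip r (Y \<omega>) \<partial>M) + C\<^sup>2 * (4 * \<kappa> + 8 * (onorm ((*v) \<sigma>))\<^sup>2 * T) / 4 * \<theta>\<^sup>2)"
    by (intro tendsto_intros)
  show ?thesis
    by (rule LIMSEQ_le[OF lim1 lim2]) (use le in blast)
qed

end

section \<open>The particle system\<close>

text \<open>The generators, including the null sets of the augmentation, are events of
  \<open>M\<close>; adapted processes are therefore measurable.\<close>

lemma measurable_driving_filtration:
  assumes Y: "Y \<in> borel_measurable (driving_filtration M n \<xi> B t)" and t: "t \<le> T"
    and \<xi>: "\<And>i. i < n \<Longrightarrow> \<xi> i \<in> borel_measurable M"
    and B: "\<And>i s. i < n \<Longrightarrow> s \<in> {0..T} \<Longrightarrow> B i s \<in> borel_measurable M"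
  shows "Y \<in> borel_measurable M"
proof (rule subsetD[OF measurable_mono Y])
  let ?A = "{\<xi> i -` A \<inter> space M |i A. i < n \<and> A \<in> sets borel} \<union>
      {B i s -` A \<inter> space M |i s A. i < n \<and> s \<in> {0..t} \<and> A \<in> sets borel} \<union> null_sets M"
  have A: "?A \<subseteq> sets M"
    using measurable_sets[OF \<xi>] measurable_sets[OF B] t by auto
  show "sets (driving_filtration M n \<xi> B t) \<le> sets M"
    unfolding driving_filtration_def sets_measure_of[OF order_trans[OF A sets.space_closed]]
    by (rule sets.sigma_sets_subset[OF A])
  show "space (driving_filtration M n \<xi> B t) = space M"
    unfolding driving_filtration_def by (rule space_measure_of_conv)
qed simp_all

theorem theorem5p4:
  fixes T L \<kappa>\<^sub>0 :: real
    and \<sigma> :: "real ^ 'd ^ 'd"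
    and b :: "real \<Rightarrow> real ^ 'd \<Rightarrow> (real ^ 'd) measure \<Rightarrow> real ^ 'd"
    and \<mu>\<^sub>0 :: "(real ^ 'd) measure"
  assumes T: "0 < T"
    and b_measurable: "(\<lambda>(t, x, m). b t x m) \<in>
          borel_measurable (restrict_space borel {0..T} \<Otimes>\<^sub>M borel \<Otimes>\<^sub>M wasserstein_borel 2)"
    and L: "0 \<le> L"
    and b_lipschitz: "\<And>t x x' m m'. t \<in> {0..T} \<Longrightarrow> m \<in> prob_moment 2 \<Longrightarrow> m' \<in> prob_moment 2 \<Longrightarrow>
          ennreal (norm (b t x m - b t x' m'))
            \<le> ennreal L * (ennreal (norm (x - x')) + wasserstein 2 m m')"
    and b_bounded: "bdd_above ((\<lambda>t. norm (b t 0 (return borel 0))) ` {0..T})"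
    and \<mu>\<^sub>0: "\<mu>\<^sub>0 \<in> prob_moment 2"
    and \<kappa>\<^sub>0: "0 \<le> \<kappa>\<^sub>0"
    \<comment> \<open>if the relative entropy is infinite, the right-hand side below is infinite\<close>
    and transport: "\<And>\<nu>. prob_space \<nu> \<Longrightarrow> sets \<nu> = sets borel \<Longrightarrow> absolutely_continuous \<mu>\<^sub>0 \<nu> \<Longrightarrow>
          rel_entropy \<nu> \<mu>\<^sub>0 \<noteq> \<infinity> \<Longrightarrow>
          wasserstein 2 \<mu>\<^sub>0 \<nu> \<le> ennreal (sqrt (2 * \<kappa>\<^sub>0 * real_of_ereal (rel_entropy \<nu> \<mu>\<^sub>0)))"
  shows "\<exists>\<delta>>0. \<forall>n\<ge>1. \<forall>(M :: 'w measure) B X. particle_system T \<sigma> b \<mu>\<^sub>0 n M B X \<longrightarrow>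
          (\<forall>a>0. \<forall>\<Phi>. lipschitz1_paths T n \<Phi> \<longrightarrow>
             measure M {\<omega> \<in> space M.
               \<Phi> (\<lambda>i t. X i t \<omega>) - integral\<^sup>L M (\<lambda>\<omega>'. \<Phi> (\<lambda>i t. X i t \<omega>')) > a}
             \<le> 2 * exp (- \<delta> * a\<^sup>2))"
proof -
  \<comment> \<open>\<open>\<kappa>\<^sub>0 = 0\<close> is allowed, whereas the dual cost divides by
    the constant; enlarging it weakens the inequality.\<close>
  define \<kappa> where "\<kappa> = \<kappa>\<^sub>0 + 1"
  have \<kappa>: "0 < \<kappa>" using \<kappa>\<^sub>0 by (simp add: \<kappa>_def)
  \<comment> \<open>The Lipschitz constant of the solution as a function of the driving paths; it
    involves only \<open>L\<close> and \<open>T\<close>.\<close>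
  define C where "C = 2 * exp (4 * (L + 1) * T)"
  have C: "0 < C" by (simp add: C_def)
  define c where "c = C\<^sup>2 * (4 * \<kappa> + 8 * (onorm ((*v) \<sigma>))\<^sup>2 * T) / 4"
  have c: "0 < c" using C \<kappa> T by (simp add: c_def add_pos_nonneg)
  have \<mu>: "dual_transport \<mu>\<^sub>0 (\<lambda>x y. (norm (x - y))\<^sup>2 / (2 * \<kappa>))"
    using \<mu>\<^sub>0 \<kappa>\<^sub>0 \<kappa> transport
    by (intro dual_transport_of_wasserstein[of \<mu>\<^sub>0 \<kappa>\<^sub>0]) (auto simp: prob_moment_def \<kappa>_def)
  have "measure M {\<omega> \<in> space M. \<Phi> (\<lambda>i t. X i t \<omega>) - integral\<^sup>L M (\<lambda>\<omega>'. \<Phi> (\<lambda>i t. X i t \<omega>')) > a}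
      \<le> 2 * exp (- (1 / (4 * c)) * a\<^sup>2)"
    if n: "1 \<le> n" and sys: "particle_system T \<sigma> b \<mu>\<^sub>0 n M B X" and a: "0 < a" and \<Phi>: "lipschitz1_paths T n \<Phi>"
    for n and M :: "'w measure" and B X a \<Phi>
  proof -
    note sys = sys[unfolded particle_system_def]
    have M: "prob_space M" using sys by blast
    interpret prob_space M by (rule M)
    have W: "std_wiener M T (B i)" if "i < n" for i using sys that by blast
    have X0: "X i 0 \<in> borel_measurable M" if "i < n" for i using sys that by blast
    have mB: "B i t \<in> borel_measurable M" if "i < n" "t \<in> {0..T}" for i t
      using W[OF that(1)] that(2) by (simp add: std_wiener_def)
    have mX: "X i t \<in> borel_measurable M" if "i < n" "t \<in> {0..T}" for i t
    proof (rule measurable_driving_filtration[where T = T])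
      show "X i t \<in> borel_measurable (driving_filtration M n (\<lambda>i. X i 0) B t)"
        using sys that by blast
    qed (use that X0 mB in auto)
    have pX: "(\<lambda>i t. X i t \<omega>) \<in> paths T n" if "\<omega> \<in> space M" for \<omega>
      using sys that unfolding paths_def by blast
    define Y where "Y \<omega> = \<Phi> (\<lambda>i t. X i t \<omega>)" for \<omega>
    have Y[measurable]: "Y \<in> borel_measurable M"
      unfolding Y_def
      by (rule borel_measurable_path_functional[where Y = X and \<Psi> = \<Phi>, OF T zero_le_one _ pX mX])
        (use \<Phi> in \<open>simp_all add: lipschitz1_paths_iff\<close>)
    define drift where "drift \<omega> i s = b s (X i s \<omega>) (empirical n (\<lambda>j. X j s \<omega>))" for \<omega> i s
    define z where "z \<omega> i t = X i 0 \<omega> + \<sigma> *v B i t \<omega>" for \<omega> i t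
    \<comment> \<open>The stability estimate compares two outcomes and uses the equation along both,
      so everything required of a single outcome is collected here. That almost every outcome is
      good also shows that one exists, as the infimum in McShane's formula demands.\<close>
    define good where "good \<omega> \<longleftrightarrow> \<omega> \<in> space M \<and> z \<omega> \<in> paths T n \<and>
      (\<forall>i<n. \<forall>t\<in>{0..T}. set_integrable lborel {0..t} (drift \<omega> i) \<and>
        X i t \<omega> = z \<omega> i t + (LINT s:{0..t}|lborel. drift \<omega> i s))" for \<omega>
    have "AE \<omega> in M. \<forall>i\<in>{..<n}. continuous_on {0..T} (\<lambda>t. B i t \<omega>)"
      using W by (intro AE_finite_allI) (auto simp: std_wiener_def)
    moreover have "AE \<omega> in M. \<forall>i<n. \<forall>t\<in>{0..T}. set_integrable lborel {0..t} (drift \<omega> i) \<and>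
        X i t \<omega> = X i 0 \<omega> + (LINT s:{0..t}|lborel. drift \<omega> i s) + \<sigma> *v B i t \<omega>"
      using sys unfolding drift_def by blast
    ultimately have good: "AE \<omega> in M. good \<omega>"
      using AE_space
    proof eventually_elim
      case (elim \<omega>)
      have z: "z \<omega> \<in> paths T n"
        unfolding paths_def z_def using elim(1)
        by (auto intro!: continuous_intros bounded_linear.continuous_on[OF matrix_vector_mul_bounded_linear])
      show ?case
        unfolding good_def
      proof (intro conjI allI impI ballI)
        fix i t assume i: "i < n" and t: "t \<in> {0..T}"
        show "set_integrable lborel {0..t} (drift \<omega> i)"
          using elim(2) i t by blast
        have "X i t \<omega> = X i 0 \<omega> + (LINT s:{0..t}|lborel. drift \<omega> i s) + \<sigma> *v B i t \<omega>"
          using elim(2) i t by blast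
        then show "X i t \<omega> = z \<omega> i t + (LINT s:{0..t}|lborel. drift \<omega> i s)"
          by (simp only: z_def ac_simps)
      qed (fact elim(3) z)+
    qed
    have "Collect good \<noteq> {}"
    proof
      assume "Collect good = {}"
      then have "AE \<omega> in M. False" using good by simp
      then show False by simp
    qed
    moreover have "\<bar>Y \<omega> - Y \<omega>'\<bar> \<le> C * path_norm T n (\<lambda>i t. z \<omega> i t - z \<omega>' i t)"
      if "\<omega> \<in> Collect good" "\<omega>' \<in> Collect good" for \<omega> \<omega>'
    proof -
      have g: "good \<omega>" "good \<omega>'" using that by auto
      then have s: "\<omega> \<in> space M" "\<omega>' \<in> space M" by (auto simp: good_def)
      have "\<bar>Y \<omega> - Y \<omega>'\<bar> \<le> path_norm T n (\<lambda>i t. X i t \<omega> - X i t \<omega>')"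
        using \<Phi> pX[OF s(1)] pX[OF s(2)] unfolding lipschitz1_paths_def Y_def by blast
      also have "\<dots> \<le> C * path_norm T n (\<lambda>i t. z \<omega> i t - z \<omega>' i t)"
        unfolding C_def using n g pX[OF s(1)] pX[OF s(2)]
        by (intro integral_equation_stable[OF T L _ b_lipschitz]) (auto simp: good_def drift_def[abs_def])
      finally show ?thesis .
    qed
    ultimately obtain \<Psi> where \<Psi>: "path_lipschitz C T n \<Psi>" "\<And>\<omega>. \<omega> \<in> Collect good \<Longrightarrow> \<Psi> (z \<omega>) = Y \<omega>"
      using T C by (rule_tac path_lipschitz_extension[of T C "Collect good" z n Y]) (auto simp: good_def)
    \<comment> \<open>The extension agrees with \<Phi>(X) only along good outcomes. This suffices,
      since the Laplace transform ignores null sets.\<close>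
    have ae: "AE \<omega> in M. Y \<omega> = \<Psi> (\<lambda>i t. X i 0 \<omega> + \<sigma> *v B i t \<omega>)"
      using good by eventually_elim (use \<Psi>(2) in \<open>simp add: z_def[abs_def]\<close>)
    have "(\<integral>\<omega>. exp (\<theta> * clip (real k) (Y \<omega>)) \<partial>M)
        \<le> exp (\<theta> * (\<integral>\<omega>. clip (real k) (Y \<omega>) \<partial>M) + c * \<theta>\<^sup>2)" for k :: nat and \<theta>
      unfolding c_def
      by (rule exp_path_functional_le[where \<xi> = "\<lambda>i. X i 0" and B = B and \<mu> = \<mu>\<^sub>0, OF M T _ \<kappa> _ _ _ _ _ _ _ \<mu> \<Psi>(1) _ Y ae])
        (use n C sys in auto)
    note sub = subgaussian_of_clip(2)[OF Y this]
    have "measure M {\<omega> \<in> space M. Y \<omega> - (\<integral>\<omega>. Y \<omega> \<partial>M) > a} \<le> exp (- (1 / (4 * c)) * a\<^sup>2)"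
      by (rule prob_gt_le_of_subgaussian[OF Y c a sub])
    also have "\<dots> \<le> 2 * exp (- (1 / (4 * c)) * a\<^sup>2)" by simp
    finally show ?thesis by (simp add: Y_def)
  qed
  then show ?thesis using c by (intro exI[of _ "1 / (4 * c)"]) auto
qed

end
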